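(* Let $Q$ be a smooth manifold and let $R_d$ be a discretization map on $Q$, with tangent lift $R_d^T$ and cotangent lift $R_d^{T^*}$. Then $$\bigl\langle\Phi(\alpha_{q_0},\alpha_{q_1}),\,R_d^{T}(w)\bigr\rangle=\bigl\langle (R_d^{T^*})^{-1}(\alpha_{q_0},\alpha_{q_1}),\,w\bigr\rangle^{T}$$ for $\alpha_{q_0}\in T^*_{q_0}Q$, $\alpha_{q_1}\in T^*_{q_1}Q$ and $w\in TTQ$ with $(R_d)^{-1}(q_0,q_1)=T\tau_Q(w)$.
   Context: Discretization map: let $M$ be a smooth manifold and $U\subset TM$ an open neighborhood of the zero section. A smooth map $R_d\colon U\to M\times M$, $R_d(x,v)=(R^1(x,v),R^2(x,v))$, is a discretization map on $M$ if (1) $R_d(x,0)=(x,x)$ for all $x\in M$; and (2) for every $x\in M$, $T_{0_x}R^2_x-T_{0_x}R^1_x\colon T_{0_x}T_xM\simeq T_xM\to T_xM$ is the identity map of $T_xM$, where $R^a_x$ is the restriction of $R^a$ to (the part in $U$ of) $T_xM$, $a=1,2$. Every discretization map is a local diffeomorphism near the zero section; $R_d^{-1}$ and $(R_d^{T^*})^{-1}$ denote the inverses on domains where these maps are restricted to be diffeomorphisms onto their images (with $(R_d^{T^*})^{-1}=\alpha_Q^{-1}\circ\widehat{R_d}^{-1}\circ\Phi$), and $(q_0,q_1)$ is in the corresponding domain. Notation: $\tau_Q\colon TQ\to Q$, $\pi_Q\colon T^*Q\to Q$, $\tau_{TQ}\colon TTQ\to TQ$ are the canonical projections. - $\kappa_Q\colon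 TTQ\to TTQ$ is the canonical involution, locally $\kappa_Q(q,v,\dot q,\dot v)=(q,\dot q,v,\dot v)$. Tangent lift: $R_d^T=TR_d\circ\kappa_Q$, with values in $T(Q\times Q)\equiv TQ\times TQ$. - $\alpha_Q\colon TT^*Q\to T^*TQ$ is the canonical diffeomorphism, locally $\alpha_Q(q,p,\dot q,\dot p)=(q,\dot q,\dot p,p)$ in coordinates $(q,v,p_q,p_v)$ of $T^*TQ$. - For a (local) diffeomorphism $F\colon M_1\to M_2$, $\widehat F\colon T^*M_1\to T^*M_2$ is $\widehat F(\alpha_x)=\alpha_x\circ(T_xF)^{-1}\in T^*_{F(x)}M_2$. - $\Phi\colon T^*Q\times T^*Q\to T^*(Q\times Q)$, $\Phi(q_0,p_0;q_1,p_1)=(q_0,q_1,-p_0,p_1)$. - Cotangent lift: $R_d^{T^*}=\Phi^{-1}\circ\widehat{R_d}\circ\alpha_Q$, defined near the zero section of $TT^*Q\to T^*Q$ with values in $T^*Q\times T^*Q$. Pairings: on the left-hand side $\langle\cdot,\cdot\rangle$ is the natural pairing of $T^*_{(q_0,q_1)}(Q\times Q)$ with $T_{(q_0,q_1)}(Q\times Q)$. The pairing $\langle\cdot,\cdot\rangle^T$ (induced by the symplectic structure of $TT^*Q$) is defined as follows: for $v\in TT^*Q$ and $w\in TTQ$ with $\tau_{TQ}(w)=T\pi_Q(v)$, $$\langle v,\kappa_Q(w)\rangle^T=\frac{d}{dt}\Big|_{t=0}\langle\sigma_v(t),\gamma_{\tilde w}(t)\rangle=\langle\alpha_Q(v),w\rangle,$$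 where $\tilde w=\kappa_Q(w)$ and $\sigma_v\colon I\to T^*Q$, $\gamma_{\tilde w}\colon I\to TQ$ are curves with $\dot\sigma_v(0)=v$, $\dot\gamma_{\tilde w}(0)=\tilde w$ and $\pi_Q\circ\sigma_v=\tau_Q\circ\gamma_{\tilde w}$. Thus $\langle v,\tilde w\rangle^T$ is defined whenever $T\pi_Q(v)=T\tau_Q(\tilde w)$. *)

theory Defs
  imports "HOL-Analysis.Analysis"
begin

section \<open>Smooth maps between finite-dimensional vector spaces\<close>

text \<open>
  Only used on open subsets of finite-dimensional spaces, where requiring that all directional
  derivatives be of class \<open>C^k\<close> is the usual definition of class \<open>C^(k+1)\<close>.
\<close>

primrec Ck_on :: "nat \<Rightarrow> 'a::real_normed_vector set \<Rightarrow> ('a \<Rightarrow> 'b::real_normed_vector) \<Rightarrow> bool" where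
  "Ck_on 0 S f \<longleftrightarrow> continuous_on S f"
| "Ck_on (Suc k) S f \<longleftrightarrow>
     (\<forall>x\<in>S. f differentiable (at x)) \<and>
     (\<forall>v. Ck_on k S (\<lambda>x. frechet_derivative f (at x) v))"

definition smooth_on :: "'a::real_normed_vector set \<Rightarrow> ('a \<Rightarrow> 'b::real_normed_vector) \<Rightarrow> bool" where
  "smooth_on S f \<longleftrightarrow> (\<forall>k. Ck_on k S f)"


section \<open>Manifolds\<close>

text \<open>
  A manifold is given by an atlas (not necessarily maximal). A chart is its domain together with
  a coordinate map, whose values outside the domain are irrelevant. The model space \<open>'e\<close> is a
  finite-dimensional inner product space. The sort is \<^class>\<open>real_inner\<close>, with finite
  dimension as an explicit hypothesis, because \<^class>\<open>euclidean_space\<close> would exclude dimension 0.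
\<close>

type_synonym ('a, 'e) chart = "'a set \<times> ('a \<Rightarrow> 'e)"
type_synonym ('a, 'e) atlas = "('a, 'e) chart set"

definition points :: "('a, 'e) atlas \<Rightarrow> 'a set" where
  "points M = (\<Union>c\<in>M. fst c)"

definition chart_inv :: "('a, 'e) chart \<Rightarrow> 'e \<Rightarrow> 'a" where
  "chart_inv c = inv_into (fst c) (snd c)"

definition charts_at :: "('a, 'e) atlas \<Rightarrow> 'a \<Rightarrow> ('a, 'e) chart set" where
  "charts_at M x = {c \<in> M. x \<in> fst c}"

definition manifold_topology :: "('a, 'e::real_inner) atlas \<Rightarrow> 'a topology" where
  "manifold_topology M =
     topology (\<lambda>W. W \<subseteq> points M \<and> (\<forall>c\<in>M. open (snd c ` (W \<inter> fst c))))"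

definition smooth_atlas :: "('a, 'e::real_inner) atlas \<Rightarrow> bool" where
  "smooth_atlas M \<longleftrightarrow>
     (\<forall>c\<in>M. inj_on (snd c) (fst c)) \<and>
     (\<forall>c\<in>M. \<forall>c'\<in>M. open (snd c ` (fst c \<inter> fst c')) \<and>
        smooth_on (snd c ` (fst c \<inter> fst c')) (snd c' \<circ> chart_inv c))"

definition second_countable_space :: "'a topology \<Rightarrow> bool" where
  "second_countable_space X \<longleftrightarrow>
     (\<exists>\<B>. countable \<B> \<and> (\<forall>V\<in>\<B>. openin X V) \<and>
        (\<forall>W x. openin X W \<and> x \<in> W \<longrightarrow> (\<exists>V\<in>\<B>. x \<in> V \<and> V \<subseteq> W)))"

definition smooth_manifold :: "('a, 'e::real_inner) atlas \<Rightarrow> bool" where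
  "smooth_manifold M \<longleftrightarrow>
     (\<exists>B::'e set. finite B \<and> span B = UNIV) \<and>
     smooth_atlas M \<and>
     Hausdorff_space (manifold_topology M) \<and>
     second_countable_space (manifold_topology M)"

definition prod_atlas ::
    "('a, 'e::real_inner) atlas \<Rightarrow> ('b, 'f::real_inner) atlas \<Rightarrow> ('a \<times> 'b, 'e \<times> 'f) atlas" where
  "prod_atlas M N = {(fst c \<times> fst d, map_prod (snd c) (snd d)) | c d. c \<in> M \<and> d \<in> N}"

definition real_atlas :: "(real, real) atlas" where
  "real_atlas = {(UNIV, \<lambda>t. t)}"

definition smooth_map ::
    "('a, 'e::real_inner) atlas \<Rightarrow> ('b, 'f::real_inner) atlas \<Rightarrow> 'a set \<Rightarrow> ('a \<Rightarrow> 'b) \<Rightarrow> bool" where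
  "smooth_map M N W f \<longleftrightarrow>
     openin (manifold_topology M) W \<and> f ` W \<subseteq> points N \<and>
     (\<forall>x\<in>W. \<exists>c\<in>charts_at M x. \<exists>d\<in>charts_at N (f x). \<exists>V.
        openin (manifold_topology M) V \<and> x \<in> V \<and> V \<subseteq> W \<inter> fst c \<and> f ` V \<subseteq> fst d \<and>
        smooth_on (snd c ` V) (snd d \<circ> f \<circ> chart_inv c))"

definition diffeomorphism_on ::
    "('a, 'e::real_inner) atlas \<Rightarrow> ('b, 'f::real_inner) atlas \<Rightarrow> 'a set \<Rightarrow> ('a \<Rightarrow> 'b) \<Rightarrow> bool" where
  "diffeomorphism_on M N V f \<longleftrightarrow>
     inj_on f V \<and> smooth_map M N V f \<and> smooth_map N M (f ` V) (inv_into V f)"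


section \<open>Tangent bundle\<close>

text \<open>
  A tangent vector at \<open>x\<close> is \<open>x\<close> together with its representatives in all charts at \<open>x\<close>, related
  by the derivatives of the chart transitions. The representative is set to 0 at every other
  chart, so that the vector space operations are pointwise.
\<close>

type_synonym ('a, 'e) tvec = "'a \<times> (('a, 'e) chart \<Rightarrow> 'e)"

definition tangent_space :: "('a, 'e::real_inner) atlas \<Rightarrow> 'a \<Rightarrow> ('a, 'e) tvec set" where
  "tangent_space M x =
     {(x, \<xi>) | \<xi>. x \<in> points M \<and> (\<forall>c. c \<notin> charts_at M x \<longrightarrow> \<xi> c = 0) \<and>
        (\<forall>c\<in>charts_at M x. \<forall>c'\<in>charts_at M x.
           \<xi> c' = frechet_derivative (snd c' \<circ> chart_inv c) (at (snd c x)) (\<xi> c))}"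

definition tvec_zero :: "'a \<Rightarrow> ('a, 'e::real_inner) tvec" where
  "tvec_zero x = (x, \<lambda>_. 0)"

definition tvec_add :: "('a, 'e::real_inner) tvec \<Rightarrow> ('a, 'e) tvec \<Rightarrow> ('a, 'e) tvec" where
  "tvec_add u v = (fst u, \<lambda>c. snd u c + snd v c)"

definition tvec_diff :: "('a, 'e::real_inner) tvec \<Rightarrow> ('a, 'e) tvec \<Rightarrow> ('a, 'e) tvec" where
  "tvec_diff u v = (fst u, \<lambda>c. snd u c - snd v c)"

definition tvec_scale :: "real \<Rightarrow> ('a, 'e::real_inner) tvec \<Rightarrow> ('a, 'e) tvec" where
  "tvec_scale r u = (fst u, \<lambda>c. r *\<^sub>R snd u c)"

text \<open>
  The bundle projections \<open>TM \<rightarrow> M\<close> and (below) \<open>T*M \<rightarrow> M\<close> are \<^const>\<open>fst\<close>.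
\<close>

definition tangent_chart ::
    "('a, 'e::real_inner) atlas \<Rightarrow> ('a, 'e) chart \<Rightarrow> (('a, 'e) tvec, 'e \<times> 'e) chart" where
  "tangent_chart M c = (\<Union>x\<in>fst c. tangent_space M x, \<lambda>v. (snd c (fst v), snd v c))"

definition tangent_bundle ::
    "('a, 'e::real_inner) atlas \<Rightarrow> (('a, 'e) tvec, 'e \<times> 'e) atlas" where
  "tangent_bundle M = tangent_chart M ` M"

text \<open>
  The tangent map is determined by its local expression in all charts at the point and its image.
  It depends only on the germ of \<open>f\<close>, so \<open>f\<close> need not be defined on all of \<open>M\<close>.
\<close>

definition tangent_map ::
    "('a, 'e::real_inner) atlas \<Rightarrow> ('b, 'f::real_inner) atlas \<Rightarrow> ('a \<Rightarrow> 'b) \<Rightarrow>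
     ('a, 'e) tvec \<Rightarrow> ('b, 'f) tvec" where
  "tangent_map M N f v =
     (THE u. u \<in> tangent_space N (f (fst v)) \<and>
        (\<forall>c\<in>charts_at M (fst v). \<forall>d\<in>charts_at N (f (fst v)).
           snd u d = frechet_derivative (snd d \<circ> f \<circ> chart_inv c) (at (snd c (fst v))) (snd v c)))"

definition velocity :: "('a, 'e::real_inner) atlas \<Rightarrow> (real \<Rightarrow> 'a) \<Rightarrow> real \<Rightarrow> ('a, 'e) tvec" where
  "velocity M \<gamma> t =
     (\<gamma> t, \<lambda>c. if c \<in> charts_at M (\<gamma> t) then vector_derivative (snd c \<circ> \<gamma>) (at t) else 0)"


section \<open>Cotangent bundle\<close>

text \<open>
  A covector at \<open>x\<close> is \<open>x\<close> together with a linear functional on the tangent space at \<open>x\<close>,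
  extended by 0 to the whole type.
\<close>

type_synonym ('a, 'e) cotvec = "'a \<times> (('a, 'e) tvec \<Rightarrow> real)"

definition cotangent_space :: "('a, 'e::real_inner) atlas \<Rightarrow> 'a \<Rightarrow> ('a, 'e) cotvec set" where
  "cotangent_space M x =
     {(x, \<phi>) | \<phi>. x \<in> points M \<and> (\<forall>v. v \<notin> tangent_space M x \<longrightarrow> \<phi> v = 0) \<and>
        (\<forall>u\<in>tangent_space M x. \<forall>v\<in>tangent_space M x. \<phi> (tvec_add u v) = \<phi> u + \<phi> v) \<and>
        (\<forall>r. \<forall>v\<in>tangent_space M x. \<phi> (tvec_scale r v) = r * \<phi> v)}"

definition pairing :: "('a, 'e) cotvec \<Rightarrow> ('a, 'e) tvec \<Rightarrow> real" where
  "pairing \<alpha> v = snd \<alpha> v"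

text \<open>
  The fibre coordinates \<open>p\<close> of a covector are those with \<open>\<alpha>(v) = p \<bullet> v\<close> in the given chart;
  for \<open>'e = \<real>^n\<close> they are the usual \<open>(p_1, \<dots>, p_n)\<close>.
\<close>

definition cotangent_chart ::
    "('a, 'e::real_inner) atlas \<Rightarrow> ('a, 'e) chart \<Rightarrow> (('a, 'e) cotvec, 'e \<times> 'e) chart" where
  "cotangent_chart M c =
     (\<Union>x\<in>fst c. cotangent_space M x,
      \<lambda>\<alpha>. (snd c (fst \<alpha>), THE p. \<forall>v\<in>tangent_space M (fst \<alpha>). pairing \<alpha> v = p \<bullet> snd v c))"

definition cotangent_bundle ::
    "('a, 'e::real_inner) atlas \<Rightarrow> (('a, 'e) cotvec, 'e \<times> 'e) atlas" where
  "cotangent_bundle M = cotangent_chart M ` M"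

text \<open>The map \<open>\<alpha>\<^sub>x \<mapsto> \<alpha>\<^sub>x \<circ> (T\<^sub>xF)\<^sup>-\<^sup>1\<close>.\<close>

definition cotangent_push ::
    "('a, 'e::real_inner) atlas \<Rightarrow> ('b, 'f::real_inner) atlas \<Rightarrow> ('a \<Rightarrow> 'b) \<Rightarrow>
     ('a, 'e) cotvec \<Rightarrow> ('b, 'f) cotvec" where
  "cotangent_push M N F \<alpha> =
     (F (fst \<alpha>),
      \<lambda>w. if w \<in> tangent_space N (F (fst \<alpha>))
          then pairing \<alpha> (inv_into (tangent_space M (fst \<alpha>)) (tangent_map M N F) w) else 0)"

text \<open>
  \<open>(q\<^sub>0, p\<^sub>0; q\<^sub>1, p\<^sub>1) \<mapsto> (q\<^sub>0, q\<^sub>1, -p\<^sub>0, p\<^sub>1)\<close>, where a pair of covectors acts on tangent vectors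
  of the product through the tangent maps of the two projections.
\<close>

definition Phi ::
    "('a, 'e::real_inner) atlas \<Rightarrow> ('a, 'e) cotvec \<times> ('a, 'e) cotvec \<Rightarrow>
     ('a \<times> 'a, 'e \<times> 'e) cotvec" where
  "Phi Q = (\<lambda>(\<alpha>0, \<alpha>1).
     ((fst \<alpha>0, fst \<alpha>1),
      \<lambda>z. if z \<in> tangent_space (prod_atlas Q Q) (fst \<alpha>0, fst \<alpha>1)
          then - pairing \<alpha>0 (tangent_map (prod_atlas Q Q) Q fst z)
               + pairing \<alpha>1 (tangent_map (prod_atlas Q Q) Q snd z)
          else 0))"


section \<open>The canonical maps on \<open>TTQ\<close> and \<open>TT*Q\<close>\<close>

text \<open>
  Both are determined by the prescribed local expression in every induced chart around
  the argument.
\<close>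

definition canonical_involution ::
    "('a, 'e::real_inner) atlas \<Rightarrow>
     (('a, 'e) tvec, 'e \<times> 'e) tvec \<Rightarrow> (('a, 'e) tvec, 'e \<times> 'e) tvec" where
  "canonical_involution Q w =
     (THE w'. \<forall>c\<in>Q. let C = tangent_chart (tangent_bundle Q) (tangent_chart Q c) in
        w \<in> fst C \<longrightarrow>
        w' \<in> fst C \<and> (case snd C w of ((q, v), (dq, dv)) \<Rightarrow> snd C w' = ((q, dq), (v, dv))))"

definition alpha_map ::
    "('a, 'e::real_inner) atlas \<Rightarrow>
     (('a, 'e) cotvec, 'e \<times> 'e) tvec \<Rightarrow> (('a, 'e) tvec, 'e \<times> 'e) cotvec" where
  "alpha_map Q v =
     (THE \<beta>. \<forall>c\<in>Q.
        let C = tangent_chart (cotangent_bundle Q) (cotangent_chart Q c);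
            D = cotangent_chart (tangent_bundle Q) (tangent_chart Q c) in
        v \<in> fst C \<longrightarrow>
        \<beta> \<in> fst D \<and> (case snd C v of ((q, p), (dq, dp)) \<Rightarrow> snd D \<beta> = ((q, dq), (dp, p))))"

text \<open>
  The tangent pairing of \<open>v \<in> TT*Q\<close> with \<open>w \<in> TTQ\<close>, for \<open>v\<close> and \<open>w\<close> with the same image in \<open>TQ\<close>
  under the tangent maps of the projections \<open>T*Q \<rightarrow> Q\<close> and \<open>TQ \<rightarrow> Q\<close>.
\<close>

definition tangent_pairing ::
    "('a, 'e::real_inner) atlas \<Rightarrow>
     (('a, 'e) cotvec, 'e \<times> 'e) tvec \<Rightarrow> (('a, 'e) tvec, 'e \<times> 'e) tvec \<Rightarrow> real" where
  "tangent_pairing Q v w =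
     (THE d. \<exists>I \<sigma> \<gamma>. is_interval I \<and> open I \<and> 0 \<in> I \<and>
        smooth_map real_atlas (cotangent_bundle Q) I \<sigma> \<and>
        smooth_map real_atlas (tangent_bundle Q) I \<gamma> \<and>
        velocity (cotangent_bundle Q) \<sigma> 0 = v \<and>
        velocity (tangent_bundle Q) \<gamma> 0 = w \<and>
        (\<forall>t\<in>I. fst (\<sigma> t) = fst (\<gamma> t)) \<and>
        ((\<lambda>t. pairing (\<sigma> t) (\<gamma> t)) has_real_derivative d) (at 0))"


section \<open>Discretization maps and their lifts\<close>

text \<open>
  The tangent space at \<open>x\<close> as a manifold, and the identification of a vector \<open>v\<close> in it with the
  tangent vector at \<open>0\<^sub>x\<close> that is the velocity of the line \<open>t \<mapsto> t v\<close>.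
\<close>

definition fibre_atlas :: "('a, 'e::real_inner) atlas \<Rightarrow> 'a \<Rightarrow> (('a, 'e) tvec, 'e) atlas" where
  "fibre_atlas M x = (\<lambda>c. (tangent_space M x, \<lambda>v. snd v c)) ` charts_at M x"

definition fibre_tangent ::
    "('a, 'e::real_inner) atlas \<Rightarrow> 'a \<Rightarrow> ('a, 'e) tvec \<Rightarrow> (('a, 'e) tvec, 'e) tvec" where
  "fibre_tangent M x v = velocity (fibre_atlas M x) (\<lambda>t. tvec_scale t v) 0"

definition discretization_map ::
    "('a, 'e::real_inner) atlas \<Rightarrow> ('a, 'e) tvec set \<Rightarrow> (('a, 'e) tvec \<Rightarrow> 'a \<times> 'a) \<Rightarrow> bool" where
  "discretization_map M U R \<longleftrightarrow>
     openin (manifold_topology (tangent_bundle M)) U \<and>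
     (\<forall>x\<in>points M. tvec_zero x \<in> U) \<and>
     smooth_map (tangent_bundle M) (prod_atlas M M) U R \<and>
     (\<forall>x\<in>points M. R (tvec_zero x) = (x, x)) \<and>
     (\<forall>x\<in>points M. \<forall>v\<in>tangent_space M x.
        tvec_diff (tangent_map (fibre_atlas M x) M (snd \<circ> R) (fibre_tangent M x v))
                  (tangent_map (fibre_atlas M x) M (fst \<circ> R) (fibre_tangent M x v)) = v)"

definition tangent_lift ::
    "('a, 'e::real_inner) atlas \<Rightarrow> (('a, 'e) tvec \<Rightarrow> 'a \<times> 'a) \<Rightarrow>
     (('a, 'e) tvec, 'e \<times> 'e) tvec \<Rightarrow> ('a \<times> 'a, 'e \<times> 'e) tvec" where
  "tangent_lift Q R w =
     tangent_map (tangent_bundle Q) (prod_atlas Q Q) R (canonical_involution Q w)"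

definition cotangent_lift ::
    "('a, 'e::real_inner) atlas \<Rightarrow> (('a, 'e) tvec \<Rightarrow> 'a \<times> 'a) \<Rightarrow>
     (('a, 'e) cotvec, 'e \<times> 'e) tvec \<Rightarrow> ('a, 'e) cotvec \<times> ('a, 'e) cotvec" where
  "cotangent_lift Q R v =
     inv_into (points (cotangent_bundle Q) \<times> points (cotangent_bundle Q)) (Phi Q)
       (cotangent_push (tangent_bundle Q) (prod_atlas Q Q) R (alpha_map Q v))"

text \<open>
  If \<open>R\<close> is a diffeomorphism from \<open>V\<close> onto its image, then its cotangent lift is one from the
  set below, i.e. from the preimage of \<open>T*V\<close> under \<^const>\<open>alpha_map\<close>.
\<close>

definition cotangent_lift_domain ::
    "('a, 'e::real_inner) atlas \<Rightarrow> ('a, 'e) tvec set \<Rightarrow> (('a, 'e) cotvec, 'e \<times> 'e) tvec set" where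
  "cotangent_lift_domain Q V =
     {v \<in> points (tangent_bundle (cotangent_bundle Q)). fst (alpha_map Q v) \<in> V}"

end

theory Submission
  imports Defs
begin

text \<open>
  Let \<open>y = R\<^sup>-\<^sup>1(q\<^sub>0, q\<^sub>1)\<close> and let \<open>v\<close> be the preimage of the two covectors under the cotangent
  lift. Since \<open>T\<^sub>yR\<close> is bijective and \<open>\<Phi>\<close> is bijective on fibres, \<open>\<alpha>\<^sub>Q(v)\<close> is the pullback of
  \<open>\<Phi>(\<alpha>\<^sub>0, \<alpha>\<^sub>1)\<close> along \<open>T\<^sub>yR\<close>, so the left-hand side is \<open>\<langle>\<alpha>\<^sub>Q(v), \<kappa>\<^sub>Q(w)\<rangle>\<close>. In a chart with
  \<open>v = (q, p, dq, dp)\<close> and \<open>w = (q, u, dq, du)\<close> this is \<open>dp \<bullet> u + p \<bullet> du\<close>, which is the derivative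
  of \<open>p \<bullet> u\<close> along curves with velocities \<open>v\<close> and \<open>w\<close>. That \<open>\<kappa>\<^sub>Q\<close> and \<open>\<alpha>\<^sub>Q\<close> do not depend on the
  chart is the symmetry of the second derivative of the chart transitions.
\<close>

section \<open>Finite-dimensional spaces and second derivatives\<close>

text \<open>Most objects in the statement are definite descriptions or values of
  \<open>inv_into\<close>, so each must be shown to exist before it can be computed. For
  \<open>tangent_map\<close>, the canonical maps and the tangent pairing, existence is built in one
  chart and carried to the others by transition formulas; uniqueness is read off in one chart. The
  inverse of \<open>cotangent_lift\<close> needs some preimage, hence the surjectivity results for
  \<open>alpha_map\<close> and \<open>Phi\<close>. The preimage that is selected is never identified
  with the constructed one: foot points and the injectivity of \<open>R\<close> on \<open>V\<close>
  suffice to place its \<open>alpha_map\<close> value over \<open>y\<close>. Transitions are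
  differentiated at most twice: the base atlas is smooth, while its tangent and cotangent bundles
  and the square are treated as atlases with differentiable transitions. The model space may have
  dimension 0, so finite dimension enters through dual frames, a spanning family with dual vectors
  that need not be independent. They serve to expand linear maps and to represent
  functionals.\<close>

definition dual_frame :: "'e::real_inner set \<Rightarrow> ('e \<Rightarrow> 'e) \<Rightarrow> bool" where
  "dual_frame B f \<longleftrightarrow> finite B \<and> (\<forall>x. (\<Sum>b\<in>B. (x \<bullet> f b) *\<^sub>R b) = x)"

text \<open>Gram-Schmidt gives an orthogonal spanning set, and the dual of \<open>c\<close> is
  \<open>c\<close> divided by its squared length. The remainder of the expansion of \<open>x\<close>
  is orthogonal to the spanning set and lies in its span, so it is orthogonal to itself.\<close>

lemma dual_frame_exists:
  assumes "finite (A::'e::real_inner set)" "span A = UNIV"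
  obtains B :: "'e::real_inner set" and f where "dual_frame B f"
proof -
  obtain C :: "'e set" where C: "finite C" "span C = span A" "pairwise orthogonal C"
    using basis_orthogonal[OF assms(1)] by blast
  \<comment> \<open>The orthogonal set may contain 0; division by 0 then yields the dual vector 0,
    and that summand vanishes.\<close>
  define f where "f = (\<lambda>c::'e. c /\<^sub>R (c \<bullet> c))"
  have "(\<Sum>b\<in>C. (x \<bullet> f b) *\<^sub>R b) = x" for x
  proof -
    define y where "y = x - (\<Sum>b\<in>C. (x \<bullet> f b) *\<^sub>R b)"
    have "orthogonal y c" if c: "c \<in> C" for c
    proof -
      have "((x \<bullet> f b) *\<^sub>R b) \<bullet> c = (if b = c then x \<bullet> c else 0)" if "b \<in> C" for b
      proof (cases "b = c")
        case False
        then have "b \<bullet> c = 0"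
          using C(3) c that by (simp add: pairwise_def orthogonal_def)
        then show ?thesis using False by simp
      qed (cases "c = 0", simp_all add: f_def)
      then have "(\<Sum>b\<in>C. (x \<bullet> f b) *\<^sub>R b) \<bullet> c = (\<Sum>b\<in>C. if b = c then x \<bullet> c else 0)"
        unfolding inner_sum_left by (intro sum.cong refl)
      then show ?thesis
        using c C(1) by (simp add: y_def orthogonal_def inner_diff_left)
    qed
    moreover have "y \<in> span C"
      by (simp add: C(2) assms(2))
    ultimately have "orthogonal y y"
      using orthogonal_to_span by blast
    then show ?thesis
      by (simp add: orthogonal_def y_def)
  qed
  then show ?thesis
    using C(1) that[of C f] unfolding dual_frame_def by blast
qed

lemma dual_frame_linear:
  assumes "dual_frame B f" "linear h"
  shows "h x = (\<Sum>b\<in>B. (x \<bullet> f b) *\<^sub>R h b)"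
proof -
  have "h x = h (\<Sum>b\<in>B. (x \<bullet> f b) *\<^sub>R b)"
    using assms(1) by (simp add: dual_frame_def)
  then show ?thesis
    by (simp add: linear_sum[OF assms(2)] linear_scale[OF assms(2)])
qed

text \<open>An explicit Riesz vector for a functional; momenta of covectors are obtained from
  it.\<close>

lemma dual_frame_riesz:
  assumes "dual_frame B f" "linear h"
  shows "h x = (\<Sum>b\<in>B. h b *\<^sub>R f b) \<bullet> x"
proof -
  have "h x = (\<Sum>b\<in>B. (x \<bullet> f b) *\<^sub>R h b)"
    by (rule dual_frame_linear[OF assms])
  also have "\<dots> = (\<Sum>b\<in>B. (h b *\<^sub>R f b) \<bullet> x)"
    by (intro sum.cong refl) (simp add: inner_commute[of x "f _"])
  finally show ?thesis by (simp only: inner_sum_left)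
qed

text \<open>The two copies of \<open>B\<close> on the axes span the product, and a frame is then
  chosen afresh. The model spaces of the tangent bundle and of the square are of this form.\<close>

lemma dual_frame_prod:
  fixes B :: "'e::real_inner set"
  assumes "dual_frame B f"
  obtains B' :: "('e::real_inner \<times> 'e) set" and f' where "dual_frame B' f'"
proof -
  define S where "S = (\<lambda>b. (b, 0::'e)) ` B \<union> (\<lambda>b. (0::'e, b)) ` B"
  have "(x, y) \<in> span S" for x y
  proof -
    have "(x, y) = (\<Sum>b\<in>B. (x \<bullet> f b) *\<^sub>R (b, 0)) + (\<Sum>b\<in>B. (y \<bullet> f b) *\<^sub>R (0, b))"
      using assms by (simp add: prod_eq_iff fst_sum snd_sum dual_frame_def)
    also have "\<dots> \<in> span S"
    proof -
      have "(b, 0) \<in> span S" "(0, b) \<in> span S" if "b \<in> B" for b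
        using that by (auto simp: S_def intro: span_base)
      then show ?thesis
        by (blast intro: span_add span_sum span_scale)
    qed
    finally show ?thesis .
  qed
  then have "span S = UNIV" by auto
  moreover have "finite S"
    using assms by (simp add: S_def dual_frame_def)
  ultimately show ?thesis
    using dual_frame_exists that by blast
qed

section \<open>Derivatives depend only on germs\<close>

lemma frechet_derivativeI:
  "(f has_derivative D) (at x) \<Longrightarrow> frechet_derivative f (at x) = D"
  by (rule frechet_derivative_at[symmetric])

lemma frechet_has_derivative:
  "f differentiable (at x) \<Longrightarrow> (f has_derivative frechet_derivative f (at x)) (at x)"
  using frechet_derivative_works by blast

lemma has_derivative_eventually_cong:
  assumes "(f has_derivative D) (at x)" "\<forall>\<^sub>F y in nhds x. f y = g y"
  shows "(g has_derivative D) (at x)"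
proof -
  have "\<forall>\<^sub>F y in at x. f y = g y"
    using assms(2) by (simp add: eventually_at_filter eventually_mono)
  then show ?thesis
    using has_derivative_transform_eventually[OF assms(1)] eventually_nhds_x_imp_x[OF assms(2)]
    by blast
qed

lemma has_derivative_along_line:
  assumes "(f has_derivative D) (at (p r))"
    and "(p has_derivative (\<lambda>h. h *\<^sub>R u)) (at r)"
  shows "((\<lambda>r. f (p r)) has_derivative (\<lambda>h. h *\<^sub>R D u)) (at (r::real))"
  using has_derivative_compose[OF assms(2,1)]
  by (simp add: linear_scale[OF has_derivative_linear[OF assms(1)]])

section \<open>Symmetry of second derivatives\<close>

lemma mvt_at:
  fixes h :: "real \<Rightarrow> real"
  assumes "0 < t" and h: "\<And>r. 0 \<le> r \<Longrightarrow> r \<le> t \<Longrightarrow> (h has_derivative (\<lambda>y. y * h' r)) (at r)"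
  obtains r where "0 < r" "r < t" "h t - h 0 = t * h' r"
  using mvt_simple[OF assms(1), of h "\<lambda>r y. y * h' r", OF has_derivative_at_withinI[OF h]] by auto

text \<open>The mean value theorem is applied twice: to the difference of \<open>g\<close> along two
  parallel edges in direction \<open>u\<close>, then to \<open>G\<close> in direction
  \<open>u\<close> along the segment in direction \<open>v\<close>. The left-hand side of the
  resulting equation does not change when \<open>u\<close> and \<open>v\<close> are
  exchanged.\<close>

lemma second_difference_mvt:
  fixes g :: "'a::real_normed_vector \<Rightarrow> real"
  assumes t: "t > 0"
    and S: "\<And>r s. 0 \<le> r \<Longrightarrow> r \<le> t \<Longrightarrow> 0 \<le> s \<Longrightarrow> s \<le> t \<Longrightarrow> x + r *\<^sub>R u + s *\<^sub>R v \<in> S"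
    and G: "\<And>y. y \<in> S \<Longrightarrow> (g has_derivative G y) (at y)"
    and H: "\<And>y. y \<in> S \<Longrightarrow> ((\<lambda>y. G y u) has_derivative H y) (at y)"
  obtains r s where "0 < r" "r < t" "0 < s" "s < t"
    "g (x + t *\<^sub>R u + t *\<^sub>R v) - g (x + t *\<^sub>R u) - g (x + t *\<^sub>R v) + g x
      = t * t * H (x + r *\<^sub>R u + s *\<^sub>R v) v"
proof -
  have "((\<lambda>r. g (x + r *\<^sub>R u + t *\<^sub>R v) - g (x + r *\<^sub>R u)) has_derivative
     (\<lambda>h. h * (G (x + r *\<^sub>R u + t *\<^sub>R v) u - G (x + r *\<^sub>R u) u))) (at r)"
    if "0 \<le> r" "r \<le> t" for r
  proof -
    have 1: "((\<lambda>r. g (x + r *\<^sub>R u + t *\<^sub>R v)) has_derivative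
        (\<lambda>h. h *\<^sub>R G (x + r *\<^sub>R u + t *\<^sub>R v) u)) (at r)"
      by (rule has_derivative_along_line[where p = "\<lambda>r. x + r *\<^sub>R u + t *\<^sub>R v", OF G])
        (use S t that in \<open>auto intro!: derivative_eq_intros\<close>)
    have 2: "((\<lambda>r. g (x + r *\<^sub>R u)) has_derivative (\<lambda>h. h *\<^sub>R G (x + r *\<^sub>R u) u)) (at r)"
      by (rule has_derivative_along_line[where p = "\<lambda>r. x + r *\<^sub>R u", OF G])
        (use S[of r 0] t that in \<open>auto intro!: derivative_eq_intros\<close>)
    show ?thesis
      using has_derivative_diff[OF 1 2] by (simp add: right_diff_distrib)
  qed
  then obtain r where r: "0 < r" "r < t"
    "(g (x + t *\<^sub>R u + t *\<^sub>R v) - g (x + t *\<^sub>R u)) - (g (x + 0 *\<^sub>R u + t *\<^sub>R v) - g (x + 0 *\<^sub>R u))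
     = t * (G (x + r *\<^sub>R u + t *\<^sub>R v) u - G (x + r *\<^sub>R u) u)"
    by (rule mvt_at[OF t])
  have "((\<lambda>s. G (x + r *\<^sub>R u + s *\<^sub>R v) u) has_derivative
     (\<lambda>h. h * H (x + r *\<^sub>R u + s *\<^sub>R v) v)) (at s)"
    if "0 \<le> s" "s \<le> t" for s
  proof -
    have "((\<lambda>s. G (x + r *\<^sub>R u + s *\<^sub>R v) u) has_derivative
       (\<lambda>h. h *\<^sub>R H (x + r *\<^sub>R u + s *\<^sub>R v) v)) (at s)"
      by (rule has_derivative_along_line[where f = "\<lambda>y. G y u"
            and p = "\<lambda>s. x + r *\<^sub>R u + s *\<^sub>R v", OF H])
        (use S r that in \<open>auto intro!: derivative_eq_intros\<close>)
    then show ?thesis by simp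
  qed
  then obtain s where s: "0 < s" "s < t"
    "G (x + r *\<^sub>R u + t *\<^sub>R v) u - G (x + r *\<^sub>R u + 0 *\<^sub>R v) u
      = t * H (x + r *\<^sub>R u + s *\<^sub>R v) v"
    by (rule mvt_at[OF t])
  show ?thesis
    using r s by (intro that[of r s]) (auto simp: algebra_simps)
qed

text \<open>The second difference over a small parallelogram is computed in both orders, so
  \<open>H u\<close> along \<open>v\<close> and \<open>H v\<close> along \<open>u\<close> take the
  same value at two points near \<open>x\<close>. By continuity both values are close to those at
  \<open>x\<close>.\<close>

lemma second_derivative_symmetric_real:
  fixes g :: "'a::real_normed_vector \<Rightarrow> real"
  assumes "open S" "x \<in> S"
    and G: "\<And>y. y \<in> S \<Longrightarrow> (g has_derivative G y) (at y)"
    and H: "\<And>y w. y \<in> S \<Longrightarrow> ((\<lambda>y. G y w) has_derivative H w y) (at y)"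
    and cont: "\<And>w w'. continuous_on S (\<lambda>y. H w y w')"
  shows "H u x v = H v x u"
proof (rule ccontr)
  assume neq: "H u x v \<noteq> H v x u"
  \<comment> \<open>Half the gap: two errors, each less than \<open>e\<close>, cannot bridge
    it.\<close>
  define e where "e = \<bar>H u x v - H v x u\<bar> / 2"
  have e: "e > 0" using neq by (simp add: e_def)
  obtain d0 where d0: "d0 > 0" "ball x d0 \<subseteq> S"
    using assms(1,2) open_contains_ball by blast
  have near: "\<exists>d>0. \<forall>y. dist y x < d \<longrightarrow> \<bar>H w y w' - H w x w'\<bar> < e" for w w'
  proof -
    have "isCont (\<lambda>y. H w y w') x"
      using cont[of w w'] assms(1,2) by (simp add: continuous_on_eq_continuous_at)
    then show ?thesis
      using e unfolding continuous_at_eps_delta dist_real_def by blast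
  qed
  obtain d1 where d1: "d1 > 0" "\<And>y. dist y x < d1 \<Longrightarrow> \<bar>H u y v - H u x v\<bar> < e"
    using near by blast
  obtain d2 where d2: "d2 > 0" "\<And>y. dist y x < d2 \<Longrightarrow> \<bar>H v y u - H v x u\<bar> < e"
    using near by blast
  define d where "d = min d0 (min d1 d2)"
  have d: "d > 0" using d0 d1 d2 by (simp add: d_def)
  \<comment> \<open>With this side length the whole parallelogram stays strictly within distance
    \<open>d\<close> of \<open>x\<close>; the summand 1 keeps the denominator positive when
    \<open>u\<close> and \<open>v\<close> vanish.\<close>
  define t where "t = d / (norm u + norm v + 1)"
  have n: "norm u + norm v + 1 > 0" by (smt (verit) norm_ge_zero)
  have t: "t > 0" using d n by (simp add: t_def)
  have close: "dist (x + r *\<^sub>R u + s *\<^sub>R v) x < d" "dist (x + s *\<^sub>R v + r *\<^sub>R u) x < d"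
    if "0 \<le> r" "r \<le> t" "0 \<le> s" "s \<le> t" for r s
  proof -
    have "norm (r *\<^sub>R u + s *\<^sub>R v) \<le> r * norm u + s * norm v"
      using that norm_triangle_ineq[of "r *\<^sub>R u" "s *\<^sub>R v"] by simp
    also have "\<dots> \<le> t * norm u + t * norm v"
      using that by (intro add_mono mult_right_mono) auto
    also have "\<dots> < t * (norm u + norm v + 1)"
      using t by (simp add: algebra_simps)
    also have "\<dots> = d" using n by (simp add: t_def)
    finally show "dist (x + r *\<^sub>R u + s *\<^sub>R v) x < d" "dist (x + s *\<^sub>R v + r *\<^sub>R u) x < d"
      by (simp_all add: dist_norm algebra_simps)
  qed
  have inS: "y \<in> S" if "dist y x < d" for y
    using that d0 by (auto simp: d_def dist_commute)
  obtain r s where rs: "0 < r" "r < t" "0 < s" "s < t"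
    "g (x + t *\<^sub>R u + t *\<^sub>R v) - g (x + t *\<^sub>R u) - g (x + t *\<^sub>R v) + g x
      = t * t * H u (x + r *\<^sub>R u + s *\<^sub>R v) v"
    by (rule second_difference_mvt[OF t _ G H[of _ u], where x = x and v = v]) (use inS close in auto)
  obtain r' s' where rs': "0 < r'" "r' < t" "0 < s'" "s' < t"
    "g (x + t *\<^sub>R v + t *\<^sub>R u) - g (x + t *\<^sub>R v) - g (x + t *\<^sub>R u) + g x
      = t * t * H v (x + r' *\<^sub>R v + s' *\<^sub>R u) u"
    by (rule second_difference_mvt[OF t _ G H[of _ v], where x = x and v = u]) (use inS close in auto)
  have eq: "x + t *\<^sub>R u + t *\<^sub>R v = x + t *\<^sub>R v + t *\<^sub>R u" by simp
  have "t * t * H u (x + r *\<^sub>R u + s *\<^sub>R v) v = t * t * H v (x + r' *\<^sub>R v + s' *\<^sub>R u) u"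
    using rs(5)[unfolded eq] rs'(5) by linarith
  then have "H u (x + r *\<^sub>R u + s *\<^sub>R v) v = H v (x + r' *\<^sub>R v + s' *\<^sub>R u) u"
    using t by simp
  moreover have "\<bar>H u (x + r *\<^sub>R u + s *\<^sub>R v) v - H u x v\<bar> < e"
    using close(1)[of r s] rs by (intro d1(2)) (simp add: d_def)
  moreover have "\<bar>H v (x + r' *\<^sub>R v + s' *\<^sub>R u) u - H v x u\<bar> < e"
    using close(2)[of s' r'] rs' by (intro d2(2)) (simp add: d_def)
  ultimately show False by (simp add: e_def abs_if split: if_splits)
qed

text \<open>The direction \<open>u\<close> is frozen before the second differentiation. This is the
  form that \<open>Ck_on\<close> controls, since it speaks of one directional derivative at a time;
  linearity in \<open>u\<close> is therefore not built in.\<close>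

abbreviation second_derivative ::
    "('a::real_normed_vector \<Rightarrow> 'b::real_normed_vector) \<Rightarrow> 'a \<Rightarrow> 'a \<Rightarrow> 'a \<Rightarrow> 'b" where
  "second_derivative f x u \<equiv> frechet_derivative (\<lambda>y. frechet_derivative f (at y) u) (at x)"

context
  fixes f :: "'a::real_normed_vector \<Rightarrow> 'b::real_normed_vector" and S
  assumes f: "smooth_on S f"
begin

lemma smooth_on_has_derivative:
  "x \<in> S \<Longrightarrow> (f has_derivative frechet_derivative f (at x)) (at x)"
proof -
  have "Ck_on (Suc 0) S f"
    using f unfolding smooth_on_def by blast
  then show "x \<in> S \<Longrightarrow> ?thesis"
    by (simp add: frechet_has_derivative)
qed

lemma smooth_on_has_second_derivative:
  "x \<in> S \<Longrightarrow> ((\<lambda>y. frechet_derivative f (at y) u) has_derivative second_derivative f x u) (at x)"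
  and smooth_on_continuous_second_derivative:
  "continuous_on S (\<lambda>x. second_derivative f x u v)"
proof -
  have "Ck_on (Suc (Suc 0)) S f"
    using f unfolding smooth_on_def by blast
  then show "x \<in> S \<Longrightarrow> ((\<lambda>y. frechet_derivative f (at y) u) has_derivative second_derivative f x u) (at x)"
    "continuous_on S (\<lambda>x. second_derivative f x u v)"
    by (simp_all add: frechet_has_derivative)
qed

end

text \<open>The real case applies to the inner product of \<open>f\<close> with each fixed vector
  \<open>z\<close>, and such inner products separate points.\<close>

lemma second_derivative_symmetric:
  fixes f :: "'a::real_normed_vector \<Rightarrow> 'b::real_inner"
  assumes "smooth_on S f" "open S" "x \<in> S"
  shows "second_derivative f x u v = second_derivative f x v u"
proof -
  have "second_derivative f x u v \<bullet> z = second_derivative f x v u \<bullet> z" for z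
  proof (rule second_derivative_symmetric_real[OF assms(2,3),
          of "\<lambda>y. f y \<bullet> z" "\<lambda>y h. frechet_derivative f (at y) h \<bullet> z"
             "\<lambda>u y h. second_derivative f y u h \<bullet> z"])
    show "((\<lambda>y. f y \<bullet> z) has_derivative (\<lambda>h. frechet_derivative f (at y) h \<bullet> z)) (at y)"
      if "y \<in> S" for y
      by (intro has_derivative_inner_left smooth_on_has_derivative[OF assms(1) that])
    show "((\<lambda>y. frechet_derivative f (at y) w \<bullet> z) has_derivative
        (\<lambda>h. second_derivative f y w h \<bullet> z)) (at y)" if "y \<in> S" for y w
      by (intro has_derivative_inner_left smooth_on_has_second_derivative[OF assms(1) that])
    show "continuous_on S (\<lambda>y. second_derivative f y w w' \<bullet> z)" for w w'
      by (intro continuous_on_inner continuous_on_const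
          smooth_on_continuous_second_derivative[OF assms(1)])
  qed
  then have "(second_derivative f x u v - second_derivative f x v u) \<bullet> z = 0" for z
    by (simp add: inner_diff_left)
  then show ?thesis
    by (metis eq_iff_diff_eq_0 inner_eq_zero_iff)
qed

text \<open>Smoothness gives differentiability of the derivative in one fixed direction only. Joint
  differentiability in point and direction follows by expanding the direction in the frame, which
  leaves a finite sum of products.\<close>

lemma has_derivative_tangent:
  fixes f :: "'e::real_inner \<Rightarrow> 'b::real_normed_vector"
  assumes fr: "dual_frame (B::'e set) g" and f: "smooth_on S f" and S: "open S" "x \<in> S"
  shows "((\<lambda>z. frechet_derivative f (at (fst z)) (snd z)) has_derivative
           (\<lambda>h. second_derivative f x v (fst h) + frechet_derivative f (at x) (snd h))) (at (x, v))"
proof -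
  note D = smooth_on_has_derivative[OF f]
  note D2 = smooth_on_has_second_derivative[OF f]
  have lin: "linear (frechet_derivative f (at y))" if "y \<in> S" for y
    using D[OF that] has_derivative_linear by blast
  have ev: "\<forall>\<^sub>F y in nhds x. y \<in> S"
    using S by (simp add: eventually_nhds_in_open)
  have "((\<lambda>y. \<Sum>b\<in>B. (v \<bullet> g b) *\<^sub>R frechet_derivative f (at y) b) has_derivative
      (\<lambda>h. \<Sum>b\<in>B. (v \<bullet> g b) *\<^sub>R second_derivative f x b h)) (at x)"
    by (intro has_derivative_sum has_derivative_scaleR_right D2 S)
  then have "((\<lambda>y. frechet_derivative f (at y) v) has_derivative
      (\<lambda>h. \<Sum>b\<in>B. (v \<bullet> g b) *\<^sub>R second_derivative f x b h)) (at x)"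
    by (rule has_derivative_eventually_cong)
      (use ev in eventually_elim, simp add: dual_frame_linear[OF fr lin, symmetric])
  \<comment> \<open>This is the linearity of the second derivative in its first direction, expressed
    in the frame.\<close>
  then have v: "second_derivative f x v = (\<lambda>h. \<Sum>b\<in>B. (v \<bullet> g b) *\<^sub>R second_derivative f x b h)"
    by (rule frechet_derivativeI)
  have comp: "((\<lambda>z. frechet_derivative f (at (fst z)) b) has_derivative
      (\<lambda>h. second_derivative f x b (fst h))) (at (x, v))" for b
    using has_derivative_compose[OF has_derivative_fst[OF has_derivative_ident], of "\<lambda>y. frechet_derivative f (at y) b"
        "second_derivative f x b" "(x, v)" UNIV] D2[OF S(2)] by simp
  have "((\<lambda>z. \<Sum>b\<in>B. (snd z \<bullet> g b) *\<^sub>R frechet_derivative f (at (fst z)) b) has_derivative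
      (\<lambda>h. \<Sum>b\<in>B. (v \<bullet> g b) *\<^sub>R second_derivative f x b (fst h)
            + (snd h \<bullet> g b) *\<^sub>R frechet_derivative f (at x) b)) (at (x, v))"
    using has_derivative_scaleR[OF has_derivative_inner_left[OF has_derivative_snd[OF has_derivative_ident]] comp]
    by (intro has_derivative_sum) simp
  then have "((\<lambda>z. \<Sum>b\<in>B. (snd z \<bullet> g b) *\<^sub>R frechet_derivative f (at (fst z)) b) has_derivative
      (\<lambda>h. second_derivative f x v (fst h) + frechet_derivative f (at x) (snd h))) (at (x, v))"
    by (simp add: sum.distrib v dual_frame_linear[OF fr lin[OF S(2)], symmetric])
  then show ?thesis
  proof (rule has_derivative_eventually_cong)
    have "open (S \<times> (UNIV::'e set))" using S by (simp add: open_Times)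
    then have "\<forall>\<^sub>F z in nhds (x, v). z \<in> S \<times> UNIV"
      using S by (intro eventually_nhds_in_open) auto
    then show "\<forall>\<^sub>F z in nhds (x, v). (\<Sum>b\<in>B. (snd z \<bullet> g b) *\<^sub>R frechet_derivative f (at (fst z)) b)
        = frechet_derivative f (at (fst z)) (snd z)"
      by eventually_elim (auto simp: dual_frame_linear[OF fr lin, symmetric])
  qed
qed

section \<open>Atlases, tangent spaces and tangent maps\<close>

lemma charts_at_iff: "c \<in> charts_at M x \<longleftrightarrow> c \<in> M \<and> x \<in> fst c"
  by (simp add: charts_at_def)

lemma has_derivative_eventually_image:
  assumes "(f has_derivative D) (at x)" "\<forall>\<^sub>F z in nhds (f x). P z"
  shows "\<forall>\<^sub>F y in nhds x. P (f y)"
proof -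
  have "(f \<longlongrightarrow> f x) (nhds x)"
    using has_derivative_continuous[OF assms(1)]
    by (simp add: continuous_at tendsto_at_iff_tendsto_nhds)
  then show ?thesis
    using assms(2) by (auto simp: filterlim_iff)
qed

definition jacobian ::
    "('a, 'e::real_inner) chart \<Rightarrow> ('a, 'e) chart \<Rightarrow> 'a \<Rightarrow> 'e \<Rightarrow> 'e" where
  "jacobian c c' x = frechet_derivative (snd c' \<circ> chart_inv c) (at (snd c x))"

text \<open>Meant for a chart \<open>c\<close> at \<open>x\<close>: the tangent vector whose
  coordinate in \<open>c\<close> is \<open>e\<close>. The value 0 at the other charts is the
  convention of \<open>tangent_space\<close>.\<close>

definition tvec_of ::
    "('a, 'e::real_inner) atlas \<Rightarrow> ('a, 'e) chart \<Rightarrow> 'a \<Rightarrow> 'e \<Rightarrow> ('a, 'e) tvec" where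
  "tvec_of M c x e = (x, \<lambda>c'. if c' \<in> charts_at M x then jacobian c c' x e else 0)"

lemma tangent_space_iff:
  "v \<in> tangent_space M x \<longleftrightarrow> fst v = x \<and> x \<in> points M \<and> (\<forall>c. c \<notin> charts_at M x \<longrightarrow> snd v c = 0) \<and>
     (\<forall>c\<in>charts_at M x. \<forall>c'\<in>charts_at M x. snd v c' = jacobian c c' x (snd v c))"
  unfolding tangent_space_def jacobian_def mem_Collect_eq
  by (metis (no_types, lifting) fst_conv snd_conv surjective_pairing)

lemma tangent_space_fst: "v \<in> tangent_space M x \<Longrightarrow> fst v = x"
  unfolding tangent_space_iff by blast

lemma tangent_space_points: "v \<in> tangent_space M x \<Longrightarrow> x \<in> points M"
  unfolding tangent_space_iff by blast

lemma tangent_space_jacobian: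
  "v \<in> tangent_space M x \<Longrightarrow> c \<in> charts_at M x \<Longrightarrow> c' \<in> charts_at M x \<Longrightarrow>
    jacobian c c' x (snd v c) = snd v c'"
  unfolding tangent_space_iff by metis

lemma tangent_space_outside: "v \<in> tangent_space M x \<Longrightarrow> c \<notin> charts_at M x \<Longrightarrow> snd v c = 0"
  unfolding tangent_space_iff by blast

text \<open>One coordinate determines the rest through the Jacobians, and the components at charts
  away from \<open>x\<close> are 0. Hence identities of tangent vectors are checked in a single
  convenient chart.\<close>

lemma tangent_space_eqI:
  assumes u: "u \<in> tangent_space M x" and v: "v \<in> tangent_space M x"
    and c: "c \<in> charts_at M x" and eq: "snd u c = snd v c"
  shows "u = v"
proof (rule prod_eqI)
  show "fst u = fst v"
    using u v by (simp add: tangent_space_fst)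
  show "snd u = snd v"
  proof
    fix c'
    show "snd u c' = snd v c'"
    proof (cases "c' \<in> charts_at M x")
      case True
      then show ?thesis
        using tangent_space_jacobian[OF u c] tangent_space_jacobian[OF v c] eq by metis
    next
      case False
      then show ?thesis
        using u v by (simp add: tangent_space_outside)
    qed
  qed
qed

text \<open>The last clause is a local form of continuity. Coordinates are meaningless outside the
  domain of \<open>d\<close>, so a derivative of the coordinate expression says something about
  \<open>f\<close> only if nearby values of \<open>f\<close> stay in that domain.\<close>

definition has_local_derivative ::
    "('a, 'e::real_inner) atlas \<Rightarrow> ('b, 'f::real_inner) atlas \<Rightarrow> ('a \<Rightarrow> 'b) \<Rightarrow> 'a \<Rightarrow>
     ('a, 'e) chart \<Rightarrow> ('b, 'f) chart \<Rightarrow> ('e \<Rightarrow> 'f) \<Rightarrow> bool" where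
  "has_local_derivative M N f x c d D \<longleftrightarrow>
     c \<in> charts_at M x \<and> d \<in> charts_at N (f x) \<and>
     ((snd d \<circ> f \<circ> chart_inv c) has_derivative D) (at (snd c x)) \<and>
     (\<forall>\<^sub>F y in nhds (snd c x). f (chart_inv c y) \<in> fst d)"

text \<open>Transitions are asked to be differentiable at each overlap point, and no more. This is
  what tangent spaces and tangent maps require, and it can be verified for bundles and products from
  a single derivative formula.\<close>

locale C1_atlas =
  fixes M :: "('a, 'e::real_inner) atlas"
  assumes inj_chart: "c \<in> M \<Longrightarrow> inj_on (snd c) (fst c)"
    and open_overlap: "c \<in> M \<Longrightarrow> c' \<in> M \<Longrightarrow> open (snd c ` (fst c \<inter> fst c'))"
    and differentiable_transition:
      "c \<in> M \<Longrightarrow> c' \<in> M \<Longrightarrow> x \<in> fst c \<Longrightarrow> x \<in> fst c' \<Longrightarrow>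
        (snd c' \<circ> chart_inv c) differentiable (at (snd c x))"
begin

lemma chart_inv_chart: "c \<in> M \<Longrightarrow> x \<in> fst c \<Longrightarrow> chart_inv c (snd c x) = x"
  by (simp add: chart_inv_def inj_chart)

lemma open_chart_image: "c \<in> M \<Longrightarrow> open (snd c ` fst c)"
  using open_overlap[of c c] by simp

text \<open>\<open>manifold_topology\<close> is given through \<open>topology\<close>, so the
  predicate must be shown to be a topology. Closure under intersections rests on the injectivity of
  charts, by which images commute with intersections.\<close>

lemma openin_manifold_topology:
  "openin (manifold_topology M) W \<longleftrightarrow> W \<subseteq> points M \<and> (\<forall>c\<in>M. open (snd c ` (W \<inter> fst c)))"
proof -
  let ?L = "\<lambda>W. W \<subseteq> points M \<and> (\<forall>c\<in>M. open (snd c ` (W \<inter> fst c)))"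
  have "istopology ?L"
    unfolding istopology_def
  proof (intro conjI allI impI)
    fix A B assume A: "?L A" and B: "?L B"
    have "snd c ` (A \<inter> B \<inter> fst c) = snd c ` (A \<inter> fst c) \<inter> snd c ` (B \<inter> fst c)" if "c \<in> M" for c
      using inj_chart[OF that] by (auto simp: inj_on_def)
    then show "A \<inter> B \<subseteq> points M" "\<forall>c\<in>M. open (snd c ` (A \<inter> B \<inter> fst c))"
      using A B by (auto simp: open_Int)
  next
    fix K assume K: "\<forall>W\<in>K. ?L W"
    have "snd c ` (\<Union>K \<inter> fst c) = (\<Union>W\<in>K. snd c ` (W \<inter> fst c))" for c :: "('a, 'e) chart"
      by auto
    then have "open (snd c ` (\<Union>K \<inter> fst c))" if "c \<in> M" for c
      using K that by (metis (no_types, lifting) open_UN)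
    then show "\<Union>K \<subseteq> points M" "\<forall>c\<in>M. open (snd c ` (\<Union>K \<inter> fst c))"
      using K by blast+
  qed
  then have "openin (topology ?L) = ?L"
    by (rule topology_inverse')
  then show ?thesis
    by (simp add: manifold_topology_def)
qed

lemma eventually_in_chart:
  assumes "c \<in> M" "open (snd c ` A)" "A \<subseteq> fst c" "x \<in> A"
  shows "\<forall>\<^sub>F y in nhds (snd c x). chart_inv c y \<in> A \<and> snd c (chart_inv c y) = y"
proof -
  have "\<forall>\<^sub>F y in nhds (snd c x). y \<in> snd c ` A"
    using assms by (intro eventually_nhds_in_open) auto
  then show ?thesis
    by eventually_elim (use assms(3) chart_inv_chart[OF assms(1)] in auto)
qed

lemma eventually_in_overlap:
  assumes "c \<in> charts_at M x" "c' \<in> charts_at M x"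
  shows "\<forall>\<^sub>F y in nhds (snd c x). chart_inv c y \<in> fst c \<inter> fst c' \<and> snd c (chart_inv c y) = y"
  using assms by (intro eventually_in_chart open_overlap) (auto simp: charts_at_iff)

lemma has_derivative_transition:
  "c \<in> charts_at M x \<Longrightarrow> c' \<in> charts_at M x \<Longrightarrow>
    ((snd c' \<circ> chart_inv c) has_derivative jacobian c c' x) (at (snd c x))"
  unfolding jacobian_def
  by (intro frechet_has_derivative differentiable_transition) (auto simp: charts_at_iff)

lemma linear_jacobian:
  "c \<in> charts_at M x \<Longrightarrow> c' \<in> charts_at M x \<Longrightarrow> linear (jacobian c c' x)"
  using has_derivative_transition has_derivative_linear by blast

text \<open>The chain rule, applied after noting that the composite of two transitions has the same
  germ as the direct one.\<close>

lemma jacobian_comp: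
  assumes c: "c \<in> charts_at M x" "c' \<in> charts_at M x" "c'' \<in> charts_at M x"
  shows "jacobian c' c'' x (jacobian c c' x e) = jacobian c c'' x e"
proof -
  have "((snd c'' \<circ> chart_inv c') has_derivative jacobian c' c'' x)
      (at ((snd c' \<circ> chart_inv c) (snd c x)))"
    using has_derivative_transition[OF c(2,3)] c by (simp add: chart_inv_chart charts_at_iff)
  from diff_chain_at[OF has_derivative_transition[OF c(1,2)] this]
  have "((snd c'' \<circ> chart_inv c) has_derivative jacobian c' c'' x \<circ> jacobian c c' x) (at (snd c x))"
  proof (rule has_derivative_eventually_cong)
    show "\<forall>\<^sub>F y in nhds (snd c x).
        (snd c'' \<circ> chart_inv c' \<circ> (snd c' \<circ> chart_inv c)) y = (snd c'' \<circ> chart_inv c) y"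
      using eventually_in_overlap[OF c(1,2)]
      by eventually_elim (use c in \<open>auto simp: chart_inv_chart charts_at_iff\<close>)
  qed
  then have "jacobian c c'' x = jacobian c' c'' x \<circ> jacobian c c' x"
    unfolding jacobian_def[of c c''] by (rule frechet_derivativeI)
  then show ?thesis by simp
qed

lemma jacobian_self:
  assumes c: "c \<in> charts_at M x"
  shows "jacobian c c x e = e"
proof -
  have "((snd c \<circ> chart_inv c) has_derivative (\<lambda>e. e)) (at (snd c x))"
    by (rule has_derivative_eventually_cong[OF has_derivative_ident])
      (use eventually_in_overlap[OF c c] in \<open>eventually_elim, simp\<close>)
  then show ?thesis
    unfolding jacobian_def by (simp add: frechet_derivativeI)
qed

lemma points_charts_at: "x \<in> points M \<Longrightarrow> \<exists>c. c \<in> charts_at M x"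
  by (auto simp: points_def charts_at_iff)

lemma charts_at_points: "c \<in> charts_at M x \<Longrightarrow> x \<in> points M"
  by (auto simp: points_def charts_at_iff)

lemma tvec_of_tangent_space: "c \<in> charts_at M x \<Longrightarrow> tvec_of M c x e \<in> tangent_space M x"
  by (simp add: tangent_space_iff tvec_of_def jacobian_comp charts_at_points)

lemma tvec_of_coord: "c \<in> charts_at M x \<Longrightarrow> snd (tvec_of M c x e) c = e"
  by (simp add: tvec_of_def jacobian_self)

lemma tvec_add_tangent_space:
  "u \<in> tangent_space M x \<Longrightarrow> v \<in> tangent_space M x \<Longrightarrow> tvec_add u v \<in> tangent_space M x"
  unfolding tangent_space_iff[of "tvec_add u v"]
  by (simp add: tvec_add_def tangent_space_fst tangent_space_outside tangent_space_points
      linear_add[OF linear_jacobian] tangent_space_jacobian)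

lemma tvec_scale_tangent_space:
  "v \<in> tangent_space M x \<Longrightarrow> tvec_scale r v \<in> tangent_space M x"
  unfolding tangent_space_iff[of "tvec_scale r v"]
  by (simp add: tvec_scale_def tangent_space_fst tangent_space_outside tangent_space_points
      linear_scale[OF linear_jacobian] tangent_space_jacobian)

lemma smooth_map_has_local_derivative:
  assumes "smooth_map M N W f" "x \<in> W"
  obtains c d D where "has_local_derivative M N f x c d D"
proof -
  obtain c d V where c: "c \<in> charts_at M x" and d: "d \<in> charts_at N (f x)"
    and V: "openin (manifold_topology M) V" "x \<in> V" "V \<subseteq> W \<inter> fst c" "f ` V \<subseteq> fst d"
    and s: "smooth_on (snd c ` V) (snd d \<circ> f \<circ> chart_inv c)"
    using assms unfolding smooth_map_def by blast
  have cM: "c \<in> M"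
    using c by (simp add: charts_at_iff)
  have "open (snd c ` (V \<inter> fst c))"
    using V(1) cM by (simp add: openin_manifold_topology)
  moreover have "V \<inter> fst c = V"
    using V(3) by auto
  ultimately have "open (snd c ` V)" by simp
  then have "\<forall>\<^sub>F y in nhds (snd c x). chart_inv c y \<in> V \<and> snd c (chart_inv c y) = y"
    using V by (intro eventually_in_chart cM) auto
  then have "\<forall>\<^sub>F y in nhds (snd c x). f (chart_inv c y) \<in> fst d"
    by eventually_elim (use V(4) in auto)
  then have "has_local_derivative M N f x c d
      (frechet_derivative (snd d \<circ> f \<circ> chart_inv c) (at (snd c x)))"
    using c d smooth_on_has_derivative[OF s] V(2) by (auto simp: has_local_derivative_def)
  then show ?thesis by (rule that)
qed

end

section \<open>Tangent maps between two atlases\<close>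

locale C1_atlas_pair = M: C1_atlas M + N: C1_atlas N
  for M :: "('a, 'e::real_inner) atlas" and N :: "('b, 'f::real_inner) atlas"
begin

text \<open>Near the point, the new local expression is the old one composed with a transition on
  either side. The work lies in showing that nearby values of \<open>f\<close> lie in both target
  charts, so that the composition is legitimate.\<close>

lemma has_local_derivative_change_charts:
  assumes "has_local_derivative M N f x c d D"
    and c': "c' \<in> charts_at M x" and d': "d' \<in> charts_at N (f x)"
  shows "has_local_derivative M N f x c' d' (\<lambda>e. jacobian d d' (f x) (D (jacobian c' c x e)))"
proof -
  have c: "c \<in> charts_at M x" and d: "d \<in> charts_at N (f x)"
    and D: "((snd d \<circ> f \<circ> chart_inv c) has_derivative D) (at (snd c x))"
    and ev: "\<forall>\<^sub>F y in nhds (snd c x). f (chart_inv c y) \<in> fst d"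
    using assms(1) by (auto simp: has_local_derivative_def)
  let ?T = "snd c \<circ> chart_inv c'" and ?F = "snd d \<circ> f \<circ> chart_inv c"
  have T: "(?T has_derivative jacobian c' c x) (at (snd c' x))"
    by (rule M.has_derivative_transition[OF c' c])
  have Tx: "?T (snd c' x) = snd c x" and Fx: "?F (snd c x) = snd d (f x)"
    using c c' by (simp_all add: M.chart_inv_chart charts_at_iff)
  have FT: "(?F \<circ> ?T has_derivative D \<circ> jacobian c' c x) (at (snd c' x))"
    by (rule diff_chain_at[OF T]) (simp only: D Tx)
  have J: "((snd d' \<circ> chart_inv d) has_derivative jacobian d d' (f x)) (at ((?F \<circ> ?T) (snd c' x)))"
    using N.has_derivative_transition[OF d d'] Fx Tx by simp
  have ev1: "\<forall>\<^sub>F y in nhds (snd c' x). chart_inv c (?T y) = chart_inv c' y"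
    using M.eventually_in_overlap[OF c' c]
    by eventually_elim (use c in \<open>simp add: M.chart_inv_chart charts_at_iff\<close>)
  have ev2: "\<forall>\<^sub>F y in nhds (snd c' x). f (chart_inv c (?T y)) \<in> fst d"
    using has_derivative_eventually_image[OF T, of "\<lambda>y. f (chart_inv c y) \<in> fst d"] ev Tx by simp
  have ev3: "\<forall>\<^sub>F y in nhds (snd c' x). (?F \<circ> ?T) y \<in> snd d ` (fst d \<inter> fst d')"
    using d d' Fx Tx
    by (intro has_derivative_eventually_image[OF FT] eventually_nhds_in_open N.open_overlap)
      (auto simp: charts_at_iff)
  \<comment> \<open>A value of \<open>f\<close> in the domain of \<open>d\<close> whose coordinate
    comes from the overlap lies in the overlap, because \<open>snd d\<close> is injective.\<close>
  have ev4: "\<forall>\<^sub>F y in nhds (snd c' x). f (chart_inv c' y) \<in> fst d \<inter> fst d'"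
    using ev1 ev2 ev3
  proof eventually_elim
    case (elim y)
    then obtain z where z: "z \<in> fst d \<inter> fst d'" "snd d (f (chart_inv c' y)) = snd d z" by auto
    then have "z = f (chart_inv c' y)"
      using N.inj_chart[of d] d elim by (auto simp: charts_at_iff inj_on_def)
    then show ?case using z by simp
  qed
  have "((snd d' \<circ> chart_inv d) \<circ> (?F \<circ> ?T) has_derivative
      jacobian d d' (f x) \<circ> (D \<circ> jacobian c' c x)) (at (snd c' x))"
    by (rule diff_chain_at[OF FT J])
  then have "(snd d' \<circ> f \<circ> chart_inv c' has_derivative
      jacobian d d' (f x) \<circ> (D \<circ> jacobian c' c x)) (at (snd c' x))"
  proof (rule has_derivative_eventually_cong)
    show "\<forall>\<^sub>F y in nhds (snd c' x).
        (snd d' \<circ> chart_inv d \<circ> (?F \<circ> ?T)) y = (snd d' \<circ> f \<circ> chart_inv c') y"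
      using ev1 ev4
      by eventually_elim (use d in \<open>auto simp: N.chart_inv_chart charts_at_iff\<close>)
  qed
  moreover have "\<forall>\<^sub>F y in nhds (snd c' x). f (chart_inv c' y) \<in> fst d'"
    using ev4 by eventually_elim simp
  ultimately show ?thesis
    using c' d' by (simp add: has_local_derivative_def o_def)
qed

text \<open>The candidate is prescribed in the one chart \<open>d\<close>; the change of charts
  shows that it meets the defining condition in all pairs of charts, and its coordinate in
  \<open>d\<close> makes it unique.\<close>

lemma tangent_map:
  assumes loc: "has_local_derivative M N f x c d D" and v: "v \<in> tangent_space M x"
  shows tangent_map_tangent_space: "tangent_map M N f v \<in> tangent_space N (f x)"
    and tangent_map_coord: "snd (tangent_map M N f v) d = D (snd v c)"
proof -
  have c: "c \<in> charts_at M x" and d: "d \<in> charts_at N (f x)"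
    using loc by (auto simp: has_local_derivative_def)
  have x: "fst v = x" using v by (rule tangent_space_fst)
  define u where "u = tvec_of N d (f x) (D (snd v c))"
  have u: "u \<in> tangent_space N (f x)" "snd u d = D (snd v c)"
    using d by (simp_all add: u_def N.tvec_of_tangent_space N.tvec_of_coord)
  have D': "frechet_derivative (snd d' \<circ> f \<circ> chart_inv c') (at (snd c' x)) (snd v c') = snd u d'"
    if c': "c' \<in> charts_at M x" and d': "d' \<in> charts_at N (f x)" for c' d'
  proof -
    have "frechet_derivative (snd d' \<circ> f \<circ> chart_inv c') (at (snd c' x))
        = (\<lambda>e. jacobian d d' (f x) (D (jacobian c' c x e)))"
      using has_local_derivative_change_charts[OF loc c' d']
      by (auto simp: has_local_derivative_def intro: frechet_derivativeI)
    then show ?thesis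
      using tangent_space_jacobian[OF v c' c] tangent_space_jacobian[OF u(1) d d'] u(2) by simp
  qed
  have "tangent_map M N f v = u"
    unfolding tangent_map_def x
  proof (rule the_equality)
    show "u \<in> tangent_space N (f x) \<and> (\<forall>c\<in>charts_at M x. \<forall>d\<in>charts_at N (f x).
        snd u d = frechet_derivative (snd d \<circ> f \<circ> chart_inv c) (at (snd c x)) (snd v c))"
      using u(1) D' by simp
  next
    fix u' assume "u' \<in> tangent_space N (f x) \<and> (\<forall>c\<in>charts_at M x. \<forall>d\<in>charts_at N (f x).
        snd u' d = frechet_derivative (snd d \<circ> f \<circ> chart_inv c) (at (snd c x)) (snd v c))"
    then have "u' \<in> tangent_space N (f x)"
      and "snd u' d = frechet_derivative (snd d \<circ> f \<circ> chart_inv c) (at (snd c x)) (snd v c)"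
      using c d by blast+
    then have "u' \<in> tangent_space N (f x)" "snd u' d = snd u d"
      by (simp_all add: D'[OF c d])
    then show "u' = u"
      by (intro tangent_space_eqI[OF _ u(1) d])
  qed
  then show "tangent_map M N f v \<in> tangent_space N (f x)" "snd (tangent_map M N f v) d = D (snd v c)"
    using u by simp_all
qed

lemma tangent_map_add:
  assumes loc: "has_local_derivative M N f x c d D"
    and u: "u \<in> tangent_space M x" and v: "v \<in> tangent_space M x"
  shows "tangent_map M N f (tvec_add u v) = tvec_add (tangent_map M N f u) (tangent_map M N f v)"
proof (rule tangent_space_eqI)
  show "d \<in> charts_at N (f x)"
    using loc by (simp add: has_local_derivative_def)
  have "linear D"
    using loc has_derivative_linear by (auto simp: has_local_derivative_def)
  then show "snd (tangent_map M N f (tvec_add u v)) d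
      = snd (tvec_add (tangent_map M N f u) (tangent_map M N f v)) d"
    using tangent_map_coord[OF loc] u v M.tvec_add_tangent_space[OF u v]
    by (simp add: tvec_add_def linear_add)
  show "tangent_map M N f (tvec_add u v) \<in> tangent_space N (f x)"
    by (rule tangent_map_tangent_space[OF loc M.tvec_add_tangent_space[OF u v]])
  show "tvec_add (tangent_map M N f u) (tangent_map M N f v) \<in> tangent_space N (f x)"
    by (rule N.tvec_add_tangent_space[OF tangent_map_tangent_space[OF loc u]
          tangent_map_tangent_space[OF loc v]])
qed

lemma tangent_map_scale:
  assumes loc: "has_local_derivative M N f x c d D" and v: "v \<in> tangent_space M x"
  shows "tangent_map M N f (tvec_scale r v) = tvec_scale r (tangent_map M N f v)"
proof (rule tangent_space_eqI)
  show "d \<in> charts_at N (f x)"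
    using loc by (simp add: has_local_derivative_def)
  have lin: "linear D"
    using loc has_derivative_linear by (auto simp: has_local_derivative_def)
  show "snd (tangent_map M N f (tvec_scale r v)) d
      = snd (tvec_scale r (tangent_map M N f v)) d"
    using tangent_map_coord[OF loc v] tangent_map_coord[OF loc M.tvec_scale_tangent_space[OF v]]
    by (simp add: tvec_scale_def linear_scale[OF lin])
  show "tangent_map M N f (tvec_scale r v) \<in> tangent_space N (f x)"
    by (rule tangent_map_tangent_space[OF loc M.tvec_scale_tangent_space[OF v]])
  show "tvec_scale r (tangent_map M N f v) \<in> tangent_space N (f x)"
    by (rule N.tvec_scale_tangent_space[OF tangent_map_tangent_space[OF loc v]])
qed

end

text \<open>In suitable charts the composite of the local expressions is the identity near the
  point, so uniqueness of derivatives makes the two derivatives inverse on one side.\<close>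

lemma tangent_map_left_inverse:
  assumes M: "C1_atlas M" and N: "C1_atlas N"
    and f: "has_local_derivative M N f x c d D" and g: "has_local_derivative N M g (f x) d' c' E"
    and W: "openin (manifold_topology M) W" "x \<in> W" and gf: "\<And>y. y \<in> W \<Longrightarrow> g (f y) = y"
    and v: "v \<in> tangent_space M x"
  shows "tangent_map N M g (tangent_map M N f v) = v"
proof -
  interpret M: C1_atlas M by (rule M)
  interpret N: C1_atlas N by (rule N)
  interpret MN: C1_atlas_pair M N by (rule C1_atlas_pair.intro[OF M N])
  interpret NM: C1_atlas_pair N M by (rule C1_atlas_pair.intro[OF N M])
  have c: "c \<in> charts_at M x" and d: "d \<in> charts_at N (f x)"
    and D: "((snd d \<circ> f \<circ> chart_inv c) has_derivative D) (at (snd c x))"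
    and ev: "\<forall>\<^sub>F y in nhds (snd c x). f (chart_inv c y) \<in> fst d"
    using f by (auto simp: has_local_derivative_def)
  have gfx: "g (f x) = x" using gf W by simp
  have cg: "c \<in> charts_at M (g (f x))" using c gfx by simp
  \<comment> \<open>The charts given for \<open>g\<close> may differ from those for
    \<open>f\<close>; in \<open>d\<close> and \<open>c\<close> the two local expressions can be
    composed.\<close>
  obtain E' where g': "has_local_derivative N M g (f x) d c E'"
    using NM.has_local_derivative_change_charts[OF g d cg] by blast
  then have E': "((snd c \<circ> g \<circ> chart_inv d) has_derivative E') (at (snd d (f x)))"
    by (simp add: has_local_derivative_def)
  have cM: "c \<in> M" using c by (simp add: charts_at_iff)
  have "((snd c \<circ> g \<circ> chart_inv d) \<circ> (snd d \<circ> f \<circ> chart_inv c) has_derivative E' \<circ> D) (at (snd c x))"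
    using E' c by (intro diff_chain_at[OF D]) (simp add: M.chart_inv_chart charts_at_iff)
  moreover have "\<forall>\<^sub>F y in nhds (snd c x).
      ((snd c \<circ> g \<circ> chart_inv d) \<circ> (snd d \<circ> f \<circ> chart_inv c)) y = y"
  proof -
    have "\<forall>\<^sub>F y in nhds (snd c x). chart_inv c y \<in> W \<inter> fst c \<and> snd c (chart_inv c y) = y"
      using W c cM
      by (intro M.eventually_in_chart) (auto simp: M.openin_manifold_topology charts_at_iff)
    then show ?thesis
      using ev
      by eventually_elim (use d gf in \<open>auto simp: N.chart_inv_chart charts_at_iff\<close>)
  qed
  ultimately have "((\<lambda>y. y) has_derivative E' \<circ> D) (at (snd c x))"
    by (rule has_derivative_eventually_cong)
  then have "E' \<circ> D = (\<lambda>y. y)"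
    using has_derivative_ident by (rule has_derivative_unique)
  then have ED: "E' (D e) = e" for e
    by (simp add: fun_eq_iff)
  have "tangent_map M N f v \<in> tangent_space N (f x)"
    by (rule MN.tangent_map_tangent_space[OF f v])
  note T = NM.tangent_map[OF g' this]
  show ?thesis
    by (rule tangent_space_eqI[OF _ v c])
      (use T gfx MN.tangent_map_coord[OF f v] ED in simp_all)
qed

section \<open>Products and tangent bundles\<close>

text \<open>\<open>chart_inv\<close> is a choice of preimages. It suffices to have a coordinate
  formula \<open>g\<close> that reproduces \<open>h\<close> at points of the manifold, where no
  inverse chart appears.\<close>

lemma has_derivative_chart_expr:
  assumes "inj_on (snd c) (fst c)" "open (snd c ` A)" "A \<subseteq> fst c" "x \<in> A"
    and "(g has_derivative D) (at (snd c x))" and "\<And>z. z \<in> A \<Longrightarrow> g (snd c z) = h z"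
  shows "((h \<circ> chart_inv c) has_derivative D) (at (snd c x))"
proof (rule has_derivative_eventually_cong[OF assms(5)])
  have "\<forall>\<^sub>F y in nhds (snd c x). y \<in> snd c ` A"
    using assms(2,4) by (intro eventually_nhds_in_open) auto
  then show "\<forall>\<^sub>F y in nhds (snd c x). g y = (h \<circ> chart_inv c) y"
  proof eventually_elim
    case (elim y)
    then obtain z where z: "z \<in> A" "y = snd c z" by blast
    then have "chart_inv c y = z"
      using assms(1,3) by (auto simp: chart_inv_def)
    then show ?case
      using assms(6) z by simp
  qed
qed

text \<open>The witness \<open>g\<close> is a coordinate formula for the transition, so the inverse
  of a bundle chart need not be computed.\<close>

lemma C1_atlasI:
  assumes inj: "\<And>c. c \<in> M \<Longrightarrow> inj_on (snd c) (fst c)"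
    and op: "\<And>c c'. c \<in> M \<Longrightarrow> c' \<in> M \<Longrightarrow> open (snd c ` (fst c \<inter> fst c'))"
    and der: "\<And>c c' x. c \<in> charts_at M x \<Longrightarrow> c' \<in> charts_at M x \<Longrightarrow>
      \<exists>g D. (g has_derivative D) (at (snd c x)) \<and> (\<forall>z\<in>fst c \<inter> fst c'. g (snd c z) = snd c' z)"
  shows "C1_atlas M"
proof
  fix c c' x assume c: "c \<in> M" "c' \<in> M" "x \<in> fst c" "x \<in> fst c'"
  then obtain g D where gD: "(g has_derivative D) (at (snd c x))"
    "\<And>z. z \<in> fst c \<inter> fst c' \<Longrightarrow> g (snd c z) = snd c' z"
    using der[of c x c'] unfolding charts_at_iff by blast
  then have "((snd c' \<circ> chart_inv c) has_derivative D) (at (snd c x))"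
    using c by (intro has_derivative_chart_expr[OF inj op _ _ gD]) auto
  then show "(snd c' \<circ> chart_inv c) differentiable (at (snd c x))"
    unfolding differentiable_def by blast
qed (use inj op in auto)

context C1_atlas
begin

lemma jacobian_eqI:
  assumes "c \<in> charts_at M x" "c' \<in> charts_at M x" "(g has_derivative D) (at (snd c x))"
    and "\<And>z. z \<in> fst c \<inter> fst c' \<Longrightarrow> g (snd c z) = snd c' z"
  shows "jacobian c c' x = D"
  unfolding jacobian_def
  by (rule frechet_derivativeI, rule has_derivative_chart_expr[OF inj_chart open_overlap _ _ assms(3,4)])
    (use assms(1,2) in \<open>auto simp: charts_at_iff\<close>)

lemma has_local_derivativeI:
  assumes c: "c \<in> charts_at M x" and d: "d \<in> charts_at N (f x)"
    and A: "openin (manifold_topology M) A" "x \<in> A" "A \<subseteq> fst c" "f ` A \<subseteq> fst d"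
    and g: "(g has_derivative D) (at (snd c x))" "\<And>z. z \<in> A \<Longrightarrow> g (snd c z) = snd d (f z)"
  shows "has_local_derivative M N f x c d D"
proof -
  have cM: "c \<in> M" using c by (simp add: charts_at_iff)
  have "A \<inter> fst c = A" using A(3) by blast
  then have op: "open (snd c ` A)"
    using A(1) cM by (metis openin_manifold_topology)
  have "((snd d \<circ> f \<circ> chart_inv c) has_derivative D) (at (snd c x))"
    using g A by (intro has_derivative_chart_expr[OF inj_chart[OF cM] op]) auto
  moreover have "\<forall>\<^sub>F y in nhds (snd c x). f (chart_inv c y) \<in> fst d"
    using eventually_in_chart[OF cM op A(3,2)] by eventually_elim (use A(4) in auto)
  ultimately show ?thesis
    using c d by (simp add: has_local_derivative_def)
qed

lemma openin_overlap:
  assumes "c \<in> M" "c' \<in> M"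
  shows "openin (manifold_topology M) (fst c \<inter> fst c')"
  unfolding openin_manifold_topology
proof (intro conjI ballI)
  show "fst c \<inter> fst c' \<subseteq> points M"
    using assms by (auto simp: points_def)
  fix d assume d: "d \<in> M"
  have "snd d ` (fst c \<inter> fst c' \<inter> fst d) = snd d ` (fst d \<inter> fst c) \<inter> snd d ` (fst d \<inter> fst c')"
    using inj_chart[OF d] by (auto simp: inj_on_def)
  then show "open (snd d ` (fst c \<inter> fst c' \<inter> fst d))"
    using open_overlap d assms by (simp add: open_Int)
qed

lemma openin_chart: "c \<in> M \<Longrightarrow> openin (manifold_topology M) (fst c)"
  using openin_overlap[of c c] by simp

lemma in_tangent_chart: "v \<in> fst (tangent_chart M c) \<longleftrightarrow> v \<in> tangent_space M (fst v) \<and> fst v \<in> fst c"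
  by (auto simp: tangent_chart_def dest: tangent_space_fst)

lemma points_tangent_bundle: "v \<in> points (tangent_bundle M) \<longleftrightarrow> v \<in> tangent_space M (fst v)"
  using tangent_space_points points_charts_at[of "fst v"]
  by (fastforce simp: points_def tangent_bundle_def in_tangent_chart charts_at_iff)

lemma charts_at_tangent_bundle:
  "v \<in> tangent_space M x \<Longrightarrow> charts_at (tangent_bundle M) v = tangent_chart M ` charts_at M x"
  by (auto simp: charts_at_def tangent_bundle_def in_tangent_chart tangent_space_fst)

lemma inj_tangent_chart:
  assumes "c \<in> M"
  shows "inj_on (snd (tangent_chart M c)) (fst (tangent_chart M c))"
proof (rule inj_onI)
  fix u v
  assume uv: "u \<in> fst (tangent_chart M c)" "v \<in> fst (tangent_chart M c)"
    and eq: "snd (tangent_chart M c) u = snd (tangent_chart M c) v"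
  then have "snd c (fst u) = snd c (fst v)" "snd u c = snd v c"
    by (simp_all add: tangent_chart_def)
  moreover from this have "fst u = fst v"
    using inj_onD[OF inj_chart[OF assms]] uv by (simp add: in_tangent_chart)
  ultimately show "u = v"
    using uv assms tangent_space_eqI[of u M "fst u" v c] by (simp add: in_tangent_chart charts_at_iff)
qed

lemma tangent_chart_image:
  assumes "c \<in> M" "c' \<in> M"
  shows "snd (tangent_chart M c) ` (fst (tangent_chart M c) \<inter> fst (tangent_chart M c'))
    = snd c ` (fst c \<inter> fst c') \<times> UNIV"
proof (intro equalityI subsetI)
  fix y assume "y \<in> snd (tangent_chart M c) ` (fst (tangent_chart M c) \<inter> fst (tangent_chart M c'))"
  then show "y \<in> snd c ` (fst c \<inter> fst c') \<times> UNIV"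
    by (auto simp: in_tangent_chart) (auto simp: tangent_chart_def)
next
  fix y assume "y \<in> snd c ` (fst c \<inter> fst c') \<times> (UNIV :: 'e set)"
  then obtain x e where x: "x \<in> fst c" "x \<in> fst c'" "y = (snd c x, e)" by auto
  then have c: "c \<in> charts_at M x" using assms by (simp add: charts_at_iff)
  have v: "tvec_of M c x e \<in> fst (tangent_chart M c) \<inter> fst (tangent_chart M c')"
    using x tvec_of_tangent_space[OF c] tangent_space_fst[OF tvec_of_tangent_space[OF c]]
    by (simp add: in_tangent_chart)
  have "y = snd (tangent_chart M c) (tvec_of M c x e)"
    using x tvec_of_coord[OF c] tangent_space_fst[OF tvec_of_tangent_space[OF c]]
    by (simp add: tangent_chart_def)
  then show "y \<in> snd (tangent_chart M c) ` (fst (tangent_chart M c) \<inter> fst (tangent_chart M c'))"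
    using v by (rule image_eqI)
qed

end

section \<open>Product charts and their projections\<close>

definition prod_chart ::
    "('a, 'e::real_inner) chart \<Rightarrow> ('b, 'f::real_inner) chart \<Rightarrow> ('a \<times> 'b, 'e \<times> 'f) chart" where
  "prod_chart c d = (fst c \<times> fst d, map_prod (snd c) (snd d))"

lemma prod_chart_simps:
  "fst (prod_chart c d) = fst c \<times> fst d"
  "snd (prod_chart c d) z = (snd c (fst z), snd d (snd z))"
  by (simp_all add: prod_chart_def map_prod_def split_beta)

lemma in_prod_atlas: "C \<in> prod_atlas M N \<longleftrightarrow> (\<exists>c\<in>M. \<exists>d\<in>N. C = prod_chart c d)"
  unfolding prod_atlas_def prod_chart_def by blast

lemma charts_at_prod:
  "C \<in> charts_at (prod_atlas M N) (x, y) \<longleftrightarrow>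
    (\<exists>c\<in>charts_at M x. \<exists>d\<in>charts_at N y. C = prod_chart c d)"
proof
  assume "C \<in> charts_at (prod_atlas M N) (x, y)"
  then obtain c d where "c \<in> M" "d \<in> N" "C = prod_chart c d" "(x, y) \<in> fst C"
    unfolding charts_at_iff in_prod_atlas by blast
  then have "c \<in> charts_at M x" "d \<in> charts_at N y"
    by (simp_all add: charts_at_iff prod_chart_simps)
  then show "\<exists>c\<in>charts_at M x. \<exists>d\<in>charts_at N y. C = prod_chart c d"
    using \<open>C = prod_chart c d\<close> by blast
next
  assume "\<exists>c\<in>charts_at M x. \<exists>d\<in>charts_at N y. C = prod_chart c d"
  then obtain c d where "c \<in> charts_at M x" "d \<in> charts_at N y" "C = prod_chart c d"
    by blast
  then show "C \<in> charts_at (prod_atlas M N) (x, y)"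
    unfolding charts_at_iff in_prod_atlas prod_chart_simps by (auto simp: prod_chart_simps)
qed

context C1_atlas_pair
begin

lemma C1_atlas_prod: "C1_atlas (prod_atlas M N)"
proof (rule C1_atlasI)
  fix C assume "C \<in> prod_atlas M N"
  then obtain c d where "c \<in> M" "d \<in> N" "C = prod_chart c d"
    unfolding in_prod_atlas by blast
  then show "inj_on (snd C) (fst C)"
    using map_prod_inj_on[OF M.inj_chart N.inj_chart] by (simp add: prod_chart_def)
next
  fix C C' assume "C \<in> prod_atlas M N" "C' \<in> prod_atlas M N"
  then obtain c d c' d' where C: "c \<in> M" "d \<in> N" "C = prod_chart c d"
    and C': "c' \<in> M" "d' \<in> N" "C' = prod_chart c' d'"
    unfolding in_prod_atlas by blast
  have "snd C ` (fst C \<inter> fst C') = snd c ` (fst c \<inter> fst c') \<times> snd d ` (fst d \<inter> fst d')"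
    by (simp add: C C' prod_chart_def Times_Int_Times map_prod_surj_on)
  then show "open (snd C ` (fst C \<inter> fst C'))"
    using C C' by (simp add: open_Times M.open_overlap N.open_overlap)
next
  fix C C' and z :: "'a \<times> 'b"
  assume z: "C \<in> charts_at (prod_atlas M N) z" "C' \<in> charts_at (prod_atlas M N) z"
  obtain x y where xy: "z = (x, y)" by fastforce
  obtain c d c' d' where c: "c \<in> charts_at M x" "c' \<in> charts_at M x"
    and d: "d \<in> charts_at N y" "d' \<in> charts_at N y"
    and C: "C = prod_chart c d" "C' = prod_chart c' d'"
    using z unfolding xy charts_at_prod by blast
  have sC: "snd C z = (snd c x, snd d y)"
    by (simp add: C prod_chart_simps xy)
  let ?g = "\<lambda>p. ((snd c' \<circ> chart_inv c) (fst p), (snd d' \<circ> chart_inv d) (snd p))"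
  have "((\<lambda>p. (snd c' \<circ> chart_inv c) (fst p)) has_derivative (\<lambda>h. jacobian c c' x (fst h)))
      (at (snd c x, snd d y))"
    by (rule has_derivative_compose[OF bounded_linear_imp_has_derivative[OF bounded_linear_fst]])
      (simp add: M.has_derivative_transition[OF c, unfolded o_def])
  moreover have "((\<lambda>p. (snd d' \<circ> chart_inv d) (snd p)) has_derivative (\<lambda>h. jacobian d d' y (snd h)))
      (at (snd c x, snd d y))"
    by (rule has_derivative_compose[OF bounded_linear_imp_has_derivative[OF bounded_linear_snd]])
      (simp add: N.has_derivative_transition[OF d, unfolded o_def])
  ultimately have "(?g has_derivative (\<lambda>h. (jacobian c c' x (fst h), jacobian d d' y (snd h)))) (at (snd C z))"
    unfolding sC by (rule has_derivative_Pair)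
  moreover have "\<forall>p\<in>fst C \<inter> fst C'. ?g (snd C p) = snd C' p"
    using c d by (auto simp: C prod_chart_simps M.chart_inv_chart N.chart_inv_chart charts_at_iff)
  ultimately show "\<exists>g D. (g has_derivative D) (at (snd C z)) \<and>
      (\<forall>p\<in>fst C \<inter> fst C'. g (snd C p) = snd C' p)" by blast
qed

lemma has_local_derivative_fst:
  assumes "c \<in> charts_at M x" "d \<in> charts_at N y"
  shows "has_local_derivative (prod_atlas M N) M fst (x, y) (prod_chart c d) c fst"
proof -
  interpret P: C1_atlas "prod_atlas M N" by (rule C1_atlas_prod)
  have C: "prod_chart c d \<in> charts_at (prod_atlas M N) (x, y)"
    unfolding charts_at_prod using assms by blast
  show ?thesis
  proof (rule P.has_local_derivativeI[OF C, where A = "fst (prod_chart c d)"])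
    show "openin (manifold_topology (prod_atlas M N)) (fst (prod_chart c d))"
      using C by (intro P.openin_chart) (simp add: charts_at_iff)
    show "(fst has_derivative fst) (at (snd (prod_chart c d) (x, y)))"
      by (rule bounded_linear_imp_has_derivative[OF bounded_linear_fst])
  qed (use assms in \<open>auto simp: charts_at_iff prod_chart_simps\<close>)
qed

lemma has_local_derivative_snd:
  assumes "c \<in> charts_at M x" "d \<in> charts_at N y"
  shows "has_local_derivative (prod_atlas M N) N snd (x, y) (prod_chart c d) d snd"
proof -
  interpret P: C1_atlas "prod_atlas M N" by (rule C1_atlas_prod)
  have C: "prod_chart c d \<in> charts_at (prod_atlas M N) (x, y)"
    unfolding charts_at_prod using assms by blast
  show ?thesis
  proof (rule P.has_local_derivativeI[OF C, where A = "fst (prod_chart c d)"])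
    show "openin (manifold_topology (prod_atlas M N)) (fst (prod_chart c d))"
      using C by (intro P.openin_chart) (simp add: charts_at_iff)
    show "(snd has_derivative snd) (at (snd (prod_chart c d) (x, y)))"
      by (rule bounded_linear_imp_has_derivative[OF bounded_linear_snd])
  qed (use assms in \<open>auto simp: charts_at_iff prod_chart_simps\<close>)
qed

end

section \<open>Covectors\<close>

lemma cotangent_space_iff:
  "\<alpha> \<in> cotangent_space M x \<longleftrightarrow> fst \<alpha> = x \<and> x \<in> points M \<and>
     (\<forall>v. v \<notin> tangent_space M x \<longrightarrow> pairing \<alpha> v = 0) \<and>
     (\<forall>u\<in>tangent_space M x. \<forall>v\<in>tangent_space M x. pairing \<alpha> (tvec_add u v) = pairing \<alpha> u + pairing \<alpha> v) \<and>
     (\<forall>r. \<forall>v\<in>tangent_space M x. pairing \<alpha> (tvec_scale r v) = r * pairing \<alpha> v)"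
  by (cases \<alpha>) (auto simp: cotangent_space_def pairing_def)

lemma cotangent_space_fst: "\<alpha> \<in> cotangent_space M x \<Longrightarrow> fst \<alpha> = x"
  unfolding cotangent_space_iff by blast

lemma cotangent_space_points: "\<alpha> \<in> cotangent_space M x \<Longrightarrow> x \<in> points M"
  unfolding cotangent_space_iff by blast

lemma cotangent_space_eqI:
  assumes "\<alpha> \<in> cotangent_space M x" "\<beta> \<in> cotangent_space M x"
    and "\<And>v. v \<in> tangent_space M x \<Longrightarrow> pairing \<alpha> v = pairing \<beta> v"
  shows "\<alpha> = \<beta>"
proof (rule prod_eqI)
  show "fst \<alpha> = fst \<beta>"
    using assms(1,2) by (simp add: cotangent_space_fst)
  show "snd \<alpha> = snd \<beta>"
  proof
    fix v show "snd \<alpha> v = snd \<beta> v"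
      using assms unfolding cotangent_space_iff pairing_def by (cases "v \<in> tangent_space M x") metis+
  qed
qed

text \<open>The fibre part of \<open>cotangent_chart\<close>, named so that existence and uniqueness
  in the description can be treated by themselves.\<close>

definition momentum ::
    "('a, 'e::real_inner) atlas \<Rightarrow> ('a, 'e) chart \<Rightarrow> ('a, 'e) cotvec \<Rightarrow> 'e" where
  "momentum M c \<alpha> = (THE p. \<forall>v\<in>tangent_space M (fst \<alpha>). pairing \<alpha> v = p \<bullet> snd v c)"

lemma snd_cotangent_chart: "snd (cotangent_chart M c) \<alpha> = (snd c (fst \<alpha>), momentum M c \<alpha>)"
  by (simp add: cotangent_chart_def momentum_def)

lemma snd_tangent_chart: "snd (tangent_chart M c) v = (snd c (fst v), snd v c)"
  by (simp add: tangent_chart_def)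

definition cotvec_of ::
    "('a, 'e::real_inner) atlas \<Rightarrow> ('a, 'e) chart \<Rightarrow> 'a \<Rightarrow> 'e \<Rightarrow> ('a, 'e) cotvec" where
  "cotvec_of M c x p = (x, \<lambda>v. if v \<in> tangent_space M x then p \<bullet> snd v c else 0)"

text \<open>The frame carries the finite dimension of the model space, by which every covector has a
  momentum.\<close>

locale C1_atlas_frame = C1_atlas M for M :: "('a, 'e::real_inner) atlas" +
  fixes B :: "'e set" and g :: "'e \<Rightarrow> 'e"
  assumes frame: "dual_frame B g"
begin

text \<open>Every \<open>e\<close> of the model space is the coordinate of some tangent vector at
  \<open>x\<close>, so two candidates have the same inner product with every vector.\<close>

lemma momentum_eqI:
  assumes c: "c \<in> charts_at M x" and "fst \<alpha> = x"
    and p: "\<And>v. v \<in> tangent_space M x \<Longrightarrow> pairing \<alpha> v = p \<bullet> snd v c"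
  shows "momentum M c \<alpha> = p"
  unfolding momentum_def \<open>fst \<alpha> = x\<close>
proof (rule the_equality)
  fix p' assume p': "\<forall>v\<in>tangent_space M x. pairing \<alpha> v = p' \<bullet> snd v c"
  have "\<forall>e. p' \<bullet> e = p \<bullet> e"
    using p' p tvec_of_tangent_space[OF c] tvec_of_coord[OF c] by metis
  then show "p' = p"
    by (simp add: vector_eq_rdot)
qed (use p in blast)

text \<open>Read through the chart, the covector becomes a linear functional \<open>h\<close> on the
  model space, and the frame supplies its Riesz vector.\<close>

lemma momentum:
  assumes \<alpha>: "\<alpha> \<in> cotangent_space M x" and c: "c \<in> charts_at M x" and v: "v \<in> tangent_space M x"
  shows "pairing \<alpha> v = momentum M c \<alpha> \<bullet> snd v c"
proof -
  note T = tvec_of_tangent_space[OF c]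
  define h where "h e = pairing \<alpha> (tvec_of M c x e)" for e
  have h: "pairing \<alpha> u = h (snd u c)" if u: "u \<in> tangent_space M x" for u
  proof -
    have "u = tvec_of M c x (snd u c)"
      by (rule tangent_space_eqI[OF u T c]) (simp add: tvec_of_coord[OF c])
    then show ?thesis by (simp add: h_def)
  qed
  have "linear h"
  proof (rule linearI)
    fix e e' :: 'e and r
    have "h (e + e') = pairing \<alpha> (tvec_add (tvec_of M c x e) (tvec_of M c x e'))"
      using h[OF tvec_add_tangent_space[OF T T], of e e']
      by (simp add: tvec_add_def tvec_of_coord[OF c])
    then show "h (e + e') = h e + h e'"
      using \<alpha> T unfolding cotangent_space_iff h_def by metis
    have "h (r *\<^sub>R e) = pairing \<alpha> (tvec_scale r (tvec_of M c x e))"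
      using h[OF tvec_scale_tangent_space[OF T], of r e]
      by (simp add: tvec_scale_def tvec_of_coord[OF c])
    then show "h (r *\<^sub>R e) = r *\<^sub>R h e"
      using \<alpha> T unfolding cotangent_space_iff h_def by (metis real_scaleR_def)
  qed
  then have "pairing \<alpha> u = (\<Sum>b\<in>B. h b *\<^sub>R g b) \<bullet> snd u c" if "u \<in> tangent_space M x" for u
    using h[OF that] dual_frame_riesz[OF frame] by simp
  moreover from this have "momentum M c \<alpha> = (\<Sum>b\<in>B. h b *\<^sub>R g b)"
    by (intro momentum_eqI[OF c cotangent_space_fst[OF \<alpha>]])
  ultimately show ?thesis using v by simp
qed

lemma cotvec_of_cotangent_space:
  assumes c: "c \<in> charts_at M x"
  shows "cotvec_of M c x p \<in> cotangent_space M x"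
  unfolding cotangent_space_iff
  using charts_at_points[OF c] tvec_add_tangent_space[of _ x] tvec_scale_tangent_space[of _ x]
  by (simp add: cotvec_of_def pairing_def)
    (simp add: tvec_add_def tvec_scale_def inner_add_right)

lemma momentum_cotvec_of:
  assumes c: "c \<in> charts_at M x"
  shows "momentum M c (cotvec_of M c x p) = p"
  by (rule momentum_eqI[OF c]) (simp_all add: cotvec_of_def pairing_def)

lemma cotangent_space_momentum_eqI:
  assumes "\<alpha> \<in> cotangent_space M x" "\<beta> \<in> cotangent_space M x" "c \<in> charts_at M x"
    and "momentum M c \<alpha> = momentum M c \<beta>"
  shows "\<alpha> = \<beta>"
  by (rule cotangent_space_eqI[OF assms(1,2)]) (simp add: momentum[OF _ assms(3)] assms)

lemma in_cotangent_chart: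
  "\<alpha> \<in> fst (cotangent_chart M c) \<longleftrightarrow> \<alpha> \<in> cotangent_space M (fst \<alpha>) \<and> fst \<alpha> \<in> fst c"
  by (auto simp: cotangent_chart_def dest: cotangent_space_fst)

lemma points_cotangent_bundle:
  "\<alpha> \<in> points (cotangent_bundle M) \<longleftrightarrow> \<alpha> \<in> cotangent_space M (fst \<alpha>)"
  using cotangent_space_points points_charts_at[of "fst \<alpha>"]
  by (fastforce simp: points_def cotangent_bundle_def in_cotangent_chart charts_at_iff)

lemma charts_at_cotangent_bundle:
  "\<alpha> \<in> cotangent_space M x \<Longrightarrow> charts_at (cotangent_bundle M) \<alpha> = cotangent_chart M ` charts_at M x"
  by (auto simp: charts_at_def cotangent_bundle_def in_cotangent_chart cotangent_space_fst)

lemma inj_cotangent_chart: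
  assumes "c \<in> M"
  shows "inj_on (snd (cotangent_chart M c)) (fst (cotangent_chart M c))"
proof (rule inj_onI)
  fix u v
  assume uv: "u \<in> fst (cotangent_chart M c)" "v \<in> fst (cotangent_chart M c)"
    and eq: "snd (cotangent_chart M c) u = snd (cotangent_chart M c) v"
  then have "snd c (fst u) = snd c (fst v)" "momentum M c u = momentum M c v"
    by (simp_all add: snd_cotangent_chart)
  moreover from this have "fst u = fst v"
    using inj_onD[OF inj_chart[OF assms]] uv by (simp add: in_cotangent_chart)
  ultimately show "u = v"
    using uv assms cotangent_space_momentum_eqI[of u "fst u" v c]
    by (simp add: in_cotangent_chart charts_at_iff)
qed

lemma cotangent_chart_image:
  assumes "c \<in> M" "c' \<in> M"
  shows "snd (cotangent_chart M c) ` (fst (cotangent_chart M c) \<inter> fst (cotangent_chart M c'))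
    = snd c ` (fst c \<inter> fst c') \<times> UNIV"
proof (intro equalityI subsetI)
  fix y assume "y \<in> snd (cotangent_chart M c) ` (fst (cotangent_chart M c) \<inter> fst (cotangent_chart M c'))"
  then show "y \<in> snd c ` (fst c \<inter> fst c') \<times> UNIV"
    by (auto simp: in_cotangent_chart snd_cotangent_chart)
next
  fix y assume "y \<in> snd c ` (fst c \<inter> fst c') \<times> (UNIV :: 'e set)"
  then obtain x p where x: "x \<in> fst c" "x \<in> fst c'" "y = (snd c x, p)" by auto
  then have c: "c \<in> charts_at M x" using assms by (simp add: charts_at_iff)
  note T = cotvec_of_cotangent_space[OF c, of p]
  have "cotvec_of M c x p \<in> fst (cotangent_chart M c) \<inter> fst (cotangent_chart M c')"
    using x T cotangent_space_fst[OF T] by (simp add: in_cotangent_chart)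
  moreover have "y = snd (cotangent_chart M c) (cotvec_of M c x p)"
    using x momentum_cotvec_of[OF c] cotangent_space_fst[OF T] by (simp add: snd_cotangent_chart)
  ultimately show "y \<in> snd (cotangent_chart M c) ` (fst (cotangent_chart M c) \<inter> fst (cotangent_chart M c'))"
    by blast
qed

end

section \<open>Transitions of the tangent bundle\<close>

definition hessian ::
    "('a, 'e::real_inner) chart \<Rightarrow> ('a, 'e) chart \<Rightarrow> 'a \<Rightarrow> 'e \<Rightarrow> 'e \<Rightarrow> 'e" where
  "hessian c c' x = second_derivative (snd c' \<circ> chart_inv c) (snd c x)"

text \<open>Transitions of both bundles already contain one derivative of the base transitions;
  differentiating them uses a second. This is where smoothness of the base atlas enters.\<close>

locale smooth_atlas_frame = C1_atlas_frame M B g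
  for M :: "('a, 'e::real_inner) atlas" and B g +
  assumes smooth_transition: "c \<in> M \<Longrightarrow> c' \<in> M \<Longrightarrow>
    smooth_on (snd c ` (fst c \<inter> fst c')) (snd c' \<circ> chart_inv c)"
begin

context
  fixes c c' x
  assumes c: "c \<in> charts_at M x" and c': "c' \<in> charts_at M x"
begin

lemma transition_smooth: "smooth_on (snd c ` (fst c \<inter> fst c')) (snd c' \<circ> chart_inv c)"
  "open (snd c ` (fst c \<inter> fst c'))" "snd c x \<in> snd c ` (fst c \<inter> fst c')"
  using c c' smooth_transition open_overlap by (auto simp: charts_at_iff)

lemma hessian_symmetric: "hessian c c' x u v = hessian c c' x v u"
  unfolding hessian_def by (rule second_derivative_symmetric[OF transition_smooth])

lemma has_derivative_jacobian_comp:
  "((\<lambda>z. (snd c' \<circ> chart_inv c) (fst z)) has_derivative (\<lambda>h. jacobian c c' x (fst h)))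
     (at (snd c x, e :: 'e))"
  by (rule has_derivative_compose[OF bounded_linear_imp_has_derivative[OF bounded_linear_fst]])
    (simp add: has_derivative_transition[OF c c', unfolded o_def])

lemma tangent_transition_has_derivative:
  "((\<lambda>z. ((snd c' \<circ> chart_inv c) (fst z),
          frechet_derivative (snd c' \<circ> chart_inv c) (at (fst z)) (snd z))) has_derivative
     (\<lambda>h. (jacobian c c' x (fst h), hessian c c' x e (fst h) + jacobian c c' x (snd h))))
     (at (snd c x, e))"
  unfolding hessian_def jacobian_def
  by (rule has_derivative_Pair[OF has_derivative_jacobian_comp[unfolded jacobian_def]
        has_derivative_tangent[OF frame transition_smooth]])

end

lemma tangent_transition_eq:
  assumes "c \<in> M" "c' \<in> M" "z \<in> fst (tangent_chart M c) \<inter> fst (tangent_chart M c')"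
  shows "((snd c' \<circ> chart_inv c) (snd c (fst z)),
     frechet_derivative (snd c' \<circ> chart_inv c) (at (snd c (fst z))) (snd z c)) = snd (tangent_chart M c') z"
proof -
  have z: "z \<in> tangent_space M (fst z)" "fst z \<in> fst c" "fst z \<in> fst c'"
    using assms by (auto simp: in_tangent_chart)
  then show ?thesis
    using tangent_space_jacobian[OF z(1), of c c'] assms
    by (simp add: snd_tangent_chart chart_inv_chart charts_at_iff jacobian_def o_def)
qed

lemma C1_atlas_tangent_bundle: "C1_atlas (tangent_bundle M)"
proof (rule C1_atlasI)
  fix C assume "C \<in> tangent_bundle M"
  then show "inj_on (snd C) (fst C)"
    using inj_tangent_chart by (auto simp: tangent_bundle_def)
next
  fix C C' assume "C \<in> tangent_bundle M" "C' \<in> tangent_bundle M"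
  then obtain c c' where c: "c \<in> M" "C = tangent_chart M c" "c' \<in> M" "C' = tangent_chart M c'"
    unfolding tangent_bundle_def by blast
  then show "open (snd C ` (fst C \<inter> fst C'))"
    using open_overlap tangent_chart_image by (simp add: open_Times)
next
  fix C C' u assume u: "C \<in> charts_at (tangent_bundle M) u" "C' \<in> charts_at (tangent_bundle M) u"
  then obtain c c' where c: "c \<in> M" "C = tangent_chart M c" "c' \<in> M" "C' = tangent_chart M c'"
    unfolding tangent_bundle_def charts_at_iff by blast
  then have c': "c \<in> charts_at M (fst u)" "c' \<in> charts_at M (fst u)"
    using u by (simp_all add: charts_at_iff in_tangent_chart)
  note D = tangent_transition_has_derivative[OF c', of "snd u c"]
  show "\<exists>g D. (g has_derivative D) (at (snd C u)) \<and> (\<forall>z\<in>fst C \<inter> fst C'. g (snd C z) = snd C' z)"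
    unfolding c(2,4) snd_tangent_chart[of M c]
    using D tangent_transition_eq[OF c(1,3)] by (intro exI conjI ballI) (assumption, simp)
qed

text \<open>The Hessian term combines the fibre coordinate of \<open>u\<close> with the base part of
  \<open>h\<close>. These are the two entries that the canonical involution exchanges.\<close>

lemma jacobian_tangent_chart:
  assumes u: "u \<in> tangent_space M x" and c: "c \<in> charts_at M x" "c' \<in> charts_at M x"
  shows "jacobian (tangent_chart M c) (tangent_chart M c') u h =
    (jacobian c c' x (fst h), hessian c c' x (snd u c) (fst h) + jacobian c c' x (snd h))"
proof -
  interpret T: C1_atlas "tangent_bundle M" by (rule C1_atlas_tangent_bundle)
  have cM: "c \<in> M" "c' \<in> M" using c by (simp_all add: charts_at_iff)
  have "jacobian (tangent_chart M c) (tangent_chart M c') u =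
    (\<lambda>h. (jacobian c c' x (fst h), hessian c c' x (snd u c) (fst h) + jacobian c c' x (snd h)))"
  proof (rule T.jacobian_eqI)
    show "((\<lambda>z. ((snd c' \<circ> chart_inv c) (fst z),
          frechet_derivative (snd c' \<circ> chart_inv c) (at (fst z)) (snd z))) has_derivative
     (\<lambda>h. (jacobian c c' x (fst h), hessian c c' x (snd u c) (fst h) + jacobian c c' x (snd h))))
     (at (snd (tangent_chart M c) u))"
      using tangent_transition_has_derivative[OF c, of "snd u c"]
      by (simp only: snd_tangent_chart tangent_space_fst[OF u])
    show "((snd c' \<circ> chart_inv c) (fst (snd (tangent_chart M c) z)),
          frechet_derivative (snd c' \<circ> chart_inv c) (at (fst (snd (tangent_chart M c) z)))
            (snd (snd (tangent_chart M c) z))) = snd (tangent_chart M c') z"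
      if "z \<in> fst (tangent_chart M c) \<inter> fst (tangent_chart M c')" for z
      using tangent_transition_eq[OF cM that] by (simp only: snd_tangent_chart[of M c] fst_conv snd_conv)
  qed (use u c charts_at_tangent_bundle in auto)
  then show ?thesis by simp
qed

end

section \<open>The cotangent bundle and curves\<close>

context smooth_atlas_frame
begin

text \<open>The second component transforms the momentum by the transposed derivative of the reverse
  transition, evaluated at the image point. Only the base part of \<open>D\<close> is recorded; the
  fibre part is characterised later by invariance of the pairing.\<close>

lemma cotangent_transition_has_derivative:
  assumes c: "c \<in> charts_at M x" and c': "c' \<in> charts_at M x"
  obtains D where
    "((\<lambda>z. ((snd c' \<circ> chart_inv c) (fst z),
           \<Sum>b\<in>B. (snd z \<bullet> frechet_derivative (snd c \<circ> chart_inv c')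
                      (at ((snd c' \<circ> chart_inv c) (fst z))) b) *\<^sub>R g b)) has_derivative D)
       (at (snd c x, p))"
    and "\<And>h. fst (D h) = jacobian c c' x (fst h)"
proof -
  let ?\<phi> = "snd c' \<circ> chart_inv c" and ?\<psi> = "snd c \<circ> chart_inv c'"
  have \<phi>x: "?\<phi> (snd c x) = snd c' x"
    using c by (simp add: chart_inv_chart charts_at_iff)
  have comp: "((\<lambda>z. frechet_derivative ?\<psi> (at (?\<phi> (fst z))) b) has_derivative
      (\<lambda>h. hessian c' c x b (jacobian c c' x (fst h)))) (at (snd c x, p))" for b
  proof (rule has_derivative_compose[OF has_derivative_jacobian_comp[OF c c']])
    show "((\<lambda>y. frechet_derivative ?\<psi> (at y) b) has_derivative hessian c' c x b)
        (at (?\<phi> (fst (snd c x, p))))"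
      unfolding fst_conv \<phi>x hessian_def
      by (rule smooth_on_has_second_derivative[OF transition_smooth(1,3)[OF c' c]])
  qed
  have "((\<lambda>z. \<Sum>b\<in>B. (snd z \<bullet> frechet_derivative ?\<psi> (at (?\<phi> (fst z))) b) *\<^sub>R g b) has_derivative
      (\<lambda>h. \<Sum>b\<in>B. (p \<bullet> hessian c' c x b (jacobian c c' x (fst h)) +
         snd h \<bullet> frechet_derivative ?\<psi> (at (?\<phi> (snd c x))) b) *\<^sub>R g b)) (at (snd c x, p))"
    using has_derivative_inner[OF bounded_linear_imp_has_derivative[OF bounded_linear_snd] comp]
    by (intro has_derivative_sum has_derivative_scaleR_left) simp
  from has_derivative_Pair[OF has_derivative_jacobian_comp[OF c c'] this]
  show ?thesis by (rule that) simp
qed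

text \<open>The new momentum is the Riesz vector of the old one composed with the Jacobian from
  \<open>c'\<close> to \<open>c\<close>, that is, the inverse transpose of the Jacobian from
  \<open>c\<close> to \<open>c'\<close>.\<close>

lemma momentum_transition:
  assumes \<alpha>: "\<alpha> \<in> cotangent_space M x" and c: "c \<in> charts_at M x" "c' \<in> charts_at M x"
  shows "momentum M c' \<alpha> = (\<Sum>b\<in>B. (momentum M c \<alpha> \<bullet> jacobian c' c x b) *\<^sub>R g b)"
proof (rule momentum_eqI[OF c(2) cotangent_space_fst[OF \<alpha>]])
  fix v assume v: "v \<in> tangent_space M x"
  have "linear (\<lambda>y. momentum M c \<alpha> \<bullet> jacobian c' c x y)"
    using linear_jacobian[OF c(2,1)] by (auto intro!: linearI simp: linear_add linear_scale inner_add_right)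
  from dual_frame_riesz[OF frame this, of "snd v c'"]
  show "pairing \<alpha> v = (\<Sum>b\<in>B. (momentum M c \<alpha> \<bullet> jacobian c' c x b) *\<^sub>R g b) \<bullet> snd v c'"
    by (simp only: momentum[OF \<alpha> c(1) v] tangent_space_jacobian[OF v c(2,1)])
qed

lemma cotangent_transition_eq:
  assumes "c \<in> M" "c' \<in> M" "z \<in> fst (cotangent_chart M c) \<inter> fst (cotangent_chart M c')"
  shows "((snd c' \<circ> chart_inv c) (snd c (fst z)),
     \<Sum>b\<in>B. (momentum M c z \<bullet> frechet_derivative (snd c \<circ> chart_inv c')
                      (at ((snd c' \<circ> chart_inv c) (snd c (fst z)))) b) *\<^sub>R g b)
    = snd (cotangent_chart M c') z"
proof -
  have z: "z \<in> cotangent_space M (fst z)" "c \<in> charts_at M (fst z)" "c' \<in> charts_at M (fst z)"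
    using assms by (auto simp: in_cotangent_chart charts_at_iff)
  have "(snd c' \<circ> chart_inv c) (snd c (fst z)) = snd c' (fst z)"
    using z by (simp add: chart_inv_chart charts_at_iff)
  then show ?thesis
    unfolding snd_cotangent_chart momentum_transition[OF z] jacobian_def by simp
qed

lemma C1_atlas_cotangent_bundle: "C1_atlas (cotangent_bundle M)"
proof (rule C1_atlasI)
  fix C assume "C \<in> cotangent_bundle M"
  then show "inj_on (snd C) (fst C)"
    using inj_cotangent_chart by (auto simp: cotangent_bundle_def)
next
  fix C C' assume "C \<in> cotangent_bundle M" "C' \<in> cotangent_bundle M"
  then obtain c c' where c: "c \<in> M" "C = cotangent_chart M c" "c' \<in> M" "C' = cotangent_chart M c'"
    unfolding cotangent_bundle_def by blast
  then show "open (snd C ` (fst C \<inter> fst C'))"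
    using open_overlap cotangent_chart_image by (simp add: open_Times)
next
  fix C C' u assume u: "C \<in> charts_at (cotangent_bundle M) u" "C' \<in> charts_at (cotangent_bundle M) u"
  then obtain c c' where c: "c \<in> M" "C = cotangent_chart M c" "c' \<in> M" "C' = cotangent_chart M c'"
    unfolding cotangent_bundle_def charts_at_iff by blast
  then have c': "c \<in> charts_at M (fst u)" "c' \<in> charts_at M (fst u)"
    using u by (simp_all add: charts_at_iff in_cotangent_chart)
  show "\<exists>g D. (g has_derivative D) (at (snd C u)) \<and> (\<forall>z\<in>fst C \<inter> fst C'. g (snd C z) = snd C' z)"
    unfolding c(2,4) snd_cotangent_chart[of M c]
    by (rule cotangent_transition_has_derivative[OF c', of "momentum M c u"], intro exI conjI ballI,
        assumption)
      (use cotangent_transition_eq[OF c(1,3)] in simp)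
qed

lemma fst_jacobian_cotangent_chart:
  assumes \<alpha>: "\<alpha> \<in> cotangent_space M x" and c: "c \<in> charts_at M x" "c' \<in> charts_at M x"
  shows "fst (jacobian (cotangent_chart M c) (cotangent_chart M c') \<alpha> h) = jacobian c c' x (fst h)"
proof -
  interpret T: C1_atlas "cotangent_bundle M" by (rule C1_atlas_cotangent_bundle)
  have cM: "c \<in> M" "c' \<in> M" using c by (simp_all add: charts_at_iff)
  obtain D where D: "((\<lambda>z. ((snd c' \<circ> chart_inv c) (fst z),
           \<Sum>b\<in>B. (snd z \<bullet> frechet_derivative (snd c \<circ> chart_inv c')
                      (at ((snd c' \<circ> chart_inv c) (fst z))) b) *\<^sub>R g b)) has_derivative D)
       (at (snd c x, momentum M c \<alpha>))"
    and fD: "\<And>h. fst (D h) = jacobian c c' x (fst h)"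
    by (rule cotangent_transition_has_derivative[OF c, of "momentum M c \<alpha>"], rule that)
  have "jacobian (cotangent_chart M c) (cotangent_chart M c') \<alpha> = D"
  proof (rule T.jacobian_eqI)
    show "((\<lambda>z. ((snd c' \<circ> chart_inv c) (fst z),
           \<Sum>b\<in>B. (snd z \<bullet> frechet_derivative (snd c \<circ> chart_inv c')
                      (at ((snd c' \<circ> chart_inv c) (fst z))) b) *\<^sub>R g b)) has_derivative D)
       (at (snd (cotangent_chart M c) \<alpha>))"
      using D by (simp only: snd_cotangent_chart cotangent_space_fst[OF \<alpha>])
    show "((snd c' \<circ> chart_inv c) (fst (snd (cotangent_chart M c) z)),
           \<Sum>b\<in>B. (snd (snd (cotangent_chart M c) z) \<bullet> frechet_derivative (snd c \<circ> chart_inv c')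
              (at ((snd c' \<circ> chart_inv c) (fst (snd (cotangent_chart M c) z)))) b) *\<^sub>R g b)
        = snd (cotangent_chart M c') z"
      if "z \<in> fst (cotangent_chart M c) \<inter> fst (cotangent_chart M c')" for z
      using cotangent_transition_eq[OF cM that]
      by (simp only: snd_cotangent_chart[of M c] fst_conv snd_conv)
  qed (use \<alpha> c charts_at_cotangent_bundle in auto)
  then show ?thesis by (simp add: fD)
qed

text \<open>Differentiating the invariance of the pairing \<open>p' \<bullet> D\<phi>(e) = p \<bullet> e\<close> of a covector with
  a vector avoids any formula for the derivative of the inverse transpose of the Jacobian.\<close>

lemma snd_jacobian_cotangent_chart:
  assumes \<alpha>: "\<alpha> \<in> cotangent_space M x" and c: "c \<in> charts_at M x" "c' \<in> charts_at M x"
  shows "momentum M c' \<alpha> \<bullet> hessian c c' x e (fst h)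
    + snd (jacobian (cotangent_chart M c) (cotangent_chart M c') \<alpha> h) \<bullet> jacobian c c' x e = snd h \<bullet> e"
proof -
  interpret T: C1_atlas "cotangent_bundle M" by (rule C1_atlas_cotangent_bundle)
  let ?C = "cotangent_chart M c" and ?C' = "cotangent_chart M c'"
  let ?F = "snd ?C' \<circ> chart_inv ?C" and ?\<phi> = "snd c' \<circ> chart_inv c"
  let ?z = "(snd c x, momentum M c \<alpha>)"
  have C: "?C \<in> charts_at (cotangent_bundle M) \<alpha>" "?C' \<in> charts_at (cotangent_bundle M) \<alpha>"
    using charts_at_cotangent_bundle[OF \<alpha>] c by auto
  have zC: "snd ?C \<alpha> = ?z"
    by (simp add: snd_cotangent_chart cotangent_space_fst[OF \<alpha>])
  have F: "(?F has_derivative jacobian ?C ?C' \<alpha>) (at ?z)"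
    using T.has_derivative_transition[OF C] by (simp only: zC)
  have Fz: "?F ?z = snd ?C' \<alpha>"
    unfolding zC[symmetric] using C by (simp add: T.chart_inv_chart charts_at_iff)
  have "((\<lambda>y. frechet_derivative ?\<phi> (at y) e) has_derivative hessian c c' x e) (at (fst ?z))"
    unfolding fst_conv hessian_def
    by (rule smooth_on_has_second_derivative[OF transition_smooth(1,3)[OF c]])
  from has_derivative_compose[OF bounded_linear_imp_has_derivative[OF bounded_linear_fst] this]
  have "((\<lambda>z. snd (?F z) \<bullet> frechet_derivative ?\<phi> (at (fst z)) e) has_derivative
     (\<lambda>h. snd (?F ?z) \<bullet> hessian c c' x e (fst h) +
        snd (jacobian ?C ?C' \<alpha> h) \<bullet> frechet_derivative ?\<phi> (at (fst ?z)) e)) (at ?z)"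
    by (rule has_derivative_inner[OF has_derivative_snd[OF F]])
  moreover have "\<forall>\<^sub>F z in nhds ?z. snd (?F z) \<bullet> frechet_derivative ?\<phi> (at (fst z)) e = snd z \<bullet> e"
    using T.eventually_in_overlap[OF C, unfolded zC]
  proof eventually_elim
    case (elim z)
    define \<beta> where "\<beta> = chart_inv ?C z"
    have \<beta>: "\<beta> \<in> cotangent_space M (fst \<beta>)" "c \<in> charts_at M (fst \<beta>)" "c' \<in> charts_at M (fst \<beta>)"
      using elim c by (auto simp: \<beta>_def in_cotangent_chart charts_at_iff)
    have "snd ?C \<beta> = z"
      using elim by (simp add: \<beta>_def)
    then have z: "fst z = snd c (fst \<beta>)" "snd z = momentum M c \<beta>"
      by (auto simp: snd_cotangent_chart)
    \<comment> \<open>The coordinate \<open>e\<close> in \<open>c\<close> is held fixed while the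
      foot point varies, so the coordinate in \<open>c'\<close> varies by the Hessian.\<close>
    let ?v = "tvec_of M c (fst \<beta>) e"
    have v: "?v \<in> tangent_space M (fst \<beta>)"
      by (rule tvec_of_tangent_space[OF \<beta>(2)])
    have "momentum M c \<beta> \<bullet> e = pairing \<beta> ?v"
      using momentum[OF \<beta>(1,2) v] by (simp add: tvec_of_coord[OF \<beta>(2)])
    also have "\<dots> = momentum M c' \<beta> \<bullet> jacobian c c' (fst \<beta>) e"
      using momentum[OF \<beta>(1,3) v] tangent_space_jacobian[OF v \<beta>(2,3)]
      by (simp add: tvec_of_coord[OF \<beta>(2)])
    finally show ?case
      by (simp add: z jacobian_def snd_cotangent_chart \<beta>_def[symmetric])
  qed
  ultimately have "((\<lambda>z. snd z \<bullet> e) has_derivative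
     (\<lambda>h. snd (?F ?z) \<bullet> hessian c c' x e (fst h) +
        snd (jacobian ?C ?C' \<alpha> h) \<bullet> frechet_derivative ?\<phi> (at (fst ?z)) e)) (at ?z)"
    by (rule has_derivative_eventually_cong)
  moreover have "((\<lambda>z. snd z \<bullet> e) has_derivative (\<lambda>h. snd h \<bullet> e)) (at ?z)"
    by (intro has_derivative_inner_left bounded_linear_imp_has_derivative bounded_linear_snd)
  ultimately have "(\<lambda>h. snd (?F ?z) \<bullet> hessian c c' x e (fst h) +
        snd (jacobian ?C ?C' \<alpha> h) \<bullet> frechet_derivative ?\<phi> (at (fst ?z)) e) = (\<lambda>h. snd h \<bullet> e)"
    by (rule has_derivative_unique)
  from fun_cong[OF this, of h] show ?thesis
    unfolding Fz by (simp add: snd_cotangent_chart jacobian_def)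
qed

end

section \<open>Curves and their velocities\<close>

lemma charts_at_real: "charts_at real_atlas t = {(UNIV, \<lambda>t. t)}"
  by (auto simp: charts_at_def real_atlas_def)

lemma chart_inv_real: "chart_inv (UNIV, \<lambda>t. t) = (\<lambda>t::real. t)"
  by (auto simp: chart_inv_def fun_eq_iff inv_into_f_f[of "\<lambda>t. t" UNIV, simplified])

lemma C1_atlas_real: "C1_atlas real_atlas"
proof (rule C1_atlasI)
  fix c c' and x :: real
  assume "c \<in> charts_at real_atlas x" "c' \<in> charts_at real_atlas x"
  then have "snd c = (\<lambda>t. t)" "snd c' = (\<lambda>t. t)"
    by (simp_all add: charts_at_real)
  then show "\<exists>g D. (g has_derivative D) (at (snd c x)) \<and> (\<forall>z\<in>fst c \<inter> fst c'. g (snd c z) = snd c' z)"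
    by (intro exI[of _ "\<lambda>t. t"] exI conjI[OF has_derivative_ident]) simp
qed (auto simp: real_atlas_def)

lemma has_local_derivative_real:
  "has_local_derivative real_atlas N \<gamma> t (UNIV, \<lambda>t. t) d D \<longleftrightarrow>
     d \<in> charts_at N (\<gamma> t) \<and> ((snd d \<circ> \<gamma>) has_derivative D) (at t) \<and> (\<forall>\<^sub>F s in nhds t. \<gamma> s \<in> fst d)"
  by (simp add: has_local_derivative_def charts_at_real chart_inv_real o_def)

context C1_atlas
begin

text \<open>A curve is a map from the real line, so the change of charts for maps turns the
  derivative in one chart into the derivative in every other.\<close>

lemma velocity_eq_tvec_of:
  assumes d: "d \<in> charts_at M (\<gamma> t)" "((snd d \<circ> \<gamma>) has_vector_derivative e) (at t)"
    and "\<forall>\<^sub>F s in nhds t. \<gamma> s \<in> fst d"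
  shows "velocity M \<gamma> t = tvec_of M d (\<gamma> t) e"
proof -
  interpret RM: C1_atlas_pair real_atlas M
    by (rule C1_atlas_pair.intro[OF C1_atlas_real C1_atlas_axioms])
  have loc: "has_local_derivative real_atlas M \<gamma> t (UNIV, \<lambda>t. t) d (\<lambda>h. h *\<^sub>R e)"
    using assms by (simp add: has_local_derivative_real has_vector_derivative_def)
  have "vector_derivative (snd d' \<circ> \<gamma>) (at t) = jacobian d d' (\<gamma> t) e"
    if d': "d' \<in> charts_at M (\<gamma> t)" for d'
  proof (rule vector_derivative_at)
    have "has_local_derivative real_atlas M \<gamma> t (UNIV, \<lambda>t. t) d'
        (\<lambda>h. jacobian d d' (\<gamma> t) (jacobian (UNIV, \<lambda>t. t) (UNIV, \<lambda>t. t) t h *\<^sub>R e))"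
      by (rule RM.has_local_derivative_change_charts[OF loc _ d']) (simp add: charts_at_real)
    moreover have "jacobian (UNIV, \<lambda>t. t) (UNIV, \<lambda>t. t) t h = h" for h :: real
      by (rule RM.M.jacobian_self) (simp add: charts_at_real)
    ultimately show "((snd d' \<circ> \<gamma>) has_vector_derivative jacobian d d' (\<gamma> t) e) (at t)"
      unfolding has_vector_derivative_def
      by (simp only: has_local_derivative_real linear_scale[OF linear_jacobian[OF d(1) d']])
  qed
  then show ?thesis
    by (auto simp: velocity_def tvec_of_def)
qed

text \<open>\<open>vector_derivative\<close> asserts no differentiability by itself. Smoothness
  provides it in some chart, and the change of charts moves it to the chart \<open>c\<close> of
  interest.\<close>

lemma smooth_curve_has_vector_derivative:
  assumes \<gamma>: "smooth_map real_atlas M I \<gamma>" "t \<in> I" and c: "c \<in> charts_at M (\<gamma> t)"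
  shows "((snd c \<circ> \<gamma>) has_vector_derivative snd (velocity M \<gamma> t) c) (at t)"
    and "\<forall>\<^sub>F s in nhds t. \<gamma> s \<in> fst c"
proof -
  interpret RM: C1_atlas_pair real_atlas M
    by (rule C1_atlas_pair.intro[OF C1_atlas_real C1_atlas_axioms])
  obtain r d D where loc: "has_local_derivative real_atlas M \<gamma> t r d D"
    using RM.M.smooth_map_has_local_derivative[OF \<gamma>] by blast
  have r: "(UNIV, \<lambda>t. t) \<in> charts_at real_atlas t"
    by (simp add: charts_at_real)
  obtain D where "has_local_derivative real_atlas M \<gamma> t (UNIV, \<lambda>t. t) c D"
    using RM.has_local_derivative_change_charts[OF loc r c] by blast
  then have D: "((snd c \<circ> \<gamma>) has_derivative D) (at t)" and ev: "\<forall>\<^sub>F s in nhds t. \<gamma> s \<in> fst c"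
    by (simp_all add: has_local_derivative_real)
  define e where "e = D 1"
  have "D h = h *\<^sub>R e" for h
    using linear_scale[OF has_derivative_linear[OF D], of h 1] by (simp add: e_def)
  then have "D = (\<lambda>h. h *\<^sub>R e)"
    by (rule ext)
  then have vD: "((snd c \<circ> \<gamma>) has_vector_derivative e) (at t)"
    using D by (simp add: has_vector_derivative_def)
  then show "((snd c \<circ> \<gamma>) has_vector_derivative snd (velocity M \<gamma> t) c) (at t)"
    by (simp add: velocity_eq_tvec_of[OF c vD ev] tvec_of_coord[OF c])
  show "\<forall>\<^sub>F s in nhds t. \<gamma> s \<in> fst c" by (rule ev)
qed

end

text \<open>On an open set equality on the set is equality of germs, so the directional derivatives
  agree there as well and the induction can pass to them.\<close>

lemma Ck_on_cong:
  assumes "open S" "\<And>x. x \<in> S \<Longrightarrow> f x = h x" "Ck_on k S f"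
  shows "Ck_on k S h"
  using assms(2,3)
proof (induction k arbitrary: f h)
  case 0
  then show ?case by (simp cong: continuous_on_cong)
next
  case (Suc k)
  have D: "(h has_derivative frechet_derivative f (at x)) (at x)" if "x \<in> S" for x
    using Suc.prems that
    by (intro has_derivative_transform_within_open[OF frechet_has_derivative assms(1)]) auto
  have "Ck_on k S (\<lambda>x. frechet_derivative h (at x) v)" for v
  proof (rule Suc.IH)
    show "frechet_derivative f (at x) v = frechet_derivative h (at x) v" if "x \<in> S" for x
      using frechet_derivativeI[OF D[OF that]] by simp
    show "Ck_on k S (\<lambda>x. frechet_derivative f (at x) v)"
      using Suc.prems(2) by simp
  qed
  then show ?case
    using D by (auto simp: differentiable_def)
qed

lemma smooth_on_affine: "smooth_on S (\<lambda>t::real. a + t *\<^sub>R b)"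
proof -
  have const: "Ck_on k S (\<lambda>t::real. e)" for k and e :: 'a
    by (induction k arbitrary: e) simp_all
  have "Ck_on k S (\<lambda>t::real. a + t *\<^sub>R b)" for k
  proof (cases k)
    case (Suc n)
    have D: "((\<lambda>t::real. a + t *\<^sub>R b) has_derivative (\<lambda>h. h *\<^sub>R b)) (at x)" for x
      by (auto intro!: derivative_eq_intros)
    show ?thesis
      unfolding Suc Ck_on.simps frechet_derivativeI[OF D]
      using D const by (auto simp: differentiable_def)
  qed (auto intro!: continuous_intros)
  then show ?thesis by (simp add: smooth_on_def)
qed

section \<open>The canonical maps on the double bundles\<close>

context smooth_atlas_frame
begin

lemma tangent_bundle_frame:
  obtains B' g' where "C1_atlas_frame (tangent_bundle M) B' g'"
proof -
  obtain B' g' where "dual_frame (B' :: ('e \<times> 'e) set) g'"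
    using dual_frame_prod[OF frame] by blast
  then show ?thesis
    by (intro that C1_atlas_frame.intro C1_atlas_tangent_bundle C1_atlas_frame_axioms.intro)
qed

lemma second_tangent_transition:
  assumes u: "u \<in> tangent_space M x" and w: "w \<in> tangent_space (tangent_bundle M) u"
    and c: "c \<in> charts_at M x" "c' \<in> charts_at M x"
  shows "snd w (tangent_chart M c') = (jacobian c c' x (fst (snd w (tangent_chart M c))),
    hessian c c' x (snd u c) (fst (snd w (tangent_chart M c)))
      + jacobian c c' x (snd (snd w (tangent_chart M c))))"
  using tangent_space_jacobian[OF w, of "tangent_chart M c" "tangent_chart M c'"] c
  by (simp add: charts_at_tangent_bundle[OF u] jacobian_tangent_chart[OF u c])

text \<open>The swapped vector is built in one chart. With Jacobian J and Hessian H, the last entry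
  of \<open>w\<close> becomes H(v, dq) + J dv in another chart and that of the swapped vector H(dq,
  v) + J dv, so symmetry of H makes the swap independent of the chart. Its foot point
  \<open>y\<close> has coordinate dq.\<close>

lemma canonical_involution:
  assumes u: "u \<in> tangent_space M x" and w: "w \<in> tangent_space (tangent_bundle M) u"
  obtains y where "y \<in> tangent_space M x"
    and "canonical_involution M w \<in> tangent_space (tangent_bundle M) y"
    and "\<And>c. c \<in> charts_at M x \<Longrightarrow> snd y c = fst (snd w (tangent_chart M c))"
    and "\<And>c. c \<in> charts_at M x \<Longrightarrow> snd (canonical_involution M w) (tangent_chart M c)
           = (snd u c, snd (snd w (tangent_chart M c)))"
proof -
  interpret T: C1_atlas "tangent_bundle M" by (rule C1_atlas_tangent_bundle)
  obtain c0 where c0: "c0 \<in> charts_at M x"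
    using points_charts_at[OF tangent_space_points[OF u]] by blast
  define y where "y = tvec_of M c0 x (fst (snd w (tangent_chart M c0)))"
  define w' where "w' = tvec_of (tangent_bundle M) (tangent_chart M c0) y
    (snd u c0, snd (snd w (tangent_chart M c0)))"
  have y: "y \<in> tangent_space M x" and y0: "snd y c0 = fst (snd w (tangent_chart M c0))"
    unfolding y_def by (rule tvec_of_tangent_space[OF c0], rule tvec_of_coord[OF c0])
  have C0: "tangent_chart M c0 \<in> charts_at (tangent_bundle M) y"
    using charts_at_tangent_bundle[OF y] c0 by simp
  have w': "w' \<in> tangent_space (tangent_bundle M) y"
    and w'0: "snd w' (tangent_chart M c0) = (snd u c0, snd (snd w (tangent_chart M c0)))"
    unfolding w'_def by (rule T.tvec_of_tangent_space[OF C0], rule T.tvec_of_coord[OF C0])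
  have yc: "snd y c = fst (snd w (tangent_chart M c))" if c: "c \<in> charts_at M x" for c
    by (simp add: second_tangent_transition[OF u w c0 c] y0[symmetric] tangent_space_jacobian[OF y c0 c])
  have wc: "snd w' (tangent_chart M c) = (snd u c, snd (snd w (tangent_chart M c)))"
    if c: "c \<in> charts_at M x" for c
    by (simp add: second_tangent_transition[OF y w' c0 c] second_tangent_transition[OF u w c0 c]
        w'0 y0 tangent_space_jacobian[OF u c0 c] hessian_symmetric[OF c0 c, of "snd u c0"])
  define P where "P z \<longleftrightarrow> (\<forall>c\<in>M. let C = tangent_chart (tangent_bundle M) (tangent_chart M c) in
      w \<in> fst C \<longrightarrow>
      z \<in> fst C \<and> (case snd C w of ((q, v), (dq, dv)) \<Rightarrow> snd C z = ((q, dq), (v, dv))))" for z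
  have in_chart: "z \<in> fst (tangent_chart (tangent_bundle M) (tangent_chart M c)) \<longleftrightarrow> c \<in> charts_at M x"
    if "z \<in> tangent_space (tangent_bundle M) s" "s \<in> tangent_space M x" "c \<in> M" for z s c
    using that by (simp add: T.in_tangent_chart in_tangent_chart charts_at_iff tangent_space_fst)
  have coord: "(case snd (tangent_chart (tangent_bundle M) (tangent_chart M c)) w of
        ((q, v), (dq, dv)) \<Rightarrow> snd C z = ((q, dq), (v, dv))) \<longleftrightarrow>
      snd C z = ((snd c x, fst (snd w (tangent_chart M c))), (snd u c, snd (snd w (tangent_chart M c))))"
    for c z and C :: "((('a, 'e) tvec, 'e \<times> 'e) tvec, ('e \<times> 'e) \<times> ('e \<times> 'e)) chart"
    by (simp add: snd_tangent_chart split_beta tangent_space_fst[OF u] tangent_space_fst[OF w])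
  have "P w'"
    unfolding P_def Let_def coord
    by (simp add: in_chart[OF w u] in_chart[OF w' y] snd_tangent_chart tangent_space_fst[OF y]
        tangent_space_fst[OF w'] yc wc)
  \<comment> \<open>One chart is enough for uniqueness, as the induced chart is injective.\<close>
  moreover have "z = w'" if "P z" for z
  proof -
    let ?C = "tangent_chart (tangent_bundle M) (tangent_chart M c0)"
    have "c0 \<in> M" using c0 by (simp add: charts_at_iff)
    then have "z \<in> fst ?C" "w' \<in> fst ?C" "snd ?C z = snd ?C w'"
      using that \<open>P w'\<close> c0 unfolding P_def Let_def coord by (simp_all add: in_chart[OF w u])
    moreover have "inj_on (snd ?C) (fst ?C)"
      using \<open>c0 \<in> M\<close> by (intro T.inj_tangent_chart) (simp add: tangent_bundle_def)
    ultimately show ?thesis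
      by (simp add: inj_onD)
  qed
  ultimately have "canonical_involution M w = w'"
    unfolding canonical_involution_def P_def by (rule the_equality)
  then show ?thesis
    using that[OF y] w' yc wc by simp
qed

text \<open>The covector is built in one chart, with momentum (dp, p) over the vector with
  coordinate dq. That it has this form in every chart is checked by pairing it with an arbitrary
  tangent vector, which avoids a transition formula for the cotangent bundle of the tangent
  bundle.\<close>

lemma alpha_map:
  assumes a: "a \<in> cotangent_space M x" and v: "v \<in> tangent_space (cotangent_bundle M) a"
  obtains y where "y \<in> tangent_space M x"
    and "alpha_map M v \<in> cotangent_space (tangent_bundle M) y"
    and "\<And>c. c \<in> charts_at M x \<Longrightarrow> snd y c = fst (snd v (cotangent_chart M c))"
    and "\<And>c. c \<in> charts_at M x \<Longrightarrow> momentum (tangent_bundle M) (tangent_chart M c) (alpha_map M v)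
           = (snd (snd v (cotangent_chart M c)), momentum M c a)"
proof -
  obtain B' g' where "C1_atlas_frame (tangent_bundle M) B' g'"
    by (rule tangent_bundle_frame)
  then interpret T: C1_atlas_frame "tangent_bundle M" B' g' .
  interpret S: C1_atlas "cotangent_bundle M" by (rule C1_atlas_cotangent_bundle)
  obtain c0 where c0: "c0 \<in> charts_at M x"
    using points_charts_at[OF cotangent_space_points[OF a]] by blast
  define y where "y = tvec_of M c0 x (fst (snd v (cotangent_chart M c0)))"
  define \<beta> where "\<beta> = cotvec_of (tangent_bundle M) (tangent_chart M c0) y
    (snd (snd v (cotangent_chart M c0)), momentum M c0 a)"
  have y: "y \<in> tangent_space M x" and y0: "snd y c0 = fst (snd v (cotangent_chart M c0))"
    unfolding y_def by (rule tvec_of_tangent_space[OF c0], rule tvec_of_coord[OF c0])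
  have C: "tangent_chart M c \<in> charts_at (tangent_bundle M) y" if "c \<in> charts_at M x" for c
    using charts_at_tangent_bundle[OF y] that by simp
  have vc: "snd v (cotangent_chart M c)
      = jacobian (cotangent_chart M c0) (cotangent_chart M c) a (snd v (cotangent_chart M c0))"
    if "c \<in> charts_at M x" for c
    using tangent_space_jacobian[OF v] charts_at_cotangent_bundle[OF a] c0 that by simp
  have \<beta>: "\<beta> \<in> cotangent_space (tangent_bundle M) y"
    unfolding \<beta>_def by (rule T.cotvec_of_cotangent_space[OF C[OF c0]])
  have yc: "snd y c = fst (snd v (cotangent_chart M c))" if c: "c \<in> charts_at M x" for c
    by (simp add: vc[OF c] fst_jacobian_cotangent_chart[OF a c0 c] y0[symmetric]
        tangent_space_jacobian[OF y c0 c])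
  have \<beta>c: "momentum (tangent_bundle M) (tangent_chart M c) \<beta>
      = (snd (snd v (cotangent_chart M c)), momentum M c a)" if c: "c \<in> charts_at M x" for c
  proof (rule T.momentum_eqI[OF C[OF c] cotangent_space_fst[OF \<beta>]])
    fix w assume w: "w \<in> tangent_space (tangent_bundle M) y"
    obtain X Z where XZ: "snd w (tangent_chart M c0) = (X, Z)" by fastforce
    obtain dq dp where dqp: "snd v (cotangent_chart M c0) = (dq, dp)" by fastforce
    have "pairing a (tvec_of M c0 x Z) = momentum M c0 a \<bullet> Z"
      using momentum[OF a c0 tvec_of_tangent_space[OF c0]] by (simp add: tvec_of_coord[OF c0])
    moreover have "pairing a (tvec_of M c0 x Z) = momentum M c a \<bullet> jacobian c0 c x Z"
      using momentum[OF a c tvec_of_tangent_space[OF c0]]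
        tangent_space_jacobian[OF tvec_of_tangent_space[OF c0] c0 c]
      by (metis tvec_of_coord[OF c0])
    ultimately have Z: "momentum M c a \<bullet> jacobian c0 c x Z = momentum M c0 a \<bullet> Z"
      by simp
    \<comment> \<open>The Hessian correction in the transition of dp is the one produced by the
      transition of \<open>w\<close>, up to the order of its arguments.\<close>
    have X: "momentum M c a \<bullet> hessian c0 c x X dq
        + snd (snd v (cotangent_chart M c)) \<bullet> jacobian c0 c x X = dp \<bullet> X"
      using snd_jacobian_cotangent_chart[OF a c0 c, of X "snd v (cotangent_chart M c0)"]
      by (simp add: vc[OF c] dqp)
    have "pairing \<beta> w = dp \<bullet> X + momentum M c0 a \<bullet> Z"
      using w by (simp add: \<beta>_def cotvec_of_def pairing_def XZ dqp)
    also have "\<dots> = (snd (snd v (cotangent_chart M c)), momentum M c a) \<bullet> snd w (tangent_chart M c)"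
      using X Z by (simp add: second_tangent_transition[OF y w c0 c] XZ y0 dqp inner_add_right
          hessian_symmetric[OF c0 c, of dq])
    finally show "pairing \<beta> w
      = (snd (snd v (cotangent_chart M c)), momentum M c a) \<bullet> snd w (tangent_chart M c)" .
  qed
  define P where "P z \<longleftrightarrow> (\<forall>c\<in>M.
        let C = tangent_chart (cotangent_bundle M) (cotangent_chart M c);
            D = cotangent_chart (tangent_bundle M) (tangent_chart M c) in
        v \<in> fst C \<longrightarrow>
        z \<in> fst D \<and> (case snd C v of ((q, p), (dq, dp)) \<Rightarrow> snd D z = ((q, dq), (dp, p))))" for z
  have in_C: "v \<in> fst (tangent_chart (cotangent_bundle M) (cotangent_chart M c)) \<longleftrightarrow> c \<in> charts_at M x"
    if "c \<in> M" for c
    using v a that by (simp add: S.in_tangent_chart in_cotangent_chart charts_at_iff tangent_space_fst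
        cotangent_space_fst)
  have in_D: "\<beta> \<in> fst (cotangent_chart (tangent_bundle M) (tangent_chart M c))"
    if "c \<in> charts_at M x" for c
    using \<beta> y that by (simp add: T.in_cotangent_chart in_tangent_chart charts_at_iff tangent_space_fst
        cotangent_space_fst)
  have coord: "(case snd (tangent_chart (cotangent_bundle M) (cotangent_chart M c)) v of
        ((q, p), (dq, dp)) \<Rightarrow> snd D z = ((q, dq), (dp, p))) \<longleftrightarrow>
      snd D z = ((snd c x, fst (snd v (cotangent_chart M c))),
        (snd (snd v (cotangent_chart M c)), momentum M c a))"
    for c z and D :: "((('a, 'e) tvec, 'e \<times> 'e) cotvec, ('e \<times> 'e) \<times> ('e \<times> 'e)) chart"
    by (simp add: snd_tangent_chart snd_cotangent_chart split_beta cotangent_space_fst[OF a]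
        tangent_space_fst[OF v])
  have "P \<beta>"
    unfolding P_def Let_def coord
    by (simp add: in_C in_D snd_cotangent_chart snd_tangent_chart tangent_space_fst[OF y]
        cotangent_space_fst[OF \<beta>] yc \<beta>c)
  moreover have "z = \<beta>" if "P z" for z
  proof -
    let ?D = "cotangent_chart (tangent_bundle M) (tangent_chart M c0)"
    have "c0 \<in> M" using c0 by (simp add: charts_at_iff)
    then have "z \<in> fst ?D" "\<beta> \<in> fst ?D" "snd ?D z = snd ?D \<beta>"
      using that \<open>P \<beta>\<close> c0 unfolding P_def Let_def coord by (simp_all add: in_C)
    moreover have "inj_on (snd ?D) (fst ?D)"
      using \<open>c0 \<in> M\<close> by (intro T.inj_cotangent_chart) (simp add: tangent_bundle_def)
    ultimately show ?thesis
      by (simp add: inj_onD)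
  qed
  ultimately have "alpha_map M v = \<beta>"
    unfolding alpha_map_def P_def by (rule the_equality)
  then show ?thesis
    using that[OF y] \<beta> yc \<beta>c by simp
qed

text \<open>In one chart the coordinates of \<open>y\<close> and \<open>\<beta>\<close> prescribe
  \<open>v\<close> completely. This provides the preimage that makes \<open>inv_into\<close> of the
  cotangent lift meaningful.\<close>

lemma alpha_map_surj:
  assumes y: "y \<in> tangent_space M x" and \<beta>: "\<beta> \<in> cotangent_space (tangent_bundle M) y"
  obtains a v where "a \<in> cotangent_space M x" "v \<in> tangent_space (cotangent_bundle M) a"
    "alpha_map M v = \<beta>"
proof -
  obtain B' g' where "C1_atlas_frame (tangent_bundle M) B' g'"
    by (rule tangent_bundle_frame)
  then interpret T: C1_atlas_frame "tangent_bundle M" B' g' .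
  interpret S: C1_atlas "cotangent_bundle M" by (rule C1_atlas_cotangent_bundle)
  obtain c where c: "c \<in> charts_at M x"
    using points_charts_at[OF tangent_space_points[OF y]] by blast
  obtain dp p where dp: "momentum (tangent_bundle M) (tangent_chart M c) \<beta> = (dp, p)"
    by fastforce
  define a where "a = cotvec_of M c x p"
  have a: "a \<in> cotangent_space M x" "momentum M c a = p"
    unfolding a_def by (rule cotvec_of_cotangent_space[OF c], rule momentum_cotvec_of[OF c])
  have C: "cotangent_chart M c \<in> charts_at (cotangent_bundle M) a"
    using charts_at_cotangent_bundle[OF a(1)] c by simp
  define v where "v = tvec_of (cotangent_bundle M) (cotangent_chart M c) a (snd y c, dp)"
  have v: "v \<in> tangent_space (cotangent_bundle M) a" "snd v (cotangent_chart M c) = (snd y c, dp)"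
    unfolding v_def by (rule S.tvec_of_tangent_space[OF C], rule S.tvec_of_coord[OF C])
  obtain y' where y': "y' \<in> tangent_space M x"
    "alpha_map M v \<in> cotangent_space (tangent_bundle M) y'"
    and coord: "\<And>c. c \<in> charts_at M x \<Longrightarrow> snd y' c = fst (snd v (cotangent_chart M c))"
      "\<And>c. c \<in> charts_at M x \<Longrightarrow> momentum (tangent_bundle M) (tangent_chart M c) (alpha_map M v)
           = (snd (snd v (cotangent_chart M c)), momentum M c a)"
    by (rule alpha_map[OF a(1) v(1)], rule that)
  have y'c: "snd y' c = snd y c"
    "momentum (tangent_bundle M) (tangent_chart M c) (alpha_map M v) = (dp, p)"
    by (simp_all add: coord[OF c] v(2) a(2))
  have "y' = y"
    by (rule tangent_space_eqI[OF y'(1) y c y'c(1)])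
  then have "alpha_map M v = \<beta>"
    using T.cotangent_space_momentum_eqI[OF _ \<beta>, of "alpha_map M v" "tangent_chart M c"] y'(2) y'c(2) dp c
    by (simp add: charts_at_tangent_bundle[OF y])
  then show ?thesis
    using that a(1) v(1) by blast
qed

end

section \<open>Cotangent lifts of diffeomorphisms and the map \<open>\<Phi>\<close>\<close>

text \<open>The left-inverse result is used for \<open>f\<close> and once more for its inverse, each
  on its own open domain.\<close>

lemma diffeomorphism_tangent_map:
  assumes M: "C1_atlas M" and N: "C1_atlas N" and f: "diffeomorphism_on M N V f" and x: "x \<in> V"
  shows diffeomorphism_tangent_map_local: "\<exists>c d D. has_local_derivative M N f x c d D"
    and diffeomorphism_tangent_map_bij:
      "bij_betw (tangent_map M N f) (tangent_space M x) (tangent_space N (f x))"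
proof -
  interpret M: C1_atlas M by (rule M)
  interpret N: C1_atlas N by (rule N)
  interpret MN: C1_atlas_pair M N by (rule C1_atlas_pair.intro[OF M N])
  interpret NM: C1_atlas_pair N M by (rule C1_atlas_pair.intro[OF N M])
  let ?h = "inv_into V f"
  have inj: "inj_on f V" and sf: "smooth_map M N V f" and sh: "smooth_map N M (f ` V) ?h"
    using f by (auto simp: diffeomorphism_on_def)
  have V: "openin (manifold_topology M) V" "openin (manifold_topology N) (f ` V)"
    using sf sh by (auto simp: smooth_map_def)
  have hf: "?h (f y) = y" if "y \<in> V" for y
    using inj that by simp
  have fx: "f x \<in> f ` V" using x by simp
  have fh: "f (?h z) = z" if "z \<in> f ` V" for z
    using that by (rule f_inv_into_f)
  obtain c d D where F: "has_local_derivative M N f x c d D"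
    using M.smooth_map_has_local_derivative[OF sf x] by blast
  then show "\<exists>c d D. has_local_derivative M N f x c d D" by blast
  obtain d' c' E where H: "has_local_derivative N M ?h (f x) d' c' E"
    using N.smooth_map_has_local_derivative[OF sh imageI[OF x]] by blast
  have F': "has_local_derivative M N f (?h (f x)) c d D"
    using F by (simp add: hf[OF x])
  show "bij_betw (tangent_map M N f) (tangent_space M x) (tangent_space N (f x))"
  proof (rule bij_betw_byWitness[where f' = "tangent_map N M ?h"])
    show "\<forall>v\<in>tangent_space M x. tangent_map N M ?h (tangent_map M N f v) = v"
      using tangent_map_left_inverse[OF M N F H V(1) x hf] by blast
    show "\<forall>v\<in>tangent_space N (f x). tangent_map M N f (tangent_map N M ?h v) = v"
      using tangent_map_left_inverse[OF N M H F' V(2) fx fh] by blast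
    show "tangent_map M N f ` tangent_space M x \<subseteq> tangent_space N (f x)"
      using MN.tangent_map_tangent_space[OF F] by blast
    show "tangent_map N M ?h ` tangent_space N (f x) \<subseteq> tangent_space M x"
      using NM.tangent_map_tangent_space[OF H] hf[OF x] by fastforce
  qed
qed

text \<open>Bijectivity of the tangent map lets every tangent vector at \<open>f x\<close> be
  written as an image, where the pairing reduces to that of \<open>\<alpha>\<close>; linearity is
  inherited in this way.\<close>

lemma cotangent_push:
  assumes M: "C1_atlas M" and N: "C1_atlas N" and f: "diffeomorphism_on M N V f" and x: "x \<in> V"
    and \<alpha>: "\<alpha> \<in> cotangent_space M x"
  shows cotangent_push_cotangent_space: "cotangent_push M N f \<alpha> \<in> cotangent_space N (f x)"
    and pairing_cotangent_push:
      "v \<in> tangent_space M x \<Longrightarrow> pairing (cotangent_push M N f \<alpha>) (tangent_map M N f v) = pairing \<alpha> v"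
proof -
  interpret M: C1_atlas M by (rule M)
  interpret N: C1_atlas N by (rule N)
  interpret MN: C1_atlas_pair M N by (rule C1_atlas_pair.intro[OF M N])
  let ?T = "tangent_map M N f"
  note bij = diffeomorphism_tangent_map_bij[OF M N f x]
  obtain c d D where F: "has_local_derivative M N f x c d D"
    using diffeomorphism_tangent_map_local[OF M N f x] by blast
  have pair: "pairing (cotangent_push M N f \<alpha>) (?T v) = pairing \<alpha> v" if v: "v \<in> tangent_space M x" for v
    using MN.tangent_map_tangent_space[OF F v] bij_betw_inv_into_left[OF bij v]
    by (simp add: cotangent_push_def pairing_def cotangent_space_fst[OF \<alpha>])
  show "v \<in> tangent_space M x \<Longrightarrow> pairing (cotangent_push M N f \<alpha>) (?T v) = pairing \<alpha> v"
    by (rule pair)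
  have ex: "\<exists>v\<in>tangent_space M x. w = ?T v" if "w \<in> tangent_space N (f x)" for w
    using that bij by (auto simp: bij_betw_def)
  show "cotangent_push M N f \<alpha> \<in> cotangent_space N (f x)"
    unfolding cotangent_space_iff
  proof (intro conjI allI impI ballI)
    show "fst (cotangent_push M N f \<alpha>) = f x"
      by (simp add: cotangent_push_def cotangent_space_fst[OF \<alpha>])
    show "f x \<in> points N"
      using F by (auto simp: has_local_derivative_def intro: N.charts_at_points)
    show "pairing (cotangent_push M N f \<alpha>) w = 0" if "w \<notin> tangent_space N (f x)" for w
      using that by (simp add: cotangent_push_def pairing_def cotangent_space_fst[OF \<alpha>])
  next
    fix w w' assume "w \<in> tangent_space N (f x)" "w' \<in> tangent_space N (f x)"
    then obtain v v' where v: "v \<in> tangent_space M x" "w = ?T v" "v' \<in> tangent_space M x" "w' = ?T v'"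
      using ex by meson
    show "pairing (cotangent_push M N f \<alpha>) (tvec_add w w')
        = pairing (cotangent_push M N f \<alpha>) w + pairing (cotangent_push M N f \<alpha>) w'"
      using \<alpha> v unfolding cotangent_space_iff
      by (simp add: MN.tangent_map_add[OF F, symmetric] pair M.tvec_add_tangent_space)
  next
    fix r w assume "w \<in> tangent_space N (f x)"
    then obtain v where v: "v \<in> tangent_space M x" "w = ?T v"
      using ex by meson
    show "pairing (cotangent_push M N f \<alpha>) (tvec_scale r w) = r * pairing (cotangent_push M N f \<alpha>) w"
      using \<alpha> v unfolding cotangent_space_iff
      by (simp add: MN.tangent_map_scale[OF F, symmetric] pair M.tvec_scale_tangent_space)
  qed
qed

section \<open>Tangent vectors of the square and the fibrewise bijectivity of
  \<open>Phi\<close>\<close>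

context C1_atlas
begin

lemma tvec_zero_tangent_space: "x \<in> points M \<Longrightarrow> tvec_zero x \<in> tangent_space M x"
  by (simp add: tangent_space_iff tvec_zero_def linear_0[OF linear_jacobian])

lemma pairing_tvec_zero:
  assumes "\<alpha> \<in> cotangent_space M x"
  shows "pairing \<alpha> (tvec_zero x) = 0"
proof -
  have "tvec_zero x \<in> tangent_space M x"
    by (rule tvec_zero_tangent_space[OF cotangent_space_points[OF assms]])
  then have "pairing \<alpha> (tvec_scale 0 (tvec_zero x)) = 0 * pairing \<alpha> (tvec_zero x)"
    using assms unfolding cotangent_space_iff by blast
  then show ?thesis
    by (simp add: tvec_scale_def tvec_zero_def)
qed

abbreviation "MM \<equiv> prod_atlas M M"
abbreviation "T1 \<equiv> tangent_map MM M fst"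
abbreviation "T2 \<equiv> tangent_map MM M snd"

lemma C1_atlas_square: "C1_atlas MM"
  by (rule C1_atlas_pair.C1_atlas_prod[OF C1_atlas_pair.intro[OF C1_atlas_axioms C1_atlas_axioms]])

lemma square_projections:
  assumes c: "c \<in> charts_at M x" and d: "d \<in> charts_at M y" and z: "z \<in> tangent_space MM (x, y)"
  shows "T1 z \<in> tangent_space M x" "snd (T1 z) c = fst (snd z (prod_chart c d))"
    and "T2 z \<in> tangent_space M y" "snd (T2 z) d = snd (snd z (prod_chart c d))"
proof -
  interpret P: C1_atlas_pair M M by (rule C1_atlas_pair.intro[OF C1_atlas_axioms C1_atlas_axioms])
  interpret PM: C1_atlas_pair MM M by (rule C1_atlas_pair.intro[OF C1_atlas_square C1_atlas_axioms])
  show "T1 z \<in> tangent_space M x" "snd (T1 z) c = fst (snd z (prod_chart c d))"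
    using PM.tangent_map[OF P.has_local_derivative_fst[OF c d] z] by simp_all
  show "T2 z \<in> tangent_space M y" "snd (T2 z) d = snd (snd z (prod_chart c d))"
    using PM.tangent_map[OF P.has_local_derivative_snd[OF c d] z] by simp_all
qed

text \<open>The two components can be prescribed independently, so that equality of values of
  \<open>Phi\<close> can be tested on each factor separately.\<close>

lemma square_tangent_pair:
  assumes u: "u \<in> tangent_space M x" and v: "v \<in> tangent_space M y"
  shows "\<exists>z\<in>tangent_space MM (x, y). T1 z = u \<and> T2 z = v"
proof -
  interpret P: C1_atlas MM by (rule C1_atlas_square)
  obtain c d where c: "c \<in> charts_at M x" and d: "d \<in> charts_at M y"
    using points_charts_at tangent_space_points[OF u] tangent_space_points[OF v] by blast
  have C: "prod_chart c d \<in> charts_at MM (x, y)"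
    using c d unfolding charts_at_prod by blast
  define z where "z = tvec_of MM (prod_chart c d) (x, y) (snd u c, snd v d)"
  have z: "z \<in> tangent_space MM (x, y)" and zC: "snd z (prod_chart c d) = (snd u c, snd v d)"
    unfolding z_def by (rule P.tvec_of_tangent_space[OF C], rule P.tvec_of_coord[OF C])
  note Tz = square_projections[OF c d z]
  have "T1 z = u"
    by (rule tangent_space_eqI[OF Tz(1) u c]) (simp add: Tz(2) zC)
  moreover have "T2 z = v"
    by (rule tangent_space_eqI[OF Tz(3) v d]) (simp add: Tz(4) zC)
  ultimately show ?thesis
    using z by blast
qed

lemma square_projections_linear:
  assumes z: "z \<in> tangent_space MM (x, y)"
  shows "z' \<in> tangent_space MM (x, y) \<Longrightarrow> T1 (tvec_add z z') = tvec_add (T1 z) (T1 z')"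
    and "z' \<in> tangent_space MM (x, y) \<Longrightarrow> T2 (tvec_add z z') = tvec_add (T2 z) (T2 z')"
    and "T1 (tvec_scale r z) = tvec_scale r (T1 z)"
    and "T2 (tvec_scale r z) = tvec_scale r (T2 z)"
proof -
  interpret P: C1_atlas_pair M M by (rule C1_atlas_pair.intro[OF C1_atlas_axioms C1_atlas_axioms])
  interpret PM: C1_atlas_pair MM M by (rule C1_atlas_pair.intro[OF C1_atlas_square C1_atlas_axioms])
  obtain C where "C \<in> charts_at MM (x, y)"
    using PM.M.points_charts_at[OF tangent_space_points[OF z]] by blast
  then obtain c d where c: "c \<in> charts_at M x" and d: "d \<in> charts_at M y"
    unfolding charts_at_prod by blast
  note L1 = P.has_local_derivative_fst[OF c d] and L2 = P.has_local_derivative_snd[OF c d]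
  show "z' \<in> tangent_space MM (x, y) \<Longrightarrow> T1 (tvec_add z z') = tvec_add (T1 z) (T1 z')"
    by (rule PM.tangent_map_add[OF L1 z])
  show "z' \<in> tangent_space MM (x, y) \<Longrightarrow> T2 (tvec_add z z') = tvec_add (T2 z) (T2 z')"
    by (rule PM.tangent_map_add[OF L2 z])
  show "T1 (tvec_scale r z) = tvec_scale r (T1 z)"
    by (rule PM.tangent_map_scale[OF L1 z])
  show "T2 (tvec_scale r z) = tvec_scale r (T2 z)"
    by (rule PM.tangent_map_scale[OF L2 z])
qed

lemma square_projections_tangent_space:
  assumes z: "z \<in> tangent_space MM (x, y)"
  shows "T1 z \<in> tangent_space M x" "T2 z \<in> tangent_space M y"
proof -
  interpret P: C1_atlas MM by (rule C1_atlas_square)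
  obtain C where "C \<in> charts_at MM (x, y)"
    using P.points_charts_at[OF tangent_space_points[OF z]] by blast
  then obtain c d where c: "c \<in> charts_at M x" and d: "d \<in> charts_at M y"
    unfolding charts_at_prod by blast
  show "T1 z \<in> tangent_space M x" "T2 z \<in> tangent_space M y"
    by (rule square_projections[OF c d z])+
qed

lemma pairing_Phi:
  assumes "\<alpha>0 \<in> cotangent_space M x" "\<alpha>1 \<in> cotangent_space M y" "z \<in> tangent_space MM (x, y)"
  shows "pairing (Phi M (\<alpha>0, \<alpha>1)) z = - pairing \<alpha>0 (T1 z) + pairing \<alpha>1 (T2 z)"
  using assms(3) by (simp add: Phi_def cotangent_space_fst[OF assms(1)] cotangent_space_fst[OF assms(2)]
      pairing_def)

lemma Phi_cotangent_space:
  assumes \<alpha>0: "\<alpha>0 \<in> cotangent_space M x" and \<alpha>1: "\<alpha>1 \<in> cotangent_space M y"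
  shows "Phi M (\<alpha>0, \<alpha>1) \<in> cotangent_space MM (x, y)"
proof -
  interpret P: C1_atlas MM by (rule C1_atlas_square)
  obtain c d where cd: "c \<in> charts_at M x" "d \<in> charts_at M y"
    using points_charts_at cotangent_space_points[OF \<alpha>0] cotangent_space_points[OF \<alpha>1] by blast
  then have "prod_chart c d \<in> charts_at MM (x, y)"
    unfolding charts_at_prod by blast
  then have xy: "(x, y) \<in> points MM"
    by (rule P.charts_at_points)
  note TS = square_projections_tangent_space and L = square_projections_linear
  show ?thesis
    unfolding cotangent_space_iff[of "Phi M (\<alpha>0, \<alpha>1)"]
  proof (intro conjI allI impI ballI)
    show "fst (Phi M (\<alpha>0, \<alpha>1)) = (x, y)"
      by (simp add: Phi_def cotangent_space_fst[OF \<alpha>0] cotangent_space_fst[OF \<alpha>1])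
    show "(x, y) \<in> points MM" by (rule xy)
    show "pairing (Phi M (\<alpha>0, \<alpha>1)) z = 0" if "z \<notin> tangent_space MM (x, y)" for z
      using that by (simp add: Phi_def pairing_def cotangent_space_fst[OF \<alpha>0] cotangent_space_fst[OF \<alpha>1])
  next
    fix z z' assume z: "z \<in> tangent_space MM (x, y)" "z' \<in> tangent_space MM (x, y)"
    have "pairing \<alpha>0 (tvec_add (T1 z) (T1 z')) = pairing \<alpha>0 (T1 z) + pairing \<alpha>0 (T1 z')"
      using \<alpha>0 TS z unfolding cotangent_space_iff by blast
    moreover have "pairing \<alpha>1 (tvec_add (T2 z) (T2 z')) = pairing \<alpha>1 (T2 z) + pairing \<alpha>1 (T2 z')"
      using \<alpha>1 TS z unfolding cotangent_space_iff by blast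
    ultimately show "pairing (Phi M (\<alpha>0, \<alpha>1)) (tvec_add z z')
        = pairing (Phi M (\<alpha>0, \<alpha>1)) z + pairing (Phi M (\<alpha>0, \<alpha>1)) z'"
      by (simp add: pairing_Phi[OF \<alpha>0 \<alpha>1] z P.tvec_add_tangent_space L(1,2)[OF z(1) z(2)])
  next
    fix r z assume z: "z \<in> tangent_space MM (x, y)"
    have "pairing \<alpha>0 (tvec_scale r (T1 z)) = r * pairing \<alpha>0 (T1 z)"
      using \<alpha>0 TS[OF z] unfolding cotangent_space_iff by blast
    moreover have "pairing \<alpha>1 (tvec_scale r (T2 z)) = r * pairing \<alpha>1 (T2 z)"
      using \<alpha>1 TS[OF z] unfolding cotangent_space_iff by blast
    ultimately show "pairing (Phi M (\<alpha>0, \<alpha>1)) (tvec_scale r z) = r * pairing (Phi M (\<alpha>0, \<alpha>1)) z"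
      by (simp add: pairing_Phi[OF \<alpha>0 \<alpha>1] z P.tvec_scale_tangent_space L(3,4)[OF z] algebra_simps)
  qed
qed

text \<open>Equal images have equal foot points. Testing on the pairs (u, 0) and (0, v) then
  isolates the two covectors, the minus sign being harmless.\<close>

lemma Phi_inj:
  assumes \<alpha>: "\<alpha>0 \<in> cotangent_space M x" "\<alpha>1 \<in> cotangent_space M y"
    and \<beta>: "\<beta>0 \<in> cotangent_space M x'" "\<beta>1 \<in> cotangent_space M y'"
    and eq: "Phi M (\<alpha>0, \<alpha>1) = Phi M (\<beta>0, \<beta>1)"
  shows "\<alpha>0 = \<beta>0 \<and> \<alpha>1 = \<beta>1"
proof -
  have "(x, y) = (x', y')"
    using cotangent_space_fst[OF Phi_cotangent_space[OF \<alpha>]]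
      cotangent_space_fst[OF Phi_cotangent_space[OF \<beta>]] eq by simp
  then have \<beta>': "\<beta>0 \<in> cotangent_space M x" "\<beta>1 \<in> cotangent_space M y"
    using \<beta> by simp_all
  have *: "- pairing \<alpha>0 u + pairing \<alpha>1 v = - pairing \<beta>0 u + pairing \<beta>1 v"
    if uv: "u \<in> tangent_space M x" "v \<in> tangent_space M y" for u v
  proof -
    obtain z where z: "z \<in> tangent_space MM (x, y)" "T1 z = u" "T2 z = v"
      using square_tangent_pair[OF uv] by blast
    show ?thesis
      using pairing_Phi[OF \<alpha> z(1)] pairing_Phi[OF \<beta>' z(1)] z(2,3) eq by simp
  qed
  note zero = tvec_zero_tangent_space[OF cotangent_space_points]
  have "\<alpha>0 = \<beta>0"
    by (rule cotangent_space_eqI[OF \<alpha>(1) \<beta>'(1)])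
      (use *[OF _ zero[OF \<alpha>(2)]] in \<open>simp add: pairing_tvec_zero[OF \<alpha>(2)] pairing_tvec_zero[OF \<beta>'(2)]\<close>)
  moreover have "\<alpha>1 = \<beta>1"
    by (rule cotangent_space_eqI[OF \<alpha>(2) \<beta>'(2)])
      (use *[OF zero[OF \<alpha>(1)]] in \<open>simp add: pairing_tvec_zero[OF \<alpha>(1)] pairing_tvec_zero[OF \<beta>'(1)]\<close>)
  ultimately show ?thesis by blast
qed

end

context C1_atlas_frame
begin

text \<open>A covector \<open>\<zeta>\<close> on the product has momentum \<open>(p\<^sub>0, p\<^sub>1)\<close> in a product chart; it is the image
  of the covectors with momenta \<open>-p\<^sub>0\<close> and \<open>p\<^sub>1\<close>.\<close>

lemma Phi_surj:
  assumes \<zeta>: "\<zeta> \<in> cotangent_space (prod_atlas M M) (x, y)"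
  obtains \<alpha>0 \<alpha>1 where "\<alpha>0 \<in> cotangent_space M x" "\<alpha>1 \<in> cotangent_space M y"
    "Phi M (\<alpha>0, \<alpha>1) = \<zeta>"
proof -
  obtain B' :: "('e \<times> 'e) set" and g' where fr: "dual_frame B' g'"
    using dual_frame_prod[OF frame] by blast
  interpret P: C1_atlas_frame "prod_atlas M M" B' g'
    by (intro C1_atlas_frame.intro C1_atlas_frame_axioms.intro C1_atlas_square fr)
  obtain C where "C \<in> charts_at (prod_atlas M M) (x, y)"
    using P.points_charts_at[OF cotangent_space_points[OF \<zeta>]] by blast
  then obtain c d where c: "c \<in> charts_at M x" and d: "d \<in> charts_at M y"
    and C: "prod_chart c d \<in> charts_at (prod_atlas M M) (x, y)"
    unfolding charts_at_prod by blast
  obtain p0 p1 where p: "momentum (prod_atlas M M) (prod_chart c d) \<zeta> = (p0, p1)"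
    by fastforce
  define \<alpha>0 where "\<alpha>0 = cotvec_of M c x (- p0)"
  define \<alpha>1 where "\<alpha>1 = cotvec_of M d y p1"
  have \<alpha>: "\<alpha>0 \<in> cotangent_space M x" "\<alpha>1 \<in> cotangent_space M y"
    unfolding \<alpha>0_def \<alpha>1_def by (rule cotvec_of_cotangent_space[OF c], rule cotvec_of_cotangent_space[OF d])
  have "pairing (Phi M (\<alpha>0, \<alpha>1)) z = pairing \<zeta> z" if z: "z \<in> tangent_space (prod_atlas M M) (x, y)" for z
  proof -
    note Tz = square_projections[OF c d z]
    have "pairing (Phi M (\<alpha>0, \<alpha>1)) z
        = p0 \<bullet> fst (snd z (prod_chart c d)) + p1 \<bullet> snd (snd z (prod_chart c d))"
      using Tz by (simp add: pairing_Phi[OF \<alpha> z]) (simp add: \<alpha>0_def \<alpha>1_def cotvec_of_def pairing_def)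
    also have "\<dots> = pairing \<zeta> z"
      by (simp add: P.momentum[OF \<zeta> C z] p inner_prod_def)
    finally show ?thesis .
  qed
  then have "Phi M (\<alpha>0, \<alpha>1) = \<zeta>"
    by (rule cotangent_space_eqI[OF Phi_cotangent_space[OF \<alpha>] \<zeta>])
  then show ?thesis
    using that \<alpha> by blast
qed

end

section \<open>The tangent pairing\<close>

context C1_atlas
begin

text \<open>\<open>smooth_map\<close> asks for one pair of charts around each point, so the chart
  \<open>d\<close> alone decides, even on bundles known only to have differentiable
  transitions.\<close>

lemma smooth_map_affine_curve:
  assumes d: "d \<in> M" and I: "open I" "\<And>t. t \<in> I \<Longrightarrow> \<gamma> t \<in> fst d"
    and aff: "\<And>t. t \<in> I \<Longrightarrow> snd d (\<gamma> t) = a + t *\<^sub>R b"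
  shows "smooth_map real_atlas M I \<gamma>"
proof -
  interpret R: C1_atlas real_atlas by (rule C1_atlas_real)
  have op: "openin (manifold_topology real_atlas) I"
    using I(1) by (simp add: R.openin_manifold_topology) (simp add: points_def real_atlas_def)
  have "smooth_on I (snd d \<circ> \<gamma>)"
    using smooth_on_affine[of I a b] aff Ck_on_cong[OF I(1), of "\<lambda>t. a + t *\<^sub>R b" "snd d \<circ> \<gamma>"]
    by (simp add: smooth_on_def)
  then have s: "smooth_on (snd (UNIV, \<lambda>t. t) ` I) (snd d \<circ> \<gamma> \<circ> chart_inv (UNIV, \<lambda>t. t))"
    by (simp add: chart_inv_real o_def)
  show ?thesis
    unfolding smooth_map_def
  proof (intro conjI ballI)
    show "\<gamma> ` I \<subseteq> points M"
      using I(2) d by (auto simp: points_def)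
    fix t assume t: "t \<in> I"
    show "\<exists>c\<in>charts_at real_atlas t. \<exists>d\<in>charts_at M (\<gamma> t). \<exists>V.
        openin (manifold_topology real_atlas) V \<and> t \<in> V \<and> V \<subseteq> I \<inter> fst c \<and> \<gamma> ` V \<subseteq> fst d \<and>
        smooth_on (snd c ` V) (snd d \<circ> \<gamma> \<circ> chart_inv c)"
      using op t s I(2) d
      by (intro bexI[of _ "(UNIV, \<lambda>t. t)"] bexI[of _ d] exI[of _ I] conjI)
        (auto simp: charts_at_real charts_at_iff)
  qed (rule op)
qed

lemma velocity_affine_curve:
  assumes d: "d \<in> M" and I: "open I" "\<And>t. t \<in> I \<Longrightarrow> \<gamma> t \<in> fst d" "s \<in> I"
    and aff: "\<And>t. t \<in> I \<Longrightarrow> snd d (\<gamma> t) = a + t *\<^sub>R b"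
  shows "velocity M \<gamma> s = tvec_of M d (\<gamma> s) b"
proof (rule velocity_eq_tvec_of)
  show "d \<in> charts_at M (\<gamma> s)"
    using d I by (simp add: charts_at_iff)
  have ev: "\<forall>\<^sub>F t in nhds s. t \<in> I"
    using I by (simp add: eventually_nhds_in_open)
  then show "\<forall>\<^sub>F t in nhds s. \<gamma> t \<in> fst d"
    by eventually_elim (rule I(2))
  have "((\<lambda>t. a + t *\<^sub>R b) has_derivative (\<lambda>h. h *\<^sub>R b)) (at s)"
    by (auto intro!: derivative_eq_intros)
  then have "((snd d \<circ> \<gamma>) has_derivative (\<lambda>h. h *\<^sub>R b)) (at s)"
    by (rule has_derivative_eventually_cong) (use ev in \<open>eventually_elim, simp add: aff\<close>)
  then show "((snd d \<circ> \<gamma>) has_vector_derivative b) (at s)"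
    by (simp add: has_vector_derivative_def)
qed

end

context smooth_atlas_frame
begin

text \<open>The product rule for momentum times vector coordinate. The value involves the curves
  only through their positions and velocities at \<open>t\<close>, which gives uniqueness in the
  definition of the tangent pairing.\<close>

lemma tangent_pairing_derivative:
  assumes a: "a \<in> cotangent_space M x" and u: "u \<in> tangent_space M x" and c: "c \<in> charts_at M x"
    and I: "open I" "t \<in> I"
    and \<sigma>: "smooth_map real_atlas (cotangent_bundle M) I \<sigma>" "\<sigma> t = a"
    and \<gamma>: "smooth_map real_atlas (tangent_bundle M) I \<gamma>" "\<gamma> t = u"
    and base: "\<And>s. s \<in> I \<Longrightarrow> fst (\<sigma> s) = fst (\<gamma> s)"
  shows "((\<lambda>s. pairing (\<sigma> s) (\<gamma> s)) has_real_derivative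
    momentum M c a \<bullet> snd (snd (velocity (tangent_bundle M) \<gamma> t) (tangent_chart M c)) +
    snd (snd (velocity (cotangent_bundle M) \<sigma> t) (cotangent_chart M c)) \<bullet> snd u c) (at t)"
proof -
  interpret T: C1_atlas "tangent_bundle M" by (rule C1_atlas_tangent_bundle)
  interpret S: C1_atlas "cotangent_bundle M" by (rule C1_atlas_cotangent_bundle)
  have Cs: "cotangent_chart M c \<in> charts_at (cotangent_bundle M) (\<sigma> t)"
    using charts_at_cotangent_bundle[OF a] c \<sigma>(2) by simp
  have Ct: "tangent_chart M c \<in> charts_at (tangent_bundle M) (\<gamma> t)"
    using charts_at_tangent_bundle[OF u] c \<gamma>(2) by simp
  let ?s = "snd (velocity (cotangent_bundle M) \<sigma> t) (cotangent_chart M c)"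
  let ?g = "snd (velocity (tangent_bundle M) \<gamma> t) (tangent_chart M c)"
  have 1: "((\<lambda>s. snd (snd (cotangent_chart M c) (\<sigma> s))) has_derivative (\<lambda>h. h *\<^sub>R snd ?s)) (at t)"
    using has_derivative_snd[OF S.smooth_curve_has_vector_derivative(1)[OF \<sigma>(1) I(2) Cs,
        unfolded has_vector_derivative_def]] by simp
  have 2: "((\<lambda>s. snd (snd (tangent_chart M c) (\<gamma> s))) has_derivative (\<lambda>h. h *\<^sub>R snd ?g)) (at t)"
    using has_derivative_snd[OF T.smooth_curve_has_vector_derivative(1)[OF \<gamma>(1) I(2) Ct,
        unfolded has_vector_derivative_def]] by simp
  have "((\<lambda>s. momentum M c (\<sigma> s) \<bullet> snd (\<gamma> s) c) has_derivative
      (\<lambda>h. momentum M c a \<bullet> (h *\<^sub>R snd ?g) + (h *\<^sub>R snd ?s) \<bullet> snd u c)) (at t)"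
    using has_derivative_inner[OF 1 2] by (simp add: snd_cotangent_chart snd_tangent_chart \<sigma>(2) \<gamma>(2))
  moreover have "\<forall>\<^sub>F s in nhds t. momentum M c (\<sigma> s) \<bullet> snd (\<gamma> s) c = pairing (\<sigma> s) (\<gamma> s)"
    using S.smooth_curve_has_vector_derivative(2)[OF \<sigma>(1) I(2) Cs]
      T.smooth_curve_has_vector_derivative(2)[OF \<gamma>(1) I(2) Ct] eventually_nhds_in_open[OF I]
  proof eventually_elim
    case (elim s)
    then show ?case
      using c momentum[of "\<sigma> s" "fst (\<gamma> s)" c "\<gamma> s"] base[of s]
      by (simp add: in_cotangent_chart in_tangent_chart charts_at_iff)
  qed
  ultimately have "((\<lambda>s. pairing (\<sigma> s) (\<gamma> s)) has_derivative
      (\<lambda>h. momentum M c a \<bullet> (h *\<^sub>R snd ?g) + (h *\<^sub>R snd ?s) \<bullet> snd u c)) (at t)"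
    by (rule has_derivative_eventually_cong)
  then show ?thesis
    by (rule has_derivative_imp_has_field_derivative) (simp add: algebra_simps)
qed

text \<open>Existence comes from curves that are straight lines in the chart. The hypothesis
  \<open>base\<close> is the equality of the projected velocities in coordinates; it lets both lines
  lie over the same curve \<open>q\<close>.\<close>

lemma tangent_pairing_coord:
  assumes a: "a \<in> cotangent_space M x" and v: "v \<in> tangent_space (cotangent_bundle M) a"
    and u: "u \<in> tangent_space M x" and w: "w \<in> tangent_space (tangent_bundle M) u"
    and c: "c \<in> charts_at M x"
    and base: "fst (snd v (cotangent_chart M c)) = fst (snd w (tangent_chart M c))"
  shows "tangent_pairing M v w = momentum M c a \<bullet> snd (snd w (tangent_chart M c)) +
    snd (snd v (cotangent_chart M c)) \<bullet> snd u c"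
proof -
  interpret T: C1_atlas "tangent_bundle M" by (rule C1_atlas_tangent_bundle)
  interpret S: C1_atlas "cotangent_bundle M" by (rule C1_atlas_cotangent_bundle)
  have cM: "c \<in> M" "x \<in> fst c" using c by (simp_all add: charts_at_iff)
  have C: "cotangent_chart M c \<in> cotangent_bundle M" "tangent_chart M c \<in> tangent_bundle M"
    using cM by (simp_all add: cotangent_bundle_def tangent_bundle_def)
  obtain dq dp where v_eq: "snd v (cotangent_chart M c) = (dq, dp)" by fastforce
  obtain du where w_eq: "snd w (tangent_chart M c) = (dq, du)"
    using base v_eq by (metis fst_conv prod.collapse)
  define q where "q t = chart_inv c (snd c x + t *\<^sub>R dq)" for t
  define \<sigma> where "\<sigma> t = cotvec_of M c (q t) (momentum M c a + t *\<^sub>R dp)" for t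
  define \<gamma> where "\<gamma> t = tvec_of M c (q t) (snd u c + t *\<^sub>R du)" for t
  \<comment> \<open>The straight line represents points of the manifold only while it stays in the
    chart image, so the parameter interval is shrunk accordingly.\<close>
  have "open ((\<lambda>t. snd c x + t *\<^sub>R dq) -` (snd c ` fst c))"
    by (intro open_vimage open_chart_image cM continuous_intros)
  moreover have "0 \<in> (\<lambda>t. snd c x + t *\<^sub>R dq) -` (snd c ` fst c)"
    using cM by simp
  ultimately obtain \<delta> where \<delta>: "\<delta> > 0" "ball 0 \<delta> \<subseteq> (\<lambda>t. snd c x + t *\<^sub>R dq) -` (snd c ` fst c)"
    using open_contains_ball by blast
  let ?I = "ball (0::real) \<delta>"
  have q: "q t \<in> fst c" "snd c (q t) = snd c x + t *\<^sub>R dq" if "t \<in> ?I" for t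
  proof -
    obtain y where "y \<in> fst c" "snd c x + t *\<^sub>R dq = snd c y"
      using \<delta>(2) \<open>t \<in> ?I\<close> by blast
    then show "q t \<in> fst c" "snd c (q t) = snd c x + t *\<^sub>R dq"
      using chart_inv_chart[OF cM(1)] by (simp_all add: q_def)
  qed
  have qc: "c \<in> charts_at M (q t)" if "t \<in> ?I" for t
    using q[OF that] cM by (simp add: charts_at_iff)
  have \<sigma>f: "\<sigma> t \<in> fst (cotangent_chart M c)" "fst (\<sigma> t) = q t"
      "snd (cotangent_chart M c) (\<sigma> t) = (snd c x, momentum M c a) + t *\<^sub>R (dq, dp)" if "t \<in> ?I" for t
    using q[OF that] cotvec_of_cotangent_space[OF qc[OF that]]
      cotangent_space_fst[OF cotvec_of_cotangent_space[OF qc[OF that]]]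
    by (simp_all add: \<sigma>_def in_cotangent_chart snd_cotangent_chart momentum_cotvec_of[OF qc[OF that]])
  have \<gamma>f: "\<gamma> t \<in> fst (tangent_chart M c)" "fst (\<gamma> t) = q t"
      "snd (tangent_chart M c) (\<gamma> t) = (snd c x, snd u c) + t *\<^sub>R (dq, du)" if "t \<in> ?I" for t
    using q[OF that] tvec_of_tangent_space[OF qc[OF that]]
      tangent_space_fst[OF tvec_of_tangent_space[OF qc[OF that]]]
    by (simp_all add: \<gamma>_def in_tangent_chart snd_tangent_chart tvec_of_coord[OF qc[OF that]])
  have I0: "0 \<in> ?I" using \<delta>(1) by simp
  have q0: "q 0 = x"
    using chart_inv_chart[OF cM] by (simp add: q_def)
  have \<sigma>0: "\<sigma> 0 = a"
    by (rule cotangent_space_momentum_eqI[OF _ a c])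
      (simp_all add: \<sigma>_def q0 cotvec_of_cotangent_space[OF c] momentum_cotvec_of[OF c])
  have \<gamma>0: "\<gamma> 0 = u"
    by (rule tangent_space_eqI[OF _ u c])
      (simp_all add: \<gamma>_def q0 tvec_of_tangent_space[OF c] tvec_of_coord[OF c])
  have Cs: "cotangent_chart M c \<in> charts_at (cotangent_bundle M) a"
    using charts_at_cotangent_bundle[OF a] c by simp
  have Ct: "tangent_chart M c \<in> charts_at (tangent_bundle M) u"
    using charts_at_tangent_bundle[OF u] c by simp
  have sm: "smooth_map real_atlas (cotangent_bundle M) ?I \<sigma>"
    "smooth_map real_atlas (tangent_bundle M) ?I \<gamma>"
    by (rule S.smooth_map_affine_curve[OF C(1) open_ball \<sigma>f(1,3)], assumption+)
      (rule T.smooth_map_affine_curve[OF C(2) open_ball \<gamma>f(1,3)], assumption+)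
  have "velocity (cotangent_bundle M) \<sigma> 0 = tvec_of (cotangent_bundle M) (cotangent_chart M c) a (dq, dp)"
    using S.velocity_affine_curve[OF C(1) open_ball \<sigma>f(1) I0 \<sigma>f(3)] \<sigma>0 by simp
  also have "\<dots> = v"
    by (rule tangent_space_eqI[OF S.tvec_of_tangent_space[OF Cs] v Cs])
      (simp add: S.tvec_of_coord[OF Cs] v_eq)
  finally have v0: "velocity (cotangent_bundle M) \<sigma> 0 = v" .
  have "velocity (tangent_bundle M) \<gamma> 0 = tvec_of (tangent_bundle M) (tangent_chart M c) u (dq, du)"
    using T.velocity_affine_curve[OF C(2) open_ball \<gamma>f(1) I0 \<gamma>f(3)] \<gamma>0 by simp
  also have "\<dots> = w"
    by (rule tangent_space_eqI[OF T.tvec_of_tangent_space[OF Ct] w Ct])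
      (simp add: T.tvec_of_coord[OF Ct] w_eq)
  finally have w0: "velocity (tangent_bundle M) \<gamma> 0 = w" .
  have val: "((\<lambda>t. pairing (\<sigma> t) (\<gamma> t)) has_real_derivative
      momentum M c a \<bullet> snd (snd w (tangent_chart M c)) +
      snd (snd v (cotangent_chart M c)) \<bullet> snd u c) (at 0)"
    if "open I" "0 \<in> I" "smooth_map real_atlas (cotangent_bundle M) I \<sigma>"
      "smooth_map real_atlas (tangent_bundle M) I \<gamma>" "velocity (cotangent_bundle M) \<sigma> 0 = v"
      "velocity (tangent_bundle M) \<gamma> 0 = w" "\<forall>t\<in>I. fst (\<sigma> t) = fst (\<gamma> t)" for I \<sigma> \<gamma>
  proof -
    have "\<sigma> 0 = a" "\<gamma> 0 = u"
      using that(5,6) tangent_space_fst[OF v] tangent_space_fst[OF w] by (auto simp: velocity_def)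
    then show ?thesis
      using tangent_pairing_derivative[OF a u c that(1,2,3) _ that(4)] that(5,6,7) by simp
  qed
  show ?thesis
    unfolding tangent_pairing_def
  proof (rule the_equality)
    show "\<exists>I \<sigma> \<gamma>. is_interval I \<and> open I \<and> 0 \<in> I \<and>
        smooth_map real_atlas (cotangent_bundle M) I \<sigma> \<and>
        smooth_map real_atlas (tangent_bundle M) I \<gamma> \<and>
        velocity (cotangent_bundle M) \<sigma> 0 = v \<and> velocity (tangent_bundle M) \<gamma> 0 = w \<and>
        (\<forall>t\<in>I. fst (\<sigma> t) = fst (\<gamma> t)) \<and>
        ((\<lambda>t. pairing (\<sigma> t) (\<gamma> t)) has_real_derivative
          momentum M c a \<bullet> snd (snd w (tangent_chart M c)) +
          snd (snd v (cotangent_chart M c)) \<bullet> snd u c) (at 0)"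
      using val[OF open_ball I0 sm v0 w0] sm v0 w0 I0 \<sigma>f(2) \<gamma>f(2)
      by (intro exI[of _ ?I] exI[of _ \<sigma>] exI[of _ \<gamma>] conjI) (simp_all add: is_interval_ball_real)
  next
    fix d assume "\<exists>I \<sigma> \<gamma>. is_interval I \<and> open I \<and> 0 \<in> I \<and>
        smooth_map real_atlas (cotangent_bundle M) I \<sigma> \<and>
        smooth_map real_atlas (tangent_bundle M) I \<gamma> \<and>
        velocity (cotangent_bundle M) \<sigma> 0 = v \<and> velocity (tangent_bundle M) \<gamma> 0 = w \<and>
        (\<forall>t\<in>I. fst (\<sigma> t) = fst (\<gamma> t)) \<and>
        ((\<lambda>t. pairing (\<sigma> t) (\<gamma> t)) has_real_derivative d) (at 0)"
    then show "d = momentum M c a \<bullet> snd (snd w (tangent_chart M c)) +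
        snd (snd v (cotangent_chart M c)) \<bullet> snd u c"
      using val DERIV_unique by blast
  qed
qed

text \<open>In the induced chart the projection reads \<open>fst\<close>, a linear map equal to its
  own derivative. Thus the projected vector has coordinate dq, just like the foot point of the
  canonical involution of \<open>w\<close>.\<close>

lemma tangent_map_projection:
  assumes u: "u \<in> tangent_space M x" and w: "w \<in> tangent_space (tangent_bundle M) u"
    and c: "c \<in> charts_at M x"
  shows "tangent_map (tangent_bundle M) M fst w \<in> tangent_space M x"
    and "snd (tangent_map (tangent_bundle M) M fst w) c = fst (snd w (tangent_chart M c))"
proof -
  interpret T: C1_atlas "tangent_bundle M" by (rule C1_atlas_tangent_bundle)
  interpret TM: C1_atlas_pair "tangent_bundle M" M
    by (rule C1_atlas_pair.intro[OF C1_atlas_tangent_bundle C1_atlas_axioms])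
  have C: "tangent_chart M c \<in> charts_at (tangent_bundle M) u"
    using charts_at_tangent_bundle[OF u] c by simp
  have loc: "has_local_derivative (tangent_bundle M) M fst u (tangent_chart M c) c fst"
  proof (rule T.has_local_derivativeI[OF C, where A = "fst (tangent_chart M c)"])
    show "openin (manifold_topology (tangent_bundle M)) (fst (tangent_chart M c))"
      using C by (intro T.openin_chart) (simp add: charts_at_iff)
    show "(fst has_derivative fst) (at (snd (tangent_chart M c) u))"
      by (rule bounded_linear_imp_has_derivative[OF bounded_linear_fst])
    show "c \<in> charts_at M (fst u)"
      using c tangent_space_fst[OF u] by simp
    show "u \<in> fst (tangent_chart M c)"
      using C by (simp add: charts_at_iff)
    show "fst ` fst (tangent_chart M c) \<subseteq> fst c"
      by (auto simp: in_tangent_chart)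
  qed (simp_all add: snd_tangent_chart)
  show "tangent_map (tangent_bundle M) M fst w \<in> tangent_space M x"
    and "snd (tangent_map (tangent_bundle M) M fst w) c = fst (snd w (tangent_chart M c))"
    using TM.tangent_map[OF loc w] tangent_space_fst[OF u] by simp_all
qed

end

section \<open>The identity between the two pairings\<close>

lemma smooth_manifold_frame:
  fixes Q :: "('q, 'e::real_inner) atlas"
  assumes "smooth_manifold Q"
  obtains B g where "smooth_atlas_frame Q B g"
proof -
  obtain A :: "'e set" where A: "finite A" "span A = UNIV"
    using assms by (auto simp: smooth_manifold_def)
  obtain B :: "'e set" and g where fr: "dual_frame B g"
    by (rule dual_frame_exists[OF A])
  have Q: "smooth_atlas Q"
    using assms by (simp add: smooth_manifold_def)
  have "C1_atlas Q"
  proof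
    fix c c' x assume c: "c \<in> Q" "c' \<in> Q" "x \<in> fst c" "x \<in> fst c'"
    have "smooth_on (snd c ` (fst c \<inter> fst c')) (snd c' \<circ> chart_inv c)"
      using Q c(1,2) unfolding smooth_atlas_def by blast
    from smooth_on_has_derivative[OF this, of "snd c x"] c
    show "(snd c' \<circ> chart_inv c) differentiable (at (snd c x))"
      unfolding differentiable_def by blast
  qed (use Q in \<open>unfold smooth_atlas_def, blast+\<close>)
  moreover have "smooth_on (snd c ` (fst c \<inter> fst c')) (snd c' \<circ> chart_inv c)"
    if "c \<in> Q" "c' \<in> Q" for c c'
    using Q that unfolding smooth_atlas_def by blast
  ultimately have "smooth_atlas_frame Q B g"
    using fr by (intro smooth_atlas_frame.intro C1_atlas_frame.intro C1_atlas_frame_axioms.intro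
        smooth_atlas_frame_axioms.intro)
  then show ?thesis by (rule that)
qed

theorem proposition3p8:
  fixes Q :: "('q, 'e::real_inner) atlas"
    and R :: "('q, 'e) tvec \<Rightarrow> 'q \<times> 'q"
    and U V :: "('q, 'e) tvec set"
    and q0 q1 :: 'q
    and \<alpha>0 \<alpha>1 :: "('q, 'e) cotvec"
    and w :: "(('q, 'e) tvec, 'e \<times> 'e) tvec"
  assumes "smooth_manifold Q"
    and "discretization_map Q U R"
    and "V \<subseteq> U"
    and "diffeomorphism_on (tangent_bundle Q) (prod_atlas Q Q) V R"
    and "(q0, q1) \<in> R ` V"
    and "\<alpha>0 \<in> cotangent_space Q q0"
    and "\<alpha>1 \<in> cotangent_space Q q1"
    and "w \<in> points (tangent_bundle (tangent_bundle Q))"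
    and "inv_into V R (q0, q1) = tangent_map (tangent_bundle Q) Q fst w"
  shows "pairing (Phi Q (\<alpha>0, \<alpha>1)) (tangent_lift Q R w) =
         tangent_pairing Q
           (inv_into (cotangent_lift_domain Q V) (cotangent_lift Q R) (\<alpha>0, \<alpha>1)) w"
proof -
  obtain B g where "smooth_atlas_frame Q B g"
    by (rule smooth_manifold_frame[OF assms(1)])
  then interpret Q: smooth_atlas_frame Q B g .
  obtain B' g' where "C1_atlas_frame (tangent_bundle Q) B' g'"
    by (rule Q.tangent_bundle_frame)
  then interpret T: C1_atlas_frame "tangent_bundle Q" B' g' .
  interpret S: C1_atlas "cotangent_bundle Q" by (rule Q.C1_atlas_cotangent_bundle)
  interpret P: C1_atlas "prod_atlas Q Q" by (rule Q.C1_atlas_square)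
  let ?TQ = "tangent_bundle Q" and ?QQ = "prod_atlas Q Q"
  let ?TR = "tangent_map ?TQ ?QQ R" and ?\<Phi> = "Phi Q (\<alpha>0, \<alpha>1)"
  interpret TP: C1_atlas_pair ?TQ ?QQ
    by (rule C1_atlas_pair.intro[OF T.C1_atlas_axioms P.C1_atlas_axioms])
  note R = T.C1_atlas_axioms P.C1_atlas_axioms assms(4)

  define y where "y = inv_into V R (q0, q1)"
  have y: "y \<in> V" "R y = (q0, q1)"
    using assms(5) by (auto simp: y_def inv_into_into f_inv_into_f)
  define u where "u = fst w"
  define x where "x = fst u"
  have w: "w \<in> tangent_space ?TQ u"
    using assms(8) by (simp add: T.points_tangent_bundle u_def)
  have u: "u \<in> tangent_space Q x"
    using tangent_space_points[OF w] by (simp add: Q.points_tangent_bundle x_def)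
  obtain c where c: "c \<in> charts_at Q x"
    using Q.points_charts_at[OF tangent_space_points[OF u]] by blast
  have yx: "y \<in> tangent_space Q x" and yc: "snd y c = fst (snd w (tangent_chart Q c))"
    using Q.tangent_map_projection[OF u w c] assms(9) by (simp_all add: y_def)
  define k where "k = canonical_involution Q w"
  obtain y' where y': "y' \<in> tangent_space Q x" "k \<in> tangent_space ?TQ y'"
    and y'c: "\<And>c. c \<in> charts_at Q x \<Longrightarrow> snd y' c = fst (snd w (tangent_chart Q c))"
    and kc: "\<And>c. c \<in> charts_at Q x \<Longrightarrow> snd k (tangent_chart Q c)
           = (snd u c, snd (snd w (tangent_chart Q c)))"
    by (rule Q.canonical_involution[OF u w, folded k_def], rule that)
  \<comment> \<open>The involution of \<open>w\<close> sits over the projected vector, which the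
    last hypothesis identifies with the inverse image of the pair of points; so the tangent map of
    \<open>R\<close> is taken at \<open>y\<close>.\<close>
  have "y' = y"
    by (rule tangent_space_eqI[OF y'(1) yx c]) (simp add: y'c[OF c] yc)
  then have k: "k \<in> tangent_space ?TQ y"
    using y'(2) by simp

  have \<Phi>: "?\<Phi> \<in> cotangent_space ?QQ (R y)"
    using Q.Phi_cotangent_space[OF assms(6,7)] y(2) by simp
  obtain e d D where loc: "has_local_derivative ?TQ ?QQ R y e d D"
    using diffeomorphism_tangent_map_local[OF R y(1)] by blast
  note bij = diffeomorphism_tangent_map_bij[OF R y(1)]
  \<comment> \<open>The pullback of the covector on the square along the tangent map of
    \<open>R\<close> at \<open>y\<close>, extended by 0 as covectors must be. Its preimage under
    \<open>alpha_map\<close> witnesses that the pair of covectors is in the image of the cotangent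
    lift.\<close>
  define \<beta> where "\<beta> = (y, \<lambda>z. if z \<in> tangent_space ?TQ y then pairing ?\<Phi> (?TR z) else 0)"
  have \<beta>: "\<beta> \<in> cotangent_space ?TQ y"
    unfolding cotangent_space_iff
  proof (intro conjI allI impI ballI)
    show "y \<in> points ?TQ"
      by (rule tangent_space_points[OF k])
    fix z assume z: "z \<in> tangent_space ?TQ y"
    note Tz = TP.tangent_map_tangent_space[OF loc]
    show "pairing \<beta> (tvec_add z z') = pairing \<beta> z + pairing \<beta> z'" if z': "z' \<in> tangent_space ?TQ y" for z'
      using \<Phi> Tz[OF z] Tz[OF z'] z z' T.tvec_add_tangent_space[OF z z']
      unfolding cotangent_space_iff
      by (simp add: \<beta>_def pairing_def TP.tangent_map_add[OF loc z z'])
    show "pairing \<beta> (tvec_scale r z) = r * pairing \<beta> z" for r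
      using \<Phi> Tz[OF z] z T.tvec_scale_tangent_space[OF z]
      unfolding cotangent_space_iff
      by (simp add: \<beta>_def pairing_def TP.tangent_map_scale[OF loc z])
  qed (simp_all add: \<beta>_def pairing_def)
  have push_\<beta>: "cotangent_push ?TQ ?QQ R \<beta> = ?\<Phi>"
  proof (rule cotangent_space_eqI[OF cotangent_push_cotangent_space[OF R y(1) \<beta>] \<Phi>])
    fix z assume "z \<in> tangent_space ?QQ (R y)"
    then have "z \<in> ?TR ` tangent_space ?TQ y"
      by (simp only: bij_betw_imp_surj_on[OF bij])
    then obtain v where v: "v \<in> tangent_space ?TQ y" "z = ?TR v" by blast
    show "pairing (cotangent_push ?TQ ?QQ R \<beta>) z = pairing ?\<Phi> z"
      using pairing_cotangent_push[OF R y(1) \<beta> v(1)] v by (simp add: \<beta>_def pairing_def)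
  qed
  have inj: "inj_on (Phi Q) (points (cotangent_bundle Q) \<times> points (cotangent_bundle Q))"
    using Q.Phi_inj by (auto simp: inj_on_def Q.points_cotangent_bundle)
  obtain a0 v0 where v0: "a0 \<in> cotangent_space Q x" "v0 \<in> tangent_space (cotangent_bundle Q) a0"
    "alpha_map Q v0 = \<beta>"
    by (rule Q.alpha_map_surj[OF yx \<beta>])
  have "v0 \<in> cotangent_lift_domain Q V"
    using v0 y(1) tangent_space_fst[OF v0(2)]
    by (simp add: cotangent_lift_domain_def S.points_tangent_bundle \<beta>_def)
  moreover have "cotangent_lift Q R v0 = (\<alpha>0, \<alpha>1)"
    unfolding cotangent_lift_def v0(3) push_\<beta>
    using assms(6,7) by (intro inv_into_f_f[OF inj])
      (simp add: Q.points_cotangent_bundle cotangent_space_fst)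
  ultimately have im: "(\<alpha>0, \<alpha>1) \<in> cotangent_lift Q R ` cotangent_lift_domain Q V"
    by (metis imageI)

  \<comment> \<open>From here on \<open>v\<close> is the selected preimage, about which only its
    membership in the domain and its image are known.\<close>
  define v where "v = inv_into (cotangent_lift_domain Q V) (cotangent_lift Q R) (\<alpha>0, \<alpha>1)"
  have v: "v \<in> cotangent_lift_domain Q V" "cotangent_lift Q R v = (\<alpha>0, \<alpha>1)"
    unfolding v_def by (rule inv_into_into[OF im], rule f_inv_into_f[OF im])
  define a where "a = fst v"
  have va: "v \<in> tangent_space (cotangent_bundle Q) a"
    using v(1) by (simp add: cotangent_lift_domain_def S.points_tangent_bundle a_def)
  define x' where "x' = fst a"
  have a: "a \<in> cotangent_space Q x'"
    using tangent_space_points[OF va] by (simp add: Q.points_cotangent_bundle x'_def)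
  define \<zeta> where "\<zeta> = alpha_map Q v"
  obtain z where z: "z \<in> tangent_space Q x'" "\<zeta> \<in> cotangent_space ?TQ z"
    and zc: "\<And>c. c \<in> charts_at Q x' \<Longrightarrow> snd z c = fst (snd v (cotangent_chart Q c))"
    and mc: "\<And>c. c \<in> charts_at Q x' \<Longrightarrow> momentum ?TQ (tangent_chart Q c) \<zeta>
           = (snd (snd v (cotangent_chart Q c)), momentum Q c a)"
    by (rule Q.alpha_map[OF a va, folded \<zeta>_def], rule that)
  have zV: "z \<in> V"
    using v(1) cotangent_space_fst[OF z(2)] by (simp add: cotangent_lift_domain_def \<zeta>_def)
  have push_\<zeta>: "cotangent_push ?TQ ?QQ R \<zeta> \<in> cotangent_space ?QQ (R z)"
    by (rule cotangent_push_cotangent_space[OF R zV z(2)])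
  \<comment> \<open>\<open>cotangent_lift\<close> inverts \<open>Phi\<close> by
    \<open>inv_into\<close>, which can be undone only once the pushed covector is known to be a
    value of \<open>Phi\<close>.\<close>
  obtain \<beta>0 \<beta>1 where \<beta>01: "\<beta>0 \<in> cotangent_space Q (fst (R z))" "\<beta>1 \<in> cotangent_space Q (snd (R z))"
    "Phi Q (\<beta>0, \<beta>1) = cotangent_push ?TQ ?QQ R \<zeta>"
    using Q.Phi_surj[of _ "fst (R z)" "snd (R z)"] push_\<zeta> by (metis prod.collapse)
  have "Phi Q (cotangent_lift Q R v) = cotangent_push ?TQ ?QQ R \<zeta>"
    unfolding cotangent_lift_def \<zeta>_def[symmetric]
  proof (rule f_inv_into_f)
    have "(\<beta>0, \<beta>1) \<in> points (cotangent_bundle Q) \<times> points (cotangent_bundle Q)"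
      using \<beta>01(1,2) by (simp add: Q.points_cotangent_bundle cotangent_space_fst)
    then show "cotangent_push ?TQ ?QQ R \<zeta>
        \<in> Phi Q ` (points (cotangent_bundle Q) \<times> points (cotangent_bundle Q))"
      using \<beta>01(3) by (metis imageI)
  qed
  then have \<Phi>_eq: "?\<Phi> = cotangent_push ?TQ ?QQ R \<zeta>"
    by (simp add: v(2))
  have "R z = R y"
    using cotangent_space_fst[OF push_\<zeta>] cotangent_space_fst[OF \<Phi>] \<Phi>_eq by simp
  \<comment> \<open>Both points lie in \<open>V\<close>, where \<open>R\<close> is injective; the
    foot point of the covector of \<open>v\<close> is therefore the expected one.\<close>
  then have "z = y"
    using assms(4) zV y(1) by (auto simp: diffeomorphism_on_def dest: inj_onD)
  then have x': "x' = x"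
    using tangent_space_fst[OF z(1)] tangent_space_fst[OF yx] by simp
  have \<zeta>: "\<zeta> \<in> cotangent_space ?TQ y"
    using z(2) \<open>z = y\<close> by simp
  have c': "tangent_chart Q c \<in> charts_at ?TQ y"
    using Q.charts_at_tangent_bundle[OF yx] c by simp

  \<comment> \<open>The inverse tangent map inside the push-forward cancels the tangent map in the
    tangent lift.\<close>
  have "pairing ?\<Phi> (tangent_lift Q R w) = pairing \<zeta> k"
    unfolding \<Phi>_eq tangent_lift_def k_def[symmetric]
    by (rule pairing_cotangent_push[OF R y(1) \<zeta> k])
  also have "\<dots> = snd (snd v (cotangent_chart Q c)) \<bullet> snd u c
      + momentum Q c a \<bullet> snd (snd w (tangent_chart Q c))"
    using mc[of c] kc[OF c] c by (simp add: T.momentum[OF \<zeta> c' k] x')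
  \<comment> \<open>The base condition holds because the base parts of \<open>v\<close> and of
    \<open>w\<close> are both the coordinate of \<open>y\<close> in \<open>c\<close>.\<close>
  also have "\<dots> = tangent_pairing Q v w"
    using Q.tangent_pairing_coord[OF a[unfolded x'] va u w c] zc[of c] yc c \<open>z = y\<close> x' by simp
  finally show ?thesis
    by (simp add: v_def)
qed

end
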